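(* Let $B_H=\{B_H(t)\}_{t\in\mathbb{R}}$ be an $\mathbb{R}^n$-valued time-reversible operator fractional Brownian motion, with wavelet coefficients $D(2^j,k)$, sample wavelet variances $W(2^j)$ and $K_j=\nu/2^j$ as described in the context. As $\nu\to\infty$, for every pair of octaves $j,j'$: (i) $$\sqrt{K_j}\sqrt{K_{j'}}\frac1{K_j}\frac1{K_{j'}}\sum_{k=1}^{K_j}\sum_{k'=1}^{K_{j'}}ED(2^j,k)D(2^{j'},k')^*\otimes ED(2^j,k)D(2^{j'},k')^*$$ $$\to\ 2^{-(j+j')/2}\gcd(2^j,2^{j'})\sum_{z=-\infty}^\infty\Omega_{j,j'}(z)\otimes\Omega_{j,j'}(z),$$ where $$\Omega_{j,j'}(z):=-\frac12\int_{\mathbb{R}}\int_{\mathbb{R}}\psi(t)\psi(t')\,|2^jt-2^{j'}t'+z\gcd(2^j,2^{j'})|^H\,\Sigma\,|2^jt-2^{j'}t'+z\gcd(2^j,2^{j'})|^{H^*}dt'dt;$$ (ii) there is a matrix $G_{jj'}\in M(n(n+1)/2,\mathbb{R})$, not necessarily symmetric, such that $$\sqrt{K_j}\sqrt{K_{j'}}\,\mathrm{Cov}\big(\mathrm{vec}_{\mathcal S}W(2^j),\mathrm{vec}_{\mathcal S}W(2^{j'})\big)\to G_{jj'},$$ where the entry of $G_{jj'}$ corresponding to the entry $(i_1,i_2)$ of $W(2^j)$ and the entry $(l_1,l_2)$ of $W(2^{j'})$ ($i_1\le i_2$, $l_1\le l_2$) is $$2^{-(j+j')/2}\gcd(2^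j,2^{j'})\sum_{z=-\infty}^\infty\big[\Omega_{j,j'}(z)_{i_1l_1}\Omega_{j,j'}(z)_{i_2l_2}+\Omega_{j,j'}(z)_{i_1l_2}\Omega_{j,j'}(z)_{i_2l_1}\big].$$
   Context: Matrix conventions: $\otimes$ is the Kronecker product; $^*$ is (Hermitian) transposition; $c^M=\exp(\log(c)M)$ for $c>0$; $x_\pm=\max\{\pm x,0\}$, and $x_\pm^{-D}$ is read as the zero matrix when $x_\pm=0$; $|0|^H\Sigma|0|^{H^*}=0$. For a real symmetric $n\times n$ matrix $S$, $\mathrm{vec}_{\mathcal S}(S)=(s_{11},s_{12},\dots,s_{1n};s_{22},\dots,s_{2n};\dots;s_{nn})^*$. $\mathrm{Cov}(U,V)$ is the matrix with entries $\mathrm{Cov}(U_p,V_q)$. Operator fractional Brownian motion (OFBM), $n\ge2$. $B_H$ is the $\mathbb{R}^n$-valued centered Gaussian process with finite-dimensional distributions those of $\int_{\mathbb{R}}\frac{e^{itx}-1}{ix}(x_+^{-D}A+x_-^{-D}\overline A)\widetilde B(dx)$, where $H\in M(n,\mathbb{R})$, $D=H-\frac12I$, $A\in M(n,\mathbb{C})$, and $\widetilde B(dx)$ is a complex Gaussian random measure with $\widetilde B(-dx)=\overline{\widetilde B(dx)}$, $E\widetilde B(dx)\widetilde B(dx)^*=dx\,I$. Assumptions: all eigenvalues $h_k$ of $H$ satisfy $0<\Re(h_k)<1$; $\Re(AA^* )$ has full rank; $\Im(AA^* )=0$ (time reversibility). Put $\Sigma=EB_H(1)B_H(1)^*$. Wavelet.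 $\psi\in L^1(\mathbb{R})$ is real-valued with $\int\psi^2=1$, $\int t^q\psi(t)dt=0$ for $q=0,\dots,N_\psi-1$, $N_\psi\ge2$; $\mathrm{supp}(\psi)$ is a compact interval; $\sup_x|\widehat\psi(x)|(1+|x|)^\alpha<\infty$ for some $\alpha>1$. Wavelet coefficients: $D(2^j,k)=\int_{\mathbb{R}}\psi(z)B_H(2^jz+2^jk)dz$ (mean-square sense), $j\in\mathbb{N}\cup\{0\}$, $k\in\mathbb{Z}$; with $\nu$ (number of data points) a power of $2$ and $K_j=\nu/2^j$, $W(2^j)=\frac1{K_j}\sum_{k=1}^{K_j}D(2^j,k)D(2^j,k)^*$. *)

theory Defs
  imports "HOL-Probability.Probability"
begin

section \<open>Matrices\<close>

definition adjoint_matrix :: "complex^'n^'m \<Rightarrow> complex^'m^'n" where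
  "adjoint_matrix A = transpose (map_matrix cnj A)"

definition conj_vec :: "complex^'n \<Rightarrow> complex^'n" where
  "conj_vec u = (\<chi> i. cnj (u $ i))"

definition complex_vec :: "real^'n \<Rightarrow> complex^'n" where
  "complex_vec u = (\<chi> i. complex_of_real (u $ i))"

abbreviation complex_matrix :: "real^'n^'m \<Rightarrow> complex^'n^'m" where
  "complex_matrix \<equiv> map_matrix complex_of_real"

(* outer u v is the matrix u v^T; for complex vectors u v^* is outer u (conj_vec v) *)
definition outer :: "'a::times^'n \<Rightarrow> 'a^'m \<Rightarrow> 'a^'m^'n" where
  "outer u v = (\<chi> i k. u $ i * v $ k)"

definition kronecker :: "real^'n^'m \<Rightarrow> real^'q^'p \<Rightarrow> real^('n \<times> 'q)^('m \<times> 'p)" where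
  "kronecker A C = (\<chi> r s. A $ fst r $ fst s * C $ snd r $ snd s)"

definition is_eigenvalue :: "complex^'n^'n \<Rightarrow> complex \<Rightarrow> bool" where
  "is_eigenvalue M h \<longleftrightarrow> (\<exists>v. v \<noteq> 0 \<and> M *v v = h *s v)"

(* The type class product on real^'n^'n is entrywise, so the library's exp cannot be used. *)
definition mat_exp :: "real^'n^'n \<Rightarrow> real^'n^'n" where
  "mat_exp M = (\<Sum>k. (1 / fact k) *\<^sub>R (((\<lambda>X. M ** X) ^^ k) (mat 1)))"

(* c^M for c > 0, with the convention that 0^M is the zero matrix; this gives both
   x_+^(-D) = 0 for x_+ = 0 and |0|^H S |0|^(H^* ) = 0 *)
definition mat_powr :: "real \<Rightarrow> real^'n^'n \<Rightarrow> real^'n^'n" where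
  "mat_powr c M = (if c = 0 then 0 else mat_exp (ln c *\<^sub>R M))"

(* Positions (i,k) with i \<le> k in the upper triangle; they label the n(n+1)/2 coordinates
   of vec_S *)
typedef (overloaded) 'n upper_idx = "{(i::'n::{finite,linorder}, k). i \<le> k}"
  by auto

instance upper_idx :: ("{finite,linorder}") finite
proof
  have "inj (Rep_upper_idx :: 'a upper_idx \<Rightarrow> 'a \<times> 'a)"
    by (simp add: inj_def Rep_upper_idx_inject)
  then show "finite (UNIV :: 'a upper_idx set)"
    using finite_imageD finite by blast
qed

definition vec_S ::
  "real^('n::{finite,linorder})^('n::{finite,linorder}) \<Rightarrow> real^('n::{finite,linorder}) upper_idx" where
  "vec_S S = (\<chi> r. S $ fst (Rep_upper_idx r) $ snd (Rep_upper_idx r))"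

section \<open>Mean-square convergence and Gaussian families\<close>

definition L2_fun :: "'a measure \<Rightarrow> ('a \<Rightarrow> 'b::real_normed_vector) \<Rightarrow> bool" where
  "L2_fun M X \<longleftrightarrow> X \<in> borel_measurable M \<and> integrable M (\<lambda>w. (norm (X w))\<^sup>2)"

definition L2_norm :: "'a measure \<Rightarrow> ('a \<Rightarrow> 'b::real_normed_vector) \<Rightarrow> real" where
  "L2_norm M X = sqrt (\<integral>w. (norm (X w))\<^sup>2 \<partial>M)"

definition L2_tendsto ::
  "'a measure \<Rightarrow> (nat \<Rightarrow> 'a \<Rightarrow> 'b::real_normed_vector) \<Rightarrow> ('a \<Rightarrow> 'b) \<Rightarrow> bool" where
  "L2_tendsto M X Y \<longleftrightarrow>
     (\<forall>m. L2_fun M (X m)) \<and> L2_fun M Y \<and> (\<lambda>m. L2_norm M (\<lambda>w. X m w - Y w)) \<longlonglongrightarrow> 0"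

(* degenerate case included *)
definition centered_gaussian :: "'a measure \<Rightarrow> ('a \<Rightarrow> real) \<Rightarrow> bool" where
  "centered_gaussian M X \<longleftrightarrow> X \<in> borel_measurable M \<and>
     (distr M borel X = return borel 0 \<or>
      (\<exists>\<sigma>>0. distr M borel X = density lborel (\<lambda>x. ennreal (normal_density 0 \<sigma> x))))"

(* For 'b = complex^'n the inner product is the real one, Re (c^* X), so this is joint
   Gaussianity of all real and imaginary parts. *)
definition centered_gaussian_family ::
  "'a measure \<Rightarrow> 'i set \<Rightarrow> ('i \<Rightarrow> 'a \<Rightarrow> 'b::real_inner) \<Rightarrow> bool" where
  "centered_gaussian_family M I X \<longleftrightarrow>
     (\<forall>i\<in>I. X i \<in> borel_measurable M) \<and>
     (\<forall>F c. finite F \<and> F \<subseteq> I \<longrightarrow> centered_gaussian M (\<lambda>w. \<Sum>i\<in>F. c i \<bullet> X i w))"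

(* The mean-square integral of f over the real line: the Bochner integral of the map
   z \<mapsto> f z with values in L^2(M), defined through L^2(M)-valued step functions.
   A step function is a list of pairs (set, value). *)
definition has_ms_integral ::
  "'a measure \<Rightarrow> (real \<Rightarrow> 'a \<Rightarrow> 'b::real_normed_vector) \<Rightarrow> ('a \<Rightarrow> 'b) \<Rightarrow> bool" where
  "has_ms_integral M f X \<longleftrightarrow> (\<forall>z. L2_fun M (f z)) \<and>
     (\<exists>S :: nat \<Rightarrow> (real set \<times> ('a \<Rightarrow> 'b)) list.
        (\<forall>m. \<forall>(E, Y) \<in> set (S m). E \<in> fmeasurable lborel \<and> L2_fun M Y) \<and>
        (\<forall>m. integrable lborel
           (\<lambda>z. L2_norm M (\<lambda>w. f z w - (\<Sum>(E, Y)\<leftarrow>S m. indicat_real E z *\<^sub>R Y w)))) \<and>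
        (\<lambda>m. \<integral>z. L2_norm M (\<lambda>w. f z w - (\<Sum>(E, Y)\<leftarrow>S m. indicat_real E z *\<^sub>R Y w)) \<partial>lborel)
          \<longlonglongrightarrow> 0 \<and>
        L2_tendsto M (\<lambda>m w. \<Sum>(E, Y)\<leftarrow>S m. measure lborel E *\<^sub>R Y w) X)"

section \<open>Complex Gaussian random measures\<close>

(* A C^n-valued centered Gaussian random measure on the Borel sets of finite Lebesgue measure
   with Bt(-dx) = conj Bt(dx) and E Bt(dx) Bt(dx)^* = dx I *)
definition gaussian_random_measure ::
  "'v measure \<Rightarrow> (real set \<Rightarrow> 'v \<Rightarrow> complex^'n) \<Rightarrow> bool" where
  "gaussian_random_measure N Bt \<longleftrightarrow> prob_space N \<and>
     centered_gaussian_family N (fmeasurable lborel) Bt \<and>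
     (\<forall>E :: nat \<Rightarrow> real set. disjoint_family E \<and> range E \<subseteq> fmeasurable lborel \<and>
        (\<Union>i. E i) \<in> fmeasurable lborel \<longrightarrow>
        L2_tendsto N (\<lambda>m w. \<Sum>i<m. Bt (E i) w) (Bt (\<Union>i. E i))) \<and>
     (\<forall>E \<in> fmeasurable lborel. AE w in N. Bt (uminus ` E) w = conj_vec (Bt E w)) \<and>
     (\<forall>E \<in> fmeasurable lborel. \<forall>F \<in> fmeasurable lborel.
        (\<integral>w. outer (Bt E w) (conj_vec (Bt F w)) \<partial>N)
          = mat (complex_of_real (measure lborel (E \<inter> F))))"

(* X is the integral of the matrix function f with respect to Bt: the isometric extension of
   the integral of step functions (lists of pairs (set, value)) *)
definition has_gaussian_integral ::
  "'v measure \<Rightarrow> (real set \<Rightarrow> 'v \<Rightarrow> complex^'n) \<Rightarrow> (real \<Rightarrow> complex^'n^'n) \<Rightarrow>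
   ('v \<Rightarrow> complex^'n) \<Rightarrow> bool" where
  "has_gaussian_integral N Bt f X \<longleftrightarrow>
     (\<exists>S :: nat \<Rightarrow> (real set \<times> (complex^'n^'n)) list.
        (\<forall>m. \<forall>(E, C) \<in> set (S m). E \<in> fmeasurable lborel) \<and>
        L2_tendsto lborel (\<lambda>m x. \<Sum>(E, C)\<leftarrow>S m. indicat_real E x *\<^sub>R C) f \<and>
        L2_tendsto N (\<lambda>m w. \<Sum>(E, C)\<leftarrow>S m. C *v Bt E w) X)"

section \<open>Operator fractional Brownian motion\<close>

definition ofbm_kernel ::
  "real^'n^'n \<Rightarrow> complex^'n^'n \<Rightarrow> real \<Rightarrow> real \<Rightarrow> complex^'n^'n" where
  "ofbm_kernel H A t x =
     (let D = H - (1/2) *\<^sub>R mat 1 in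
      map_matrix (\<lambda>z. (exp (\<i> * of_real (t * x)) - 1) / (\<i> * of_real x) * z)
        (complex_matrix (mat_powr (max x 0) (- D)) ** A
         + complex_matrix (mat_powr (max (- x) 0) (- D)) ** map_matrix cnj A))"

definition same_fdd ::
  "'w measure \<Rightarrow> (real \<Rightarrow> 'w \<Rightarrow> 'b::topological_space) \<Rightarrow> 'v measure \<Rightarrow> (real \<Rightarrow> 'v \<Rightarrow> 'b) \<Rightarrow> bool"
where
  "same_fdd M X N Y \<longleftrightarrow> (\<forall>t. X t \<in> borel_measurable M) \<and> (\<forall>t. Y t \<in> borel_measurable N) \<and>
     (\<forall>T. finite T \<longrightarrow>
        distr M (\<Pi>\<^sub>M t\<in>T. borel) (\<lambda>w. \<lambda>t\<in>T. X t w) =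
        distr N (\<Pi>\<^sub>M t\<in>T. borel) (\<lambda>w. \<lambda>t\<in>T. Y t w))"

(* B, on M, has the law of the integral with respect to a random measure Bt on some
   (possibly different) probability space N. That integral is real-valued almost surely;
   Y is a real-valued version of it. *)
definition is_ofbm ::
  "'w measure \<Rightarrow> (real \<Rightarrow> 'w \<Rightarrow> real^'n) \<Rightarrow> 'v measure \<Rightarrow> (real set \<Rightarrow> 'v \<Rightarrow> complex^'n) \<Rightarrow>
   real^'n^'n \<Rightarrow> complex^'n^'n \<Rightarrow> bool" where
  "is_ofbm M B N Bt H A \<longleftrightarrow>
     (\<forall>h. is_eigenvalue (complex_matrix H) h \<longrightarrow> 0 < Re h \<and> Re h < 1) \<and>
     rank (map_matrix Re (A ** adjoint_matrix A)) = CARD('n) \<and>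
     prob_space M \<and> centered_gaussian_family M UNIV B \<and>
     gaussian_random_measure N Bt \<and>
     (\<exists>Y. (\<forall>t. has_gaussian_integral N Bt (ofbm_kernel H A t) (\<lambda>w. complex_vec (Y t w))) \<and>
          same_fdd M B N Y)"

definition time_reversible :: "complex^'n^'n \<Rightarrow> bool" where
  "time_reversible A \<longleftrightarrow> map_matrix Im (A ** adjoint_matrix A) = 0"

section \<open>Wavelets and sample wavelet variances\<close>

definition fourier_transform :: "(real \<Rightarrow> real) \<Rightarrow> real \<Rightarrow> complex" where
  "fourier_transform \<psi> x = (\<integral>t. exp (- \<i> * of_real (x * t)) * of_real (\<psi> t) \<partial>lborel)"

definition is_wavelet :: "(real \<Rightarrow> real) \<Rightarrow> nat \<Rightarrow> real \<Rightarrow> bool" where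
  "is_wavelet \<psi> N\<^sub>\<psi> \<alpha> \<longleftrightarrow>
     integrable lborel \<psi> \<and> (\<integral>t. (\<psi> t)\<^sup>2 \<partial>lborel) = 1 \<and>
     N\<^sub>\<psi> \<ge> 2 \<and> (\<forall>q<N\<^sub>\<psi>. (\<integral>t. t ^ q * \<psi> t \<partial>lborel) = 0) \<and>
     (\<exists>a b. a \<le> b \<and> closure {t. \<psi> t \<noteq> 0} = {a..b}) \<and>
     \<alpha> > 1 \<and> bdd_above (range (\<lambda>x. norm (fourier_transform \<psi> x) * (1 + \<bar>x\<bar>) powr \<alpha>))"

definition is_wavelet_coeff ::
  "'w measure \<Rightarrow> (real \<Rightarrow> 'w \<Rightarrow> real^'n) \<Rightarrow> (real \<Rightarrow> real) \<Rightarrow> (nat \<Rightarrow> int \<Rightarrow> 'w \<Rightarrow> real^'n) \<Rightarrow> bool"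
where
  "is_wavelet_coeff M B \<psi> D \<longleftrightarrow>
     (\<forall>j k. has_ms_integral M (\<lambda>z w. \<psi> z *\<^sub>R B (2 ^ j * z + 2 ^ j * of_int k) w) (D j k))"

(* K_j = \<nu> / 2^j, exact once \<nu> is a power of 2 that is at least 2^j *)
definition num_coeffs :: "nat \<Rightarrow> nat \<Rightarrow> nat" where
  "num_coeffs \<nu> j = \<nu> div 2 ^ j"

definition wavelet_variance ::
  "(nat \<Rightarrow> int \<Rightarrow> 'w \<Rightarrow> real^'n) \<Rightarrow> nat \<Rightarrow> nat \<Rightarrow> 'w \<Rightarrow> real^'n^'n" where
  "wavelet_variance D \<nu> j w =
     (1 / real (num_coeffs \<nu> j)) *\<^sub>R
       (\<Sum>k = 1..int (num_coeffs \<nu> j). outer (D j k w) (D j k w))"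

definition cov_matrix ::
  "'w measure \<Rightarrow> ('w \<Rightarrow> real^'p) \<Rightarrow> ('w \<Rightarrow> real^'q) \<Rightarrow> real^'q^'p" where
  "cov_matrix M U V =
     (\<chi> p q. \<integral>w. (U w $ p - (\<integral>v. U v $ p \<partial>M)) * (V w $ q - (\<integral>v. V v $ q \<partial>M)) \<partial>M)"

definition Omega ::
  "(real \<Rightarrow> real) \<Rightarrow> real^'n^'n \<Rightarrow> real^'n^'n \<Rightarrow> nat \<Rightarrow> nat \<Rightarrow> int \<Rightarrow> real^'n^'n" where
  "Omega \<psi> H S j j' z =
     (- 1/2) *\<^sub>R (\<integral>t. (\<integral>t'.
        (let u = \<bar>2 ^ j * t - 2 ^ j' * t' + of_int z * real (gcd (2 ^ j) (2 ^ j'))\<bar>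
         in (\<psi> t * \<psi> t') *\<^sub>R (mat_powr u H ** S ** mat_powr u (transpose H)))
        \<partial>lborel) \<partial>lborel)"

end

theory Submission
  imports Defs
begin

text \<open>The coefficients \<open>D j k\<close> are jointly Gaussian, and the covariance matrix of \<open>D j k\<close> and \<open>D j' k'\<close>
  is \<open>Omega\<close> at the lag \<open>2 ^ j * k - 2 ^ j' * k'\<close>, counted in units of the gcd. Both limits are
  therefore limits of normalised double sums over \<open>k\<close> and \<open>k'\<close> of a summable function of the lag:
  in the first part by definition, in the second because Isserlis' formula (\<open>isserlis\<close>) expresses
  the covariance of two products of coefficients by products of covariances. Such double sums
  converge by counting the pairs with a given lag (\<open>lattice_average\<close>, \<open>octave_average\<close>).

  The spectral representation of the process is an isometry, and time reversibility makes the
  spectral density real and even. Hence the covariance of \<open>B s\<close> and \<open>B t\<close> is half of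
  \<open>g s + g t - g (s - t)\<close>, where a change of variables in the spectral integral gives
  \<open>g u = \<bar>u\<bar>\<^sup>H Sig \<bar>u\<bar>\<^sup>H\<^sup>*\<close> (\<open>ofbm_covariance\<close>). Integrating against two wavelets, which have mean
  zero, leaves only the term \<open>g (s - t)\<close>; this is \<open>D_covariance\<close>.

  Summability comes from the vanishing moments. The function \<open>g\<close> grows at most quadratically,
  because the process has stationary increments (\<open>variance_function_growth\<close>). By homogeneity its
  fourth derivative is a fixed linear operator applied to \<open>g u / u ^ 4\<close>, so it is of order
  \<open>1 / u\<^sup>2\<close>. Two wavelets with two vanishing moments each annihilate polynomials of degree three
  in the difference of their arguments, which leaves the Taylor remainder of order four. Hence
  \<open>Omega\<close> at lag \<open>z\<close> is of order \<open>1 / z\<^sup>2\<close> (\<open>Omega_decay\<close>).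

  The coefficients are jointly Gaussian because a coefficient is a mean-square integral, and such
  an integral lies in the closed linear span of the values of its integrand
  (\<open>ms_integral_approx_from_span\<close>); limits of Gaussian variables are Gaussian
  (\<open>centered_gaussian_L2_limit\<close>).\<close>

section \<open>The matrix exponential\<close>

text \<open>The multiplication of the type class on \<open>real^'n^'n\<close> is entrywise, and \<open>exp\<close> refers to it. Bounded
  endomorphisms of \<open>real^'n\<close>, copied into a type of their own, form a Banach algebra under composition,
  where \<open>exp\<close> is the operator exponential; \<open>mat_of\<close> carries its calculus to \<open>mat_exp\<close>.\<close>

typedef (overloaded) 'a endo = "UNIV :: ('a::euclidean_space \<Rightarrow>\<^sub>L 'a) set"
  morphisms rep_endo Endo
  by simp

setup_lifting type_definition_endo

instantiation endo :: (euclidean_space) real_normed_algebra_1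
begin

lift_definition zero_endo :: "'a endo" is 0 .
lift_definition one_endo :: "'a endo" is id_blinfun .
lift_definition plus_endo :: "'a endo \<Rightarrow> 'a endo \<Rightarrow> 'a endo" is "(+)" .
lift_definition minus_endo :: "'a endo \<Rightarrow> 'a endo \<Rightarrow> 'a endo" is "(-)" .
lift_definition uminus_endo :: "'a endo \<Rightarrow> 'a endo" is uminus .
lift_definition times_endo :: "'a endo \<Rightarrow> 'a endo \<Rightarrow> 'a endo" is "(o\<^sub>L)" .
lift_definition scaleR_endo :: "real \<Rightarrow> 'a endo \<Rightarrow> 'a endo" is scaleR .
lift_definition norm_endo :: "'a endo \<Rightarrow> real" is norm .
definition dist_endo :: "'a endo \<Rightarrow> 'a endo \<Rightarrow> real" where "dist_endo a b = norm (a - b)"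
definition uniformity_endo :: "('a endo \<times> 'a endo) filter" where
  "uniformity_endo = (INF e\<in>{0 <..}. principal {(x, y). dist x y < e})"
definition open_endo :: "'a endo set \<Rightarrow> bool" where
  "open_endo S = (\<forall>x\<in>S. \<forall>\<^sub>F (x', y) in uniformity. x' = x \<longrightarrow> y \<in> S)"
definition sgn_endo :: "'a endo \<Rightarrow> 'a endo" where "sgn_endo x = scaleR (inverse (norm x)) x"

instance
proof
  show "dist x y = norm (x - y)" for x y :: "'a endo" by (rule dist_endo_def)
  show "sgn x = inverse (norm x) *\<^sub>R x" for x :: "'a endo" by (rule sgn_endo_def)
  show "uniformity = (INF e\<in>{0 <..}. principal {(x, y :: 'a endo). dist x y < e})"
    by (rule uniformity_endo_def)
  show "open U = (\<forall>x\<in>U. \<forall>\<^sub>F (x', y) in uniformity. x' = x \<longrightarrow> y \<in> U)" for U :: "'a endo set"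
    by (rule open_endo_def)
  show "0 \<noteq> (1 :: 'a endo)"
    by transfer (metis norm_blinfun_id norm_zero zero_neq_one)
qed (transfer; auto simp: algebra_simps blinfun.bilinear_simps norm_triangle_ineq
      norm_blinfun_compose intro!: blinfun_eqI)+

end

instance endo :: (euclidean_space) banach
proof
  fix X :: "nat \<Rightarrow> 'a endo"
  assume "Cauchy X"
  then have "Cauchy (\<lambda>m. rep_endo (X m))"
    by (simp add: Cauchy_def dist_norm minus_endo.rep_eq norm_endo.rep_eq)
  then obtain L where L: "(\<lambda>m. rep_endo (X m)) \<longlonglongrightarrow> L"
    using Cauchy_convergent convergent_def by blast
  have "X \<longlonglongrightarrow> Endo L"
    using L by (simp add: LIMSEQ_def dist_norm minus_endo.rep_eq norm_endo.rep_eq Endo_inverse)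
  then show "convergent X" by (auto simp: convergent_def)
qed

definition mat_of :: "(real^'n) endo \<Rightarrow> real^'n^'n" where
  "mat_of e = matrix (blinfun_apply (rep_endo e))"

definition endo_of :: "real^'n^'n \<Rightarrow> (real^'n) endo" where
  "endo_of M = Endo (Blinfun ((*v) M))"

lemma mat_of_endo_of [simp]: "mat_of (endo_of M) = M"
  by (simp add: mat_of_def endo_of_def Endo_inverse bounded_linear_Blinfun_apply
      matrix_vector_mul_bounded_linear matrix_of_matrix_vector_mul)

lemma mat_of_mult: "mat_of (x * y) = mat_of x ** mat_of y"
proof -
  have "matrix (blinfun_apply (rep_endo x) \<circ> blinfun_apply (rep_endo y)) = mat_of x ** mat_of y"
    unfolding mat_of_def
    by (rule matrix_compose) (auto intro: bounded_linear.linear blinfun.bounded_linear_right)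
  moreover have "blinfun_apply (rep_endo (x * y)) = blinfun_apply (rep_endo x) \<circ> blinfun_apply (rep_endo y)"
    by (simp add: times_endo.rep_eq fun_eq_iff)
  ultimately show ?thesis
    by (simp add: mat_of_def)
qed

lemma mat_of_one: "mat_of 1 = mat 1"
  by (simp add: mat_of_def one_endo.rep_eq matrix_def mat_def axis_def vec_eq_iff)

lemma matrix_norm_le_sum:
  fixes P :: "real^'n^'m"
  shows "norm P \<le> (\<Sum>i\<in>UNIV. \<Sum>k\<in>UNIV. \<bar>P $ i $ k\<bar>)"
proof -
  have "norm P \<le> (\<Sum>i\<in>UNIV. norm (P $ i))"
    by (simp add: norm_vec_def L2_set_le_sum)
  also have "\<dots> \<le> (\<Sum>i\<in>UNIV. \<Sum>k\<in>UNIV. \<bar>P $ i $ k\<bar>)"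
    by (intro sum_mono norm_le_l1_cart)
  finally show ?thesis .
qed

lemma bounded_linear_mat_of: "bounded_linear mat_of"
proof (rule bounded_linear_intro[where K = "\<Sum>i::'n\<in>UNIV. \<Sum>k::'n\<in>UNIV. 1"])
  show "mat_of (x + y) = mat_of x + mat_of y" for x y :: "(real^'n) endo"
    by (simp add: mat_of_def matrix_def plus_endo.rep_eq blinfun.bilinear_simps vec_eq_iff)
  show "mat_of (r *\<^sub>R x) = r *\<^sub>R mat_of x" for r and x :: "(real^'n) endo"
    by (simp add: mat_of_def matrix_def scaleR_endo.rep_eq blinfun.bilinear_simps vec_eq_iff)
  fix x :: "(real^'n) endo"
  have entry: "\<bar>mat_of x $ i $ k\<bar> \<le> norm x" for i k
  proof -
    have "\<bar>mat_of x $ i $ k\<bar> \<le> norm (blinfun_apply (rep_endo x) (axis k 1))"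
      by (simp add: mat_of_def matrix_def component_le_norm_cart)
    also have "\<dots> \<le> norm (rep_endo x) * norm (axis k (1::real))"
      by (rule norm_blinfun)
    finally show ?thesis by (simp add: norm_endo.rep_eq norm_axis_1)
  qed
  have "norm (mat_of x) \<le> (\<Sum>i\<in>UNIV. \<Sum>k\<in>UNIV. \<bar>mat_of x $ i $ k\<bar>)"
    by (rule matrix_norm_le_sum)
  also have "\<dots> \<le> (\<Sum>i::'n\<in>UNIV. \<Sum>k::'n\<in>UNIV. norm x)"
    by (intro sum_mono entry)
  finally show "norm (mat_of x) \<le> norm x * (\<Sum>i::'n\<in>UNIV. \<Sum>k::'n\<in>UNIV. 1)"
    by (simp add: mult_ac)
qed

lemmas linear_mat_of = bounded_linear.linear[OF bounded_linear_mat_of]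

lemma mat_of_scaleR: "mat_of (r *\<^sub>R x) = r *\<^sub>R mat_of x"
  by (rule linear_scale[OF linear_mat_of])

lemma mat_exp_mat_of: "mat_exp (mat_of e) = mat_of (exp e)"
proof -
  have pow: "((\<lambda>X. mat_of e ** X) ^^ k) (mat 1) = mat_of (e ^ k)" for k
    by (induction k) (simp_all add: mat_of_one mat_of_mult)
  have "mat_of (exp e) = (\<Sum>k. mat_of (e ^ k /\<^sub>R fact k))"
    unfolding exp_def
    by (rule bounded_linear.suminf[OF bounded_linear_mat_of]) (rule summable_exp_generic)
  also have "\<dots> = mat_exp (mat_of e)"
    by (simp add: mat_exp_def pow mat_of_scaleR divide_inverse)
  finally show ?thesis by simp
qed

lemma mat_powr_eq_exp: "0 < u \<Longrightarrow> mat_powr u H = mat_of (exp (ln u *\<^sub>R endo_of H))"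
  by (metis mat_powr_def less_irrefl mat_exp_mat_of mat_of_scaleR mat_of_endo_of)

lemma mat_powr_mult:
  assumes "0 < u" "0 < v"
  shows "mat_powr (u * v) H = mat_powr u H ** mat_powr v H"
proof -
  have "exp (ln (u * v) *\<^sub>R endo_of H) = exp (ln u *\<^sub>R endo_of H) * exp (ln v *\<^sub>R endo_of H)"
    using assms by (simp add: ln_mult scaleR_add_left exp_add_commuting)
  then show ?thesis
    using assms by (simp add: mat_powr_eq_exp mat_of_mult)
qed

lemma mat_powr_inverse_minus: "0 < u \<Longrightarrow> mat_powr (inverse u) (- H) = mat_powr u H"
  by (simp add: mat_powr_def ln_inverse)

text \<open>Scalar matrices commute with everything, so they split off; this relates the exponent \<open>H\<close> of the
  process to the exponent \<open>D = H - 1/2\<close> of its spectral kernel.\<close>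

lemma mat_powr_add_scalar:
  assumes "0 < u"
  shows "mat_powr u (H + c *\<^sub>R mat 1) = (u powr c) *\<^sub>R mat_powr u H"
proof -
  have "mat_of (endo_of H + c *\<^sub>R 1) = H + c *\<^sub>R mat 1"
    by (simp add: linear_add[OF linear_mat_of] mat_of_scaleR mat_of_one)
  then have "mat_powr u (H + c *\<^sub>R mat 1) = mat_of (exp (ln u *\<^sub>R (endo_of H + c *\<^sub>R 1)))"
    using assms by (metis mat_powr_def less_irrefl mat_exp_mat_of mat_of_scaleR)
  also have "exp (ln u *\<^sub>R (endo_of H + c *\<^sub>R 1)) = exp (ln u *\<^sub>R endo_of H) * exp ((c * ln u) *\<^sub>R 1)"
    by (simp add: scaleR_add_right exp_add_commuting mult.commute)
  also have "exp ((c * ln u) *\<^sub>R (1 :: (real^'n) endo)) = of_real (u powr c)"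
    using assms exp_of_real[of "c * ln u", where 'a = "(real^'n) endo"]
    by (simp add: of_real_def powr_def)
  finally show ?thesis
    using assms
    by (simp add: mat_powr_eq_exp of_real_def mat_of_scaleR)
qed

lemma bounded_linear_transpose: "bounded_linear (transpose :: real^'n^'n \<Rightarrow> real^'n^'n)"
  by (rule linear_conv_bounded_linear[THEN iffD1], rule linearI)
    (simp_all add: transpose_def vec_eq_iff)

text \<open>Transposition reverses products, but the factors of a power of one matrix are all equal, so the
  two exponential series agree term by term.\<close>

lemma mat_exp_transpose: "mat_exp (transpose M) = transpose (mat_exp M)"
proof -
  let ?e = "endo_of M"
  have pow: "((\<lambda>X. M ** X) ^^ k) (mat 1) = mat_of (?e ^ k)" for k
    by (induction k) (simp_all add: mat_of_one mat_of_mult)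
  have tpow: "((\<lambda>X. transpose M ** X) ^^ k) (mat 1) = transpose (mat_of (?e ^ k))" for k
  proof (induction k)
    case (Suc k)
    have "transpose M ** transpose (mat_of (?e ^ k)) = transpose (mat_of (?e ^ k * ?e))"
      by (simp add: mat_of_mult matrix_transpose_mul)
    then show ?case using Suc by (simp add: power_commutes)
  qed (simp add: mat_of_one transpose_mat)
  have sm: "summable (\<lambda>k. (1 / fact k) *\<^sub>R mat_of (?e ^ k))"
    using bounded_linear.summable[OF bounded_linear_mat_of summable_exp_generic[of ?e]]
    by (simp add: divide_inverse mat_of_scaleR)
  have "transpose (mat_exp M) = (\<Sum>k. transpose ((1 / fact k) *\<^sub>R mat_of (?e ^ k)))"
    unfolding mat_exp_def pow by (rule bounded_linear.suminf[OF bounded_linear_transpose sm])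
  also have "\<dots> = mat_exp (transpose M)"
    unfolding mat_exp_def tpow
    by (simp add: linear_scale[OF bounded_linear.linear[OF bounded_linear_transpose]])
  finally show ?thesis by simp
qed

lemma mat_powr_transpose: "mat_powr u (transpose H) = transpose (mat_powr u H)"
proof -
  have "ln u *\<^sub>R transpose H = transpose (ln u *\<^sub>R H)"
    by (simp add: transpose_def vec_eq_iff)
  moreover have "transpose (0::real^'n^'n) = 0"
    by (simp add: transpose_def vec_eq_iff zero_vec_def)
  ultimately show ?thesis
    by (auto simp: mat_powr_def mat_exp_transpose)
qed

lemma mat_powr_has_vector_derivative:
  assumes "0 < u"
  shows "((\<lambda>u. mat_powr u H) has_vector_derivative inverse u *\<^sub>R (H ** mat_powr u H)) (at u)"
proof -
  have "((\<lambda>u. exp (ln u *\<^sub>R endo_of H)) has_vector_derivative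
      inverse u *\<^sub>R (endo_of H * exp (ln u *\<^sub>R endo_of H))) (at u)"
    using vector_diff_chain_at[OF has_real_derivative_iff_has_vector_derivative[THEN iffD1, OF DERIV_ln[OF assms]]
        exp_scaleR_has_vector_derivative_left[of "endo_of H" "ln u"]]
    by (simp add: comp_def)
  from bounded_linear.has_vector_derivative[OF bounded_linear_mat_of this]
  have "((\<lambda>u. mat_of (exp (ln u *\<^sub>R endo_of H))) has_vector_derivative
      inverse u *\<^sub>R (H ** mat_powr u H)) (at u)"
    using assms
    by (simp add: mat_of_mult mat_powr_eq_exp mat_of_scaleR)
  then show ?thesis
    by (rule has_vector_derivative_transform_within_open[where S = "{0<..}"])
      (use assms in \<open>auto simp: mat_powr_eq_exp\<close>)
qed

lemma bounded_bilinear_matrix_mult: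
  "bounded_bilinear ((**) :: real^'n^'m \<Rightarrow> real^'p^'n \<Rightarrow> real^'p^'m)"
  by (rule bilinear_conv_bounded_bilinear[THEN iffD1])
    (auto simp: bilinear_def linear_iff matrix_matrix_mult_def vec_eq_iff sum.distrib
      sum_distrib_left algebra_simps)

section \<open>Square-integrable functions\<close>

lemma L2_fun_measurable: "L2_fun M X \<Longrightarrow> X \<in> borel_measurable M"
  by (simp add: L2_fun_def)

lemma L2_fun_integrable_power2: "L2_fun M X \<Longrightarrow> integrable M (\<lambda>w. (norm (X w))\<^sup>2)"
  by (simp add: L2_fun_def)

lemma L2_fun_norm:
  fixes X :: "'a \<Rightarrow> 'b::{real_normed_vector, second_countable_topology}"
  shows "L2_fun M X \<Longrightarrow> L2_fun M (\<lambda>w. norm (X w))"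
  by (auto simp: L2_fun_def)

lemma L2_norm_norm: "L2_norm M (\<lambda>w. norm (X w)) = L2_norm M X"
  by (simp add: L2_norm_def)

lemma L2_norm_nonneg: "0 \<le> L2_norm M X"
  by (simp add: L2_norm_def)

lemma L2_norm_power2: "(L2_norm M X)\<^sup>2 = (\<integral>w. (norm (X w))\<^sup>2 \<partial>M)"
  by (simp add: L2_norm_def)

lemma L2_norm_minus_commute: "L2_norm M (\<lambda>w. X w - Y w) = L2_norm M (\<lambda>w. Y w - X w)"
  by (simp add: L2_norm_def norm_minus_commute)

lemma L2_fun_bounded_bilinear_integrable:
  fixes X :: "'a \<Rightarrow> 'b::{real_normed_vector, second_countable_topology}"
    and Y :: "'a \<Rightarrow> 'c::{real_normed_vector, second_countable_topology}"
    and prod :: "'b \<Rightarrow> 'c \<Rightarrow> 'd::{banach, second_countable_topology}"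
  assumes bil: "bounded_bilinear prod" and X: "L2_fun M X" and Y: "L2_fun M Y"
  shows "integrable M (\<lambda>w. prod (X w) (Y w))"
proof -
  interpret bounded_bilinear prod by (rule bil)
  obtain K where K: "0 < K" "\<And>a b. norm (prod a b) \<le> norm a * norm b * K"
    using pos_bounded by blast
  have meas: "(\<lambda>w. prod (X w) (Y w)) \<in> borel_measurable M"
    using L2_fun_measurable[OF X] L2_fun_measurable[OF Y]
    by (rule borel_measurable_continuous_Pair) (intro continuous_on continuous_intros)
  have bound: "norm (prod (X w) (Y w)) \<le> K * ((norm (X w))\<^sup>2 + (norm (Y w))\<^sup>2)" for w
  proof -
    have "norm (X w) * norm (Y w) \<le> (norm (X w))\<^sup>2 + (norm (Y w))\<^sup>2"
      using sum_squares_bound[of "norm (X w)" "norm (Y w)"]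
        mult_nonneg_nonneg[OF norm_ge_zero norm_ge_zero, of "X w" "Y w"] by linarith
    then have "norm (X w) * norm (Y w) * K \<le> K * ((norm (X w))\<^sup>2 + (norm (Y w))\<^sup>2)"
      using K(1) by (simp add: mult.commute)
    with K(2) show ?thesis by (rule order.trans)
  qed
  show ?thesis
    by (rule Bochner_Integration.integrable_bound
        [of M "\<lambda>w. K * ((norm (X w))\<^sup>2 + (norm (Y w))\<^sup>2)"])
      (use L2_fun_integrable_power2[OF X] L2_fun_integrable_power2[OF Y] K(1) meas bound in
        \<open>simp_all add: abs_mult\<close>)
qed

lemmas L2_fun_integrable_mult =
  L2_fun_bounded_bilinear_integrable[OF bounded_bilinear_mult]

lemma L2_fun_scaleR:
  fixes X :: "'a \<Rightarrow> 'b::{real_normed_vector, second_countable_topology}"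
  assumes "L2_fun M X"
  shows "L2_fun M (\<lambda>w. c *\<^sub>R X w)"
  using assms by (auto simp: L2_fun_def power_mult_distrib intro: borel_measurable_scaleR)

lemma L2_fun_add:
  fixes X Y :: "'a \<Rightarrow> 'b::{real_normed_vector, second_countable_topology}"
  assumes X: "L2_fun M X" and Y: "L2_fun M Y"
  shows "L2_fun M (\<lambda>w. X w + Y w)"
proof -
  have bound: "(norm (X w + Y w))\<^sup>2 \<le> 2 * ((norm (X w))\<^sup>2 + (norm (Y w))\<^sup>2)" for w
  proof -
    have "(norm (X w + Y w))\<^sup>2 \<le> (norm (X w) + norm (Y w))\<^sup>2"
      by (intro power_mono norm_triangle_ineq norm_ge_zero)
    also have "\<dots> \<le> 2 * ((norm (X w))\<^sup>2 + (norm (Y w))\<^sup>2)"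
      using sum_squares_bound[of "norm (X w)" "norm (Y w)"] by (simp add: power2_sum)
    finally show ?thesis .
  qed
  have "integrable M (\<lambda>w. (norm (X w + Y w))\<^sup>2)"
    by (rule Bochner_Integration.integrable_bound
        [of M "\<lambda>w. 2 * ((norm (X w))\<^sup>2 + (norm (Y w))\<^sup>2)"])
      (use L2_fun_measurable[OF X] L2_fun_measurable[OF Y] L2_fun_integrable_power2[OF X]
        L2_fun_integrable_power2[OF Y] bound in \<open>auto intro!: AE_I2\<close>)
  then show ?thesis
    using L2_fun_measurable[OF X] L2_fun_measurable[OF Y] by (simp add: L2_fun_def)
qed

lemma L2_fun_diff:
  fixes X Y :: "'a \<Rightarrow> 'b::{real_normed_vector, second_countable_topology}"
  assumes "L2_fun M X" and "L2_fun M Y"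
  shows "L2_fun M (\<lambda>w. X w - Y w)"
  using L2_fun_add[OF assms(1) L2_fun_scaleR[OF assms(2), of "-1"]] by simp

lemma L2_fun_zero: "L2_fun M (\<lambda>w. 0)"
  by (simp add: L2_fun_def)

lemma L2_fun_sum:
  fixes X :: "'i \<Rightarrow> 'a \<Rightarrow> 'b::{real_normed_vector, second_countable_topology}"
  assumes "\<And>i. i \<in> I \<Longrightarrow> L2_fun M (X i)"
  shows "L2_fun M (\<lambda>w. \<Sum>i\<in>I. X i w)"
  using assms by (induction I rule: infinite_finite_induct) (simp_all add: L2_fun_add L2_fun_zero)

lemma L2_fun_sum_list:
  fixes X :: "'i \<Rightarrow> 'a \<Rightarrow> 'b::{real_normed_vector, second_countable_topology}"
  assumes "\<And>i. i \<in> set xs \<Longrightarrow> L2_fun M (X i)"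
  shows "L2_fun M (\<lambda>w. \<Sum>i\<leftarrow>xs. X i w)"
  using assms by (induction xs) (simp_all add: L2_fun_add L2_fun_zero)

lemma L2_fun_bounded_linear:
  fixes f :: "'b::real_normed_vector \<Rightarrow> 'c::real_normed_vector"
  assumes f: "bounded_linear f" and X: "L2_fun M X"
  shows "L2_fun M (\<lambda>w. f (X w))"
proof -
  obtain K where K: "\<And>x. norm (f x) \<le> norm x * K"
    using bounded_linear.bounded[OF f] by blast
  have meas: "(\<lambda>w. f (X w)) \<in> borel_measurable M"
    using L2_fun_measurable[OF X]
    by (rule borel_measurable_continuous_on[OF linear_continuous_on[OF f], rotated])
  have "integrable M (\<lambda>w. (norm (f (X w)))\<^sup>2)"
  proof (rule Bochner_Integration.integrable_bound)
    show "integrable M (\<lambda>w. K\<^sup>2 * (norm (X w))\<^sup>2)"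
      using L2_fun_integrable_power2[OF X] by simp
    have "(norm (f (X w)))\<^sup>2 \<le> K\<^sup>2 * (norm (X w))\<^sup>2" for w
      using power_mono[OF K norm_ge_zero, of "X w" 2] by (simp add: power_mult_distrib mult.commute)
    then show "AE w in M. norm ((norm (f (X w)))\<^sup>2) \<le> norm (K\<^sup>2 * (norm (X w))\<^sup>2)"
      by simp
  qed (use meas in simp)
  with meas show ?thesis by (simp add: L2_fun_def)
qed

lemma L2_fun_component:
  fixes X :: "'a \<Rightarrow> 'b::real_normed_vector^'n"
  shows "L2_fun M X \<Longrightarrow> L2_fun M (\<lambda>w. X w $ i)"
  by (rule L2_fun_bounded_linear[OF bounded_linear_vec_nth])

text \<open>The quadratic \<open>s \<mapsto> E(X + s Y)\<^sup>2\<close> is nonnegative, in particular at its vertex.\<close>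

lemma L2_Cauchy_Schwarz_power2:
  fixes X Y :: "'a \<Rightarrow> real"
  assumes X: "L2_fun M X" and Y: "L2_fun M Y"
  shows "(\<integral>w. X w * Y w \<partial>M)\<^sup>2 \<le> (\<integral>w. (X w)\<^sup>2 \<partial>M) * (\<integral>w. (Y w)\<^sup>2 \<partial>M)"
proof -
  define a where "a = (\<integral>w. (X w)\<^sup>2 \<partial>M)"
  define b where "b = (\<integral>w. X w * Y w \<partial>M)"
  define c where "c = (\<integral>w. (Y w)\<^sup>2 \<partial>M)"
  have int: "integrable M (\<lambda>w. (X w)\<^sup>2)" "integrable M (\<lambda>w. (Y w)\<^sup>2)"
    "integrable M (\<lambda>w. X w * Y w)"
    using L2_fun_integrable_power2[OF X] L2_fun_integrable_power2[OF Y] L2_fun_integrable_mult[OF X Y]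
    by simp_all
  have quad: "0 \<le> a + 2 * s * b + s\<^sup>2 * c" for s
  proof -
    have "0 \<le> (\<integral>w. (X w + s * Y w)\<^sup>2 \<partial>M)" by simp
    also have "(\<lambda>w. (X w + s * Y w)\<^sup>2) = (\<lambda>w. (X w)\<^sup>2 + 2 * s * (X w * Y w) + s\<^sup>2 * (Y w)\<^sup>2)"
      by (auto simp: power2_sum power_mult_distrib)
    also have "(\<integral>w. \<dots> w \<partial>M) = a + 2 * s * b + s\<^sup>2 * c"
      using int by (simp add: a_def b_def c_def)
    finally show ?thesis .
  qed
  have c0: "0 \<le> c" by (simp add: c_def)
  have "b\<^sup>2 \<le> a * c"
  proof (cases "c = 0")
    case True
    have "b = 0"
    proof (rule ccontr)
      assume "b \<noteq> 0"
      then show False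
        using quad[of "- (a + 1) / (2 * b)"] True by (simp add: field_simps)
    qed
    then show ?thesis using True by simp
  next
    case False
    then have "0 \<le> (a + 2 * (- b / c) * b + (- b / c)\<^sup>2 * c) * c"
      using quad[of "- b / c"] c0 by simp
    also have "\<dots> = a * c - b\<^sup>2"
      using False by (simp add: power2_eq_square field_simps)
    finally show ?thesis by simp
  qed
  then show ?thesis by (simp add: a_def b_def c_def)
qed

lemma L2_Cauchy_Schwarz:
  fixes X Y :: "'a \<Rightarrow> real"
  assumes "L2_fun M X" and "L2_fun M Y"
  shows "\<bar>\<integral>w. X w * Y w \<partial>M\<bar> \<le> L2_norm M X * L2_norm M Y"
  using L2_Cauchy_Schwarz_power2[OF assms] unfolding L2_norm_def real_sqrt_mult[symmetric]
  by (intro real_le_rsqrt) simp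

lemma L2_bounded_bilinear_bound:
  fixes X :: "'a \<Rightarrow> 'b::{real_normed_vector, second_countable_topology}"
    and Y :: "'a \<Rightarrow> 'c::{real_normed_vector, second_countable_topology}"
    and prod :: "'b \<Rightarrow> 'c \<Rightarrow> 'd::{banach, second_countable_topology}"
  assumes bil: "bounded_bilinear prod" and K: "\<And>a b. norm (prod a b) \<le> norm a * norm b * K" "0 \<le> K"
    and X: "L2_fun M X" and Y: "L2_fun M Y"
  shows "norm (\<integral>w. prod (X w) (Y w) \<partial>M) \<le> L2_norm M X * L2_norm M Y * K"
proof -
  have "norm (\<integral>w. prod (X w) (Y w) \<partial>M) \<le> (\<integral>w. norm (prod (X w) (Y w)) \<partial>M)"
    by (rule integral_norm_bound)
  also have "\<dots> \<le> (\<integral>w. norm (X w) * norm (Y w) * K \<partial>M)"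
    using L2_fun_bounded_bilinear_integrable[OF bil X Y]
      L2_fun_integrable_mult[OF L2_fun_norm[OF X] L2_fun_norm[OF Y]] K
    by (intro integral_mono) auto
  also have "\<dots> = (\<integral>w. norm (X w) * norm (Y w) \<partial>M) * K" by simp
  also have "\<dots> \<le> L2_norm M X * L2_norm M Y * K"
    using L2_Cauchy_Schwarz[OF L2_fun_norm[OF X] L2_fun_norm[OF Y]] K(2)
    by (intro mult_right_mono) (simp_all add: L2_norm_norm)
  finally show ?thesis .
qed

lemma L2_norm_triangle:
  fixes X Y :: "'a \<Rightarrow> 'b::{real_normed_vector, second_countable_topology}"
  assumes X: "L2_fun M X" and Y: "L2_fun M Y"
  shows "L2_norm M (\<lambda>w. X w + Y w) \<le> L2_norm M X + L2_norm M Y"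
proof (rule power2_le_imp_le)
  have "(L2_norm M (\<lambda>w. X w + Y w))\<^sup>2
      \<le> (\<integral>w. (norm (X w))\<^sup>2 + 2 * (norm (X w) * norm (Y w)) + (norm (Y w))\<^sup>2 \<partial>M)"
    unfolding L2_norm_power2
  proof (rule integral_mono)
    show "(norm (X w + Y w))\<^sup>2 \<le> (norm (X w))\<^sup>2 + 2 * (norm (X w) * norm (Y w)) + (norm (Y w))\<^sup>2" for w
      using power_mono[OF norm_triangle_ineq norm_ge_zero, of "X w" "Y w" 2]
      by (simp add: power2_sum)
  qed (use L2_fun_integrable_power2[OF L2_fun_add[OF X Y]] L2_fun_integrable_power2[OF X]
      L2_fun_integrable_power2[OF Y] L2_fun_integrable_mult[OF L2_fun_norm[OF X] L2_fun_norm[OF Y]]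
      in auto)
  also have "\<dots> = (L2_norm M X)\<^sup>2 + 2 * (\<integral>w. norm (X w) * norm (Y w) \<partial>M) + (L2_norm M Y)\<^sup>2"
    using L2_fun_integrable_power2[OF X]
      L2_fun_integrable_power2[OF Y] L2_fun_integrable_mult[OF L2_fun_norm[OF X] L2_fun_norm[OF Y]]
    by (simp add: L2_norm_power2)
  also have "\<dots> \<le> (L2_norm M X + L2_norm M Y)\<^sup>2"
    using L2_Cauchy_Schwarz[OF L2_fun_norm[OF X] L2_fun_norm[OF Y]]
    by (simp add: L2_norm_norm power2_sum abs_le_iff)
  finally show "(L2_norm M (\<lambda>w. X w + Y w))\<^sup>2 \<le> (L2_norm M X + L2_norm M Y)\<^sup>2" .
qed (simp add: L2_norm_nonneg)

text \<open>Mean-square limits may be taken in any bilinear expression. This carries covariances and isometry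
  relations from step functions to the integrals that they approximate.\<close>

lemma L2_tendsto_bounded_bilinear:
  fixes X :: "nat \<Rightarrow> 'a \<Rightarrow> 'b::{real_normed_vector, second_countable_topology}"
    and Y :: "nat \<Rightarrow> 'a \<Rightarrow> 'c::{real_normed_vector, second_countable_topology}"
    and prod :: "'b \<Rightarrow> 'c \<Rightarrow> 'd::{banach, second_countable_topology}"
  assumes bil: "bounded_bilinear prod" and X: "L2_tendsto M X X'" and Y: "L2_tendsto M Y Y'"
  shows "(\<lambda>m. \<integral>w. prod (X m w) (Y m w) \<partial>M) \<longlonglongrightarrow> (\<integral>w. prod (X' w) (Y' w) \<partial>M)"
proof -
  interpret bounded_bilinear prod by (rule bil)
  obtain K where K: "0 \<le> K" "\<And>a b. norm (prod a b) \<le> norm a * norm b * K"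
    using nonneg_bounded by blast
  have L2: "L2_fun M (X m)" "L2_fun M X'" "L2_fun M (Y m)" "L2_fun M Y'" for m
    using X Y by (auto simp: L2_tendsto_def)
  define dx where "dx m = L2_norm M (\<lambda>w. X m w - X' w)" for m
  define dy where "dy m = L2_norm M (\<lambda>w. Y m w - Y' w)" for m
  have lim: "dx \<longlonglongrightarrow> 0" "dy \<longlonglongrightarrow> 0"
    using X Y by (simp_all add: L2_tendsto_def dx_def[abs_def] dy_def[abs_def])
  have bound: "norm ((\<integral>w. prod (X m w) (Y m w) \<partial>M) - (\<integral>w. prod (X' w) (Y' w) \<partial>M))
      \<le> dx m * (dy m + L2_norm M Y') * K + L2_norm M X' * dy m * K" for m
  proof -
    have "prod (X m w) (Y m w) - prod (X' w) (Y' w)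
        = prod (X m w - X' w) (Y m w) + prod (X' w) (Y m w - Y' w)" for w
      by (simp add: diff_left diff_right)
    moreover have int: "integrable M (\<lambda>w. prod (X m w) (Y m w))" "integrable M (\<lambda>w. prod (X' w) (Y' w))"
      "integrable M (\<lambda>w. prod (X m w - X' w) (Y m w))"
      "integrable M (\<lambda>w. prod (X' w) (Y m w - Y' w))"
      using L2 by (auto intro!: L2_fun_bounded_bilinear_integrable[OF bil] L2_fun_diff)
    ultimately have "(\<integral>w. prod (X m w) (Y m w) \<partial>M) - (\<integral>w. prod (X' w) (Y' w) \<partial>M)
      = (\<integral>w. prod (X m w - X' w) (Y m w) \<partial>M) + (\<integral>w. prod (X' w) (Y m w - Y' w) \<partial>M)"
      unfolding Bochner_Integration.integral_diff[OF int(1,2), symmetric]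
        Bochner_Integration.integral_add[OF int(3,4), symmetric] by simp
    also have "norm \<dots> \<le> dx m * L2_norm M (Y m) * K + L2_norm M X' * dy m * K"
      unfolding dx_def dy_def using L2 K
      by (intro norm_triangle_le add_mono L2_bounded_bilinear_bound bil L2_fun_diff)
    finally have "norm ((\<integral>w. prod (X m w) (Y m w) \<partial>M) - (\<integral>w. prod (X' w) (Y' w) \<partial>M))
      \<le> dx m * L2_norm M (Y m) * K + L2_norm M X' * dy m * K" .
    moreover have "L2_norm M (Y m) \<le> dy m + L2_norm M Y'"
      using L2_norm_triangle[OF L2_fun_diff[OF L2(3) L2(4)] L2(4), of m] by (simp add: dy_def)
    then have "dx m * L2_norm M (Y m) * K \<le> dx m * (dy m + L2_norm M Y') * K"
      unfolding dx_def by (rule mult_right_mono[OF mult_left_mono[OF _ L2_norm_nonneg] K(1)])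
    ultimately show ?thesis by (smt (verit))
  qed
  have "(\<lambda>m. dx m * (dy m + L2_norm M Y') * K + L2_norm M X' * dy m * K)
      \<longlonglongrightarrow> 0 * (0 + L2_norm M Y') * K + L2_norm M X' * 0 * K"
    by (intro tendsto_add tendsto_mult tendsto_const lim)
  then have lim0: "(\<lambda>m. dx m * (dy m + L2_norm M Y') * K + L2_norm M X' * dy m * K) \<longlonglongrightarrow> 0"
    by simp
  have "(\<lambda>m. (\<integral>w. prod (X m w) (Y m w) \<partial>M) - (\<integral>w. prod (X' w) (Y' w) \<partial>M)) \<longlonglongrightarrow> 0"
    by (rule Lim_null_comparison[OF always_eventually lim0]) (use bound in auto)
  then show ?thesis by (simp add: LIM_zero_iff)
qed

lemma L2_tendsto_const: "L2_fun M X \<Longrightarrow> L2_tendsto M (\<lambda>_. X) X"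
  by (simp add: L2_tendsto_def L2_norm_def)

section \<open>Mean-square integrals\<close>

lemma L2_norm_component:
  fixes X :: "'a \<Rightarrow> real^'n"
  assumes "L2_fun M X"
  shows "L2_norm M (\<lambda>w. X w $ i) \<le> L2_norm M X"
  unfolding L2_norm_def
  using L2_fun_integrable_power2[OF assms] L2_fun_integrable_power2[OF L2_fun_component[OF assms, of i]]
  by (intro real_sqrt_le_mono integral_mono power_mono) (auto simp: component_le_norm_cart)

lemma bounded_bilinear_component_mult:
  "bounded_bilinear (\<lambda>(x::real^'n) (y::real). x $ i * y)"
  by (rule bounded_bilinear.comp1[OF bounded_bilinear_mult bounded_linear_vec_nth])

lemma has_bochner_integral_step_pairing:
  fixes S :: "(real set \<times> ('a \<Rightarrow> real^'n)) list"
  assumes "\<forall>(E, Z) \<in> set S. E \<in> fmeasurable lborel \<and> L2_fun M Z" and Y: "L2_fun M Y"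
  shows "has_bochner_integral lborel
      (\<lambda>z. \<integral>w. (\<Sum>(E, Z)\<leftarrow>S. indicat_real E z *\<^sub>R Z w) $ i * Y w \<partial>M)
      (\<integral>w. (\<Sum>(E, Z)\<leftarrow>S. measure lborel E *\<^sub>R Z w) $ i * Y w \<partial>M)"
  using assms(1)
proof (induction S)
  case (Cons p S)
  obtain E Z where p: "p = (E, Z)" by (cases p)
  have E: "E \<in> fmeasurable lborel" and Z: "L2_fun M Z"
    and S: "\<forall>(E, Z) \<in> set S. E \<in> fmeasurable lborel \<and> L2_fun M Z"
    using Cons.prems by (auto simp: p)
  have int: "integrable M (\<lambda>w. (\<Sum>(E, Z)\<leftarrow>S. g E *\<^sub>R Z w) $ i * Y w)" for g :: "real set \<Rightarrow> real"
  proof -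
    have "L2_fun M (\<lambda>w. \<Sum>q\<leftarrow>S. g (fst q) *\<^sub>R snd q w)"
      using S by (intro L2_fun_sum_list L2_fun_scaleR) auto
    then show ?thesis
      using L2_fun_bounded_bilinear_integrable[OF bounded_bilinear_component_mult _ Y]
      by (simp add: case_prod_unfold)
  qed
  have intZ: "integrable M (\<lambda>w. Z w $ i * Y w)"
    by (rule L2_fun_bounded_bilinear_integrable[OF bounded_bilinear_component_mult Z Y])
  have split: "(\<integral>w. (\<Sum>(E, Z)\<leftarrow>p # S. g E *\<^sub>R Z w) $ i * Y w \<partial>M)
      = g E * (\<integral>w. Z w $ i * Y w \<partial>M) + (\<integral>w. (\<Sum>(E, Z)\<leftarrow>S. g E *\<^sub>R Z w) $ i * Y w \<partial>M)"
    for g :: "real set \<Rightarrow> real"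
    using int[of g] intZ by (simp add: p distrib_right mult.assoc)
  have "has_bochner_integral lborel (\<lambda>z. indicat_real E z * (\<integral>w. Z w $ i * Y w \<partial>M))
      (measure lborel E * (\<integral>w. Z w $ i * Y w \<partial>M))"
    using E by (intro has_bochner_integral_mult_left has_bochner_integral_real_indicator)
      (auto simp: fmeasurable_def)
  from has_bochner_integral_add[OF this Cons.IH[OF S]] show ?case
    unfolding split[of "measure lborel"] split[of "\<lambda>E. indicat_real E _"] .
qed (simp add: has_bochner_integral_zero)

text \<open>Pairing with a fixed square-integrable variable is a bounded functional, so it commutes with the
  mean-square integral. The Bochner integral of the pairings also asks for Borel measurability of
  the scalar integrand, which convergence in the mean does not supply; it is a hypothesis, and is
  verified from explicit covariances in each use.\<close>

lemma has_ms_integral_pairing: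
  fixes f :: "real \<Rightarrow> 'a \<Rightarrow> real^'n"
  assumes f: "has_ms_integral M f X" and Y: "L2_fun M Y"
    and meas: "(\<lambda>z. \<integral>w. f z w $ i * Y w \<partial>M) \<in> borel_measurable borel"
  shows "integrable lborel (\<lambda>z. \<integral>w. f z w $ i * Y w \<partial>M)"
    and "(\<integral>z. (\<integral>w. f z w $ i * Y w \<partial>M) \<partial>lborel) = (\<integral>w. X w $ i * Y w \<partial>M)" (is "?lhs = ?rhs")
proof -
  obtain S :: "nat \<Rightarrow> (real set \<times> ('a \<Rightarrow> real^'n)) list" where
    S: "\<And>m. \<forall>(E, Z) \<in> set (S m). E \<in> fmeasurable lborel \<and> L2_fun M Z"
    and err: "\<And>m. integrable lborel
           (\<lambda>z. L2_norm M (\<lambda>w. f z w - (\<Sum>(E, Z)\<leftarrow>S m. indicat_real E z *\<^sub>R Z w)))"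
    and err0: "(\<lambda>m. \<integral>z. L2_norm M (\<lambda>w. f z w - (\<Sum>(E, Z)\<leftarrow>S m. indicat_real E z *\<^sub>R Z w)) \<partial>lborel)
          \<longlonglongrightarrow> 0"
    and lim: "L2_tendsto M (\<lambda>m w. \<Sum>(E, Z)\<leftarrow>S m. measure lborel E *\<^sub>R Z w) X"
    and fz: "\<And>z. L2_fun M (f z)"
    using f unfolding has_ms_integral_def by blast
  define s where "s m z w = (\<Sum>(E, Z)\<leftarrow>S m. indicat_real E z *\<^sub>R Z w)" for m z w
  define e where "e m z = L2_norm M (\<lambda>w. f z w - s m z w)" for m z
  define F where "F z = (\<integral>w. f z w $ i * Y w \<partial>M)" for z
  define A where "A m z = (\<integral>w. s m z w $ i * Y w \<partial>M)" for m z
  define I where "I m = (\<integral>w. (\<Sum>(E, Z)\<leftarrow>S m. measure lborel E *\<^sub>R Z w) $ i * Y w \<partial>M)" for m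
  have A: "has_bochner_integral lborel (A m) (I m)" for m
    unfolding A_def s_def I_def by (rule has_bochner_integral_step_pairing[OF S Y])
  have sL2: "L2_fun M (s m z)" for m z
  proof -
    have "L2_fun M (\<lambda>w. \<Sum>q\<leftarrow>S m. indicat_real (fst q) z *\<^sub>R snd q w)"
      using S[of m] by (intro L2_fun_sum_list L2_fun_scaleR) auto
    then show ?thesis unfolding s_def[abs_def] by (simp add: case_prod_unfold)
  qed
  have close: "\<bar>F z - A m z\<bar> \<le> e m z * L2_norm M Y" for m z
  proof -
    have "F z - A m z = (\<integral>w. (f z w - s m z w) $ i * Y w \<partial>M)"
      unfolding F_def A_def
      by (subst Bochner_Integration.integral_diff[symmetric])
        (auto simp: left_diff_distrib intro!: fz sL2
          L2_fun_bounded_bilinear_integrable[OF bounded_bilinear_component_mult _ Y])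
    also have "\<bar>\<dots>\<bar> \<le> L2_norm M (\<lambda>w. (f z w - s m z w) $ i) * L2_norm M Y"
      by (rule L2_Cauchy_Schwarz[OF L2_fun_component[OF L2_fun_diff[OF fz sL2]] Y])
    also have "\<dots> \<le> e m z * L2_norm M Y"
      unfolding e_def by (rule mult_right_mono[OF L2_norm_component[OF L2_fun_diff[OF fz sL2]] L2_norm_nonneg])
    finally show ?thesis .
  qed
  have err': "integrable lborel (\<lambda>z. e m z * L2_norm M Y)" for m
    unfolding e_def s_def by (rule integrable_mult_left) (rule err)
  have intA: "integrable lborel (A m)" for m
    using A by (rule integrable.intros)
  have measF: "F \<in> borel_measurable lborel"
    using meas by (simp add: F_def[abs_def])
  have diff: "integrable lborel (\<lambda>z. F z - A m z)" for m
  proof (rule Bochner_Integration.integrable_bound[OF err'[of m]])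
    show "(\<lambda>z. F z - A m z) \<in> borel_measurable lborel"
      using measF borel_measurable_integrable[OF intA[of m]] by (rule borel_measurable_diff)
    show "AE z in lborel. norm (F z - A m z) \<le> norm (e m z * L2_norm M Y)"
      using close by (auto intro!: AE_I2 simp: abs_mult e_def L2_norm_nonneg)
  qed
  have intF: "integrable lborel F"
    using Bochner_Integration.integrable_add[OF diff[of 0] intA[of 0]] by simp
  then show "integrable lborel (\<lambda>z. \<integral>w. f z w $ i * Y w \<partial>M)"
    by (simp add: F_def[abs_def])
  have conv: "norm ((\<integral>z. F z \<partial>lborel) - I m)
      \<le> (\<integral>z. e m z \<partial>lborel) * L2_norm M Y" for m
  proof -
    have "I m = (\<integral>z. A m z \<partial>lborel)"
      by (rule has_bochner_integral_integral_eq[OF A, symmetric])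
    then have "\<bar>(\<integral>z. F z \<partial>lborel) - I m\<bar> = \<bar>\<integral>z. F z - A m z \<partial>lborel\<bar>"
      using intF intA by simp
    also have "\<dots> \<le> (\<integral>z. \<bar>F z - A m z\<bar> \<partial>lborel)"
      by (rule integral_abs_bound)
    also have "\<dots> \<le> (\<integral>z. e m z * L2_norm M Y \<partial>lborel)"
      using diff err' close by (intro integral_mono) auto
    finally show ?thesis by simp
  qed
  have conv0: "(\<lambda>m. (\<integral>z. e m z \<partial>lborel) * L2_norm M Y) \<longlonglongrightarrow> 0"
    using tendsto_mult_left_zero[OF err0] by (simp add: e_def s_def)
  have "(\<lambda>m. (\<integral>z. F z \<partial>lborel) - I m) \<longlonglongrightarrow> 0"
    by (rule Lim_null_comparison[OF always_eventually conv0]) (use conv in blast)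
  then have "(\<lambda>m. (\<integral>z. F z \<partial>lborel) - ((\<integral>z. F z \<partial>lborel) - I m)) \<longlonglongrightarrow> (\<integral>z. F z \<partial>lborel) - 0"
    by (rule tendsto_diff[OF tendsto_const])
  then have "I \<longlonglongrightarrow> (\<integral>z. F z \<partial>lborel)"
    by simp
  moreover have "I \<longlonglongrightarrow> (\<integral>w. X w $ i * Y w \<partial>M)"
    unfolding I_def
    by (rule L2_tendsto_bounded_bilinear[OF bounded_bilinear_component_mult lim L2_tendsto_const[OF Y]])
  ultimately show "?lhs = ?rhs"
    unfolding F_def by (rule LIMSEQ_unique)
qed

lemma has_ms_integral_L2: "has_ms_integral M f X \<Longrightarrow> L2_fun M X"
  by (auto simp: has_ms_integral_def L2_tendsto_def)

section \<open>Approximation from a linear space\<close>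

text \<open>A criterion for \<open>X\<close> to be a mean-square limit of elements of a linear space \<open>G\<close>, in which
  approximate minimisers replace the orthogonal projection. If \<open>R \<in> G\<close> nearly minimises the distance
  to \<open>X\<close>, then \<open>X - R\<close> is nearly orthogonal to \<open>G\<close>. The hypothesis \<open>orth\<close> says that \<open>X\<close> is tied to
  \<open>G\<close> closely enough to be nearly orthogonal to \<open>X - R\<close> as well, and then \<open>X - R\<close> is nearly
  orthogonal to itself.\<close>

lemma L2_approx_from_linear_space:
  fixes X :: "'a \<Rightarrow> real"
  assumes X: "L2_fun M X" and G: "\<And>R. R \<in> G \<Longrightarrow> L2_fun M R"
    and zero: "(\<lambda>w. 0) \<in> G"
    and lin: "\<And>R R' s. R \<in> G \<Longrightarrow> R' \<in> G \<Longrightarrow> (\<lambda>w. R w + s * R' w) \<in> G"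
    and C: "0 \<le> C"
    and orth: "\<And>R \<delta>. R \<in> G \<Longrightarrow> 0 \<le> \<delta> \<Longrightarrow>
      (\<And>R'. R' \<in> G \<Longrightarrow> \<bar>\<integral>w. R' w * (X w - R w) \<partial>M\<bar> \<le> \<delta> * L2_norm M R') \<Longrightarrow>
      \<bar>\<integral>w. X w * (X w - R w) \<partial>M\<bar> \<le> C * \<delta>"
    and "0 < \<epsilon>"
  shows "\<exists>R\<in>G. L2_norm M (\<lambda>w. X w - R w) < \<epsilon>"
proof -
  let ?D = "(\<lambda>R. (L2_norm M (\<lambda>w. X w - R w))\<^sup>2) ` G"
  define d where "d = Inf ?D"
  have bdd: "bdd_below ?D" by (rule bdd_belowI2[of _ 0]) simp
  have d_le: "d \<le> (L2_norm M (\<lambda>w. X w - R w))\<^sup>2" if "R \<in> G" for R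
    unfolding d_def using that by (intro cInf_lower bdd) auto
  \<comment> \<open>chosen so that the final bound \<open>\<delta> * k\<close> stays below \<open>\<epsilon>\<^sup>2\<close>\<close>
  define k where "k = C + 2 * L2_norm M X + 1"
  have k: "1 \<le> k" using C by (simp add: k_def L2_norm_nonneg)
  define \<delta> where "\<delta> = min 1 (\<epsilon>\<^sup>2 / (2 * k))"
  have \<delta>: "0 < \<delta>" "\<delta> \<le> 1" "\<delta> * k \<le> \<epsilon>\<^sup>2 / 2"
    using k \<open>0 < \<epsilon>\<close> by (auto simp: \<delta>_def min_def field_simps)
  have "\<exists>x\<in>?D. x < d + \<delta>\<^sup>2"
    unfolding d_def using zero \<delta>(1) by (intro cInf_lessD) auto
  then obtain R where R: "R \<in> G" and near: "(L2_norm M (\<lambda>w. X w - R w))\<^sup>2 < d + \<delta>\<^sup>2"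
    by auto
  let ?Y = "\<lambda>w. X w - R w"
  have Y: "L2_fun M ?Y" by (rule L2_fun_diff[OF X G[OF R]])
  have almost: "\<bar>\<integral>w. R' w * ?Y w \<partial>M\<bar> \<le> \<delta> * L2_norm M R'" if R': "R' \<in> G" for R'
  proof (cases "L2_norm M R' = 0")
    case True
    then show ?thesis using L2_Cauchy_Schwarz[OF G[OF R'] Y] by simp
  next
    case False
    define b where "b = (\<integral>w. R' w * ?Y w \<partial>M)"
    define c where "c = (L2_norm M R')\<^sup>2"
    have c: "0 < c" using False by (simp add: c_def)
    \<comment> \<open>moving \<open>R\<close> along \<open>R'\<close> by this amount gains \<open>b\<^sup>2 / c\<close>, which cannot exceed the slack \<open>\<delta>\<^sup>2\<close>\<close>
    let ?s = "b / c"
    have "d \<le> (L2_norm M (\<lambda>w. X w - (R w + ?s * R' w)))\<^sup>2"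
      by (rule d_le[OF lin[OF R R']])
    also have "\<dots> = (\<integral>w. (?Y w)\<^sup>2 - 2 * ?s * (R' w * ?Y w) + ?s\<^sup>2 * (R' w)\<^sup>2 \<partial>M)"
      unfolding L2_norm_power2
      by (intro Bochner_Integration.integral_cong) (auto simp: power2_eq_square algebra_simps)
    also have "\<dots> = (L2_norm M ?Y)\<^sup>2 - 2 * ?s * b + ?s\<^sup>2 * c"
      unfolding L2_norm_power2 b_def c_def
      using L2_fun_integrable_power2[OF Y] L2_fun_integrable_power2[OF G[OF R']]
        L2_fun_integrable_mult[OF G[OF R'] Y]
      by simp
    also have "\<dots> = (L2_norm M ?Y)\<^sup>2 - b\<^sup>2 / c"
      using c by (simp add: power2_eq_square field_simps)
    finally have "b\<^sup>2 / c \<le> \<delta>\<^sup>2" using near by simp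
    then have "b\<^sup>2 \<le> (\<delta> * L2_norm M R')\<^sup>2"
      using c by (simp add: c_def power_mult_distrib field_simps)
    then have "\<bar>b\<bar> \<le> \<delta> * L2_norm M R'"
      using \<delta>(1) abs_le_square_iff[of b "\<delta> * L2_norm M R'"] by (simp add: abs_mult L2_norm_nonneg)
    then show ?thesis by (simp add: b_def)
  qed
  have "d \<le> (L2_norm M X)\<^sup>2" using d_le[OF zero] by simp
  then have "(L2_norm M ?Y)\<^sup>2 \<le> (L2_norm M X + \<delta>)\<^sup>2"
    using near \<delta>(1) by (simp add: power2_sum L2_norm_nonneg add_increasing2)
  then have normY: "L2_norm M ?Y \<le> L2_norm M X + \<delta>"
    by (rule power2_le_imp_le) (simp add: L2_norm_nonneg less_imp_le[OF \<delta>(1)])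
  have "L2_norm M (\<lambda>w. X w + (-1) *\<^sub>R ?Y w) \<le> L2_norm M X + L2_norm M (\<lambda>w. (-1) *\<^sub>R ?Y w)"
    by (rule L2_norm_triangle[OF X L2_fun_scaleR[OF Y]])
  moreover have "(\<lambda>w. X w + (-1) *\<^sub>R ?Y w) = R" by auto
  moreover have "L2_norm M (\<lambda>w. (-1) *\<^sub>R ?Y w) = L2_norm M ?Y"
    by (simp add: L2_norm_def power2_commute)
  ultimately have "L2_norm M R \<le> L2_norm M X + L2_norm M ?Y" by simp
  with normY \<delta>(2) have normR: "L2_norm M R \<le> 2 * L2_norm M X + 1" by simp
  have "(L2_norm M ?Y)\<^sup>2 = (\<integral>w. X w * ?Y w - R w * ?Y w \<partial>M)"
    unfolding L2_norm_power2
    by (intro Bochner_Integration.integral_cong) (auto simp: power2_eq_square algebra_simps)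
  also have "\<dots> = (\<integral>w. X w * ?Y w \<partial>M) - (\<integral>w. R w * ?Y w \<partial>M)"
    by (intro Bochner_Integration.integral_diff L2_fun_integrable_mult X G R Y)
  also have "\<dots> \<le> C * \<delta> + \<delta> * L2_norm M R"
    using orth[OF R less_imp_le[OF \<delta>(1)] almost] almost[OF R] by linarith
  also have "\<dots> \<le> C * \<delta> + \<delta> * (2 * L2_norm M X + 1)"
    using normR \<delta>(1) by simp
  also have "\<dots> = \<delta> * k" by (simp add: k_def algebra_simps)
  also have "\<dots> < \<epsilon>\<^sup>2" using \<delta>(3) zero_less_power[OF \<open>0 < \<epsilon>\<close>, of 2] by linarith
  finally have "L2_norm M ?Y < \<epsilon>"
    by (rule power2_less_imp_less) (use \<open>0 < \<epsilon>\<close> in simp)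
  with R show ?thesis by blast
qed

definition linear_span :: "('t \<Rightarrow> 'a \<Rightarrow> real^'n) \<Rightarrow> ('a \<Rightarrow> real) set" where
  "linear_span B = {\<lambda>w. \<Sum>t\<in>F. c t \<bullet> B t w | F c. finite F}"

lemma linear_span_zero: "(\<lambda>w. 0) \<in> linear_span B"
  unfolding linear_span_def by (rule CollectI, rule exI[of _ "{}"]) simp

lemma linear_span_component: "(\<lambda>w. r * B t w $ i) \<in> linear_span B"
  unfolding linear_span_def
  by (rule CollectI, rule exI[of _ "{t}"], rule exI[of _ "\<lambda>_. axis i r"])
    (simp add: inner_axis' )

lemma linear_span_add_mult:
  assumes "R \<in> linear_span B" and "R' \<in> linear_span B"
  shows "(\<lambda>w. R w + s * R' w) \<in> linear_span B"
proof -
  obtain F c where F: "finite F" "R = (\<lambda>w. \<Sum>t\<in>F. c t \<bullet> B t w)"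
    using assms(1) by (auto simp: linear_span_def)
  obtain F' c' where F': "finite F'" "R' = (\<lambda>w. \<Sum>t\<in>F'. c' t \<bullet> B t w)"
    using assms(2) by (auto simp: linear_span_def)
  let ?c = "\<lambda>t. (if t \<in> F then c t else 0) + s *\<^sub>R (if t \<in> F' then c' t else 0)"
  have "R w + s * R' w = (\<Sum>t\<in>F \<union> F'. ?c t \<bullet> B t w)" for w
  proof -
    have "(\<Sum>t\<in>F. c t \<bullet> B t w) = (\<Sum>t\<in>F \<union> F'. (if t \<in> F then c t else 0) \<bullet> B t w)"
      using F(1) F'(1) by (intro sum.mono_neutral_cong_left) auto
    moreover have "(\<Sum>t\<in>F'. c' t \<bullet> B t w) = (\<Sum>t\<in>F \<union> F'. (if t \<in> F' then c' t else 0) \<bullet> B t w)"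
      using F(1) F'(1) by (intro sum.mono_neutral_cong_left) auto
    ultimately show ?thesis
      by (simp add: F(2) F'(2) inner_add_left sum.distrib sum_distrib_left)
  qed
  then show ?thesis
    unfolding linear_span_def using F(1) F'(1)
    by (intro CollectI exI[of _ "F \<union> F'"] exI[of _ ?c]) auto
qed

lemma linear_span_L2:
  assumes "\<And>t. L2_fun M (B t)" and "R \<in> linear_span B"
  shows "L2_fun M R"
  using assms(2) unfolding linear_span_def
  by (auto intro!: L2_fun_sum L2_fun_bounded_linear[OF bounded_linear_inner_right assms(1)])

text \<open>The step functions in \<open>has_ms_integral\<close> may take values outside the span of \<open>B\<close>, so membership of
  the integral in the closed span is not immediate. It follows from the criterion above: what is nearly
  orthogonal to each value of the integrand is nearly orthogonal to the integral.\<close>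

lemma ms_integral_approx_from_span:
  fixes B :: "'t \<Rightarrow> 'a \<Rightarrow> real^'n"
  assumes B: "\<And>t. L2_fun M (B t)"
    and X: "has_ms_integral M (\<lambda>z w. \<psi> z *\<^sub>R B (\<tau> z) w) X"
    and measB: "\<And>t k. (\<lambda>z. \<integral>w. (\<psi> z *\<^sub>R B (\<tau> z) w) $ i * B t w $ k \<partial>M) \<in> borel_measurable borel"
    and measX: "(\<lambda>z. \<integral>w. (\<psi> z *\<^sub>R B (\<tau> z) w) $ i * X w $ i \<partial>M) \<in> borel_measurable borel"
    and int: "integrable lborel (\<lambda>z. L2_norm M (\<lambda>w. (\<psi> z *\<^sub>R B (\<tau> z) w) $ i))"
    and "0 < \<epsilon>"
  shows "\<exists>R\<in>linear_span B. L2_norm M (\<lambda>w. X w $ i - R w) < \<epsilon>"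
proof (rule L2_approx_from_linear_space
    [where C = "\<integral>z. L2_norm M (\<lambda>w. (\<psi> z *\<^sub>R B (\<tau> z) w) $ i) \<partial>lborel"])
  let ?f = "\<lambda>z w. \<psi> z *\<^sub>R B (\<tau> z) w"
  show Xi: "L2_fun M (\<lambda>w. X w $ i)"
    by (rule L2_fun_component[OF has_ms_integral_L2[OF X]])
  show "0 \<le> (\<integral>z. L2_norm M (\<lambda>w. ?f z w $ i) \<partial>lborel)"
    by (simp add: L2_norm_nonneg)
  fix R \<delta>
  assume R: "R \<in> linear_span B" and \<delta>: "0 \<le> \<delta>"
    and orth: "\<And>R'. R' \<in> linear_span B \<Longrightarrow> \<bar>\<integral>w. R' w * (X w $ i - R w) \<partial>M\<bar> \<le> \<delta> * L2_norm M R'"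
  have R2: "L2_fun M R" by (rule linear_span_L2[OF B R])
  have f2: "L2_fun M (\<lambda>w. ?f z w $ k)" for z k
    by (rule L2_fun_component[OF L2_fun_scaleR[OF B]])
  have measR: "(\<lambda>z. \<integral>w. ?f z w $ i * R w \<partial>M) \<in> borel_measurable borel"
  proof -
    obtain F c where F: "finite F" "R = (\<lambda>w. \<Sum>t\<in>F. c t \<bullet> B t w)"
      using R by (auto simp: linear_span_def)
    have "(\<integral>w. ?f z w $ i * R w \<partial>M) = (\<Sum>t\<in>F. \<Sum>k\<in>UNIV. c t $ k * (\<integral>w. ?f z w $ i * B t w $ k \<partial>M))" for z
    proof -
      have "?f z w $ i * R w = (\<Sum>t\<in>F. \<Sum>k\<in>UNIV. c t $ k * (?f z w $ i * B t w $ k))" for w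
        by (simp add: F(2) inner_vec_def sum_distrib_left mult_ac)
      then show ?thesis
        using L2_fun_integrable_mult[OF f2 L2_fun_component[OF B]] by simp
    qed
    then show ?thesis using measB by simp
  qed
  have "(\<lambda>z. (\<integral>w. ?f z w $ i * X w $ i \<partial>M) - (\<integral>w. ?f z w $ i * R w \<partial>M)) \<in> borel_measurable borel"
    by (rule borel_measurable_diff[OF measX measR])
  moreover have "(\<integral>w. ?f z w $ i * X w $ i \<partial>M) - (\<integral>w. ?f z w $ i * R w \<partial>M)
      = (\<integral>w. ?f z w $ i * (X w $ i - R w) \<partial>M)" for z
    using L2_fun_integrable_mult[OF f2 Xi] L2_fun_integrable_mult[OF f2 R2]
    by (simp add: right_diff_distrib)
  ultimately have "(\<lambda>z. \<integral>w. ?f z w $ i * (X w $ i - R w) \<partial>M) \<in> borel_measurable borel"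
    by simp
  note pair = has_ms_integral_pairing[OF X L2_fun_diff[OF Xi R2] this]
  have bound: "\<bar>\<integral>w. ?f z w $ i * (X w $ i - R w) \<partial>M\<bar> \<le> \<delta> * L2_norm M (\<lambda>w. ?f z w $ i)" for z
    using orth[OF linear_span_component[of "\<psi> z" B "\<tau> z" i]] by simp
  have "\<bar>\<integral>w. X w $ i * (X w $ i - R w) \<partial>M\<bar> = \<bar>\<integral>z. (\<integral>w. ?f z w $ i * (X w $ i - R w) \<partial>M) \<partial>lborel\<bar>"
    by (simp only: pair(2))
  also have "\<dots> \<le> (\<integral>z. \<bar>\<integral>w. ?f z w $ i * (X w $ i - R w) \<partial>M\<bar> \<partial>lborel)"
    by (rule integral_abs_bound)
  also have "\<dots> \<le> (\<integral>z. \<delta> * L2_norm M (\<lambda>w. ?f z w $ i) \<partial>lborel)"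
    using pair(1) int bound by (intro integral_mono integrable_abs integrable_mult_right) auto
  finally show "\<bar>\<integral>w. X w $ i * (X w $ i - R w) \<partial>M\<bar> \<le> (\<integral>z. L2_norm M (\<lambda>w. ?f z w $ i) \<partial>lborel) * \<delta>"
    by (simp add: mult.commute)
qed (use assms in \<open>auto intro: linear_span_L2[OF B] linear_span_zero linear_span_add_mult\<close>)

lemma L2_approx_add_mult:
  fixes X Y :: "'a \<Rightarrow> real"
  assumes B: "\<And>t. L2_fun M (B t)" and X: "L2_fun M X" and Y: "L2_fun M Y"
    and X': "\<And>\<epsilon>. 0 < \<epsilon> \<Longrightarrow> \<exists>R\<in>linear_span B. L2_norm M (\<lambda>w. X w - R w) < \<epsilon>"
    and Y': "\<And>\<epsilon>. 0 < \<epsilon> \<Longrightarrow> \<exists>R\<in>linear_span B. L2_norm M (\<lambda>w. Y w - R w) < \<epsilon>"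
    and "0 < \<epsilon>"
  shows "\<exists>R\<in>linear_span B. L2_norm M (\<lambda>w. (X w + s * Y w) - R w) < \<epsilon>"
proof -
  obtain R where R: "R \<in> linear_span B" "L2_norm M (\<lambda>w. X w - R w) < \<epsilon> / 2"
    using X'[of "\<epsilon> / 2"] \<open>0 < \<epsilon>\<close> by auto
  define \<eta> where "\<eta> = \<epsilon> / (2 * (\<bar>s\<bar> + 1))"
  have \<eta>: "0 < \<eta>" "\<bar>s\<bar> * \<eta> \<le> \<epsilon> / 2"
    using \<open>0 < \<epsilon>\<close> by (auto simp: \<eta>_def field_simps)
  obtain R' where R': "R' \<in> linear_span B" "L2_norm M (\<lambda>w. Y w - R' w) < \<eta>"
    using Y'[OF \<eta>(1)] by auto
  have d: "L2_fun M (\<lambda>w. X w - R w)" "L2_fun M (\<lambda>w. s *\<^sub>R (Y w - R' w))"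
    using X Y linear_span_L2[OF B] R(1) R'(1) by (auto intro!: L2_fun_diff L2_fun_scaleR[of M "\<lambda>w. Y w - R' w" s, simplified])
  have "L2_norm M (\<lambda>w. (X w - R w) + s *\<^sub>R (Y w - R' w))
      \<le> L2_norm M (\<lambda>w. X w - R w) + L2_norm M (\<lambda>w. s *\<^sub>R (Y w - R' w))"
    by (rule L2_norm_triangle[OF d])
  also have "L2_norm M (\<lambda>w. s *\<^sub>R (Y w - R' w)) = \<bar>s\<bar> * L2_norm M (\<lambda>w. Y w - R' w)"
    by (simp add: L2_norm_def power_mult_distrib real_sqrt_mult)
  also have "\<dots> \<le> \<bar>s\<bar> * \<eta>" using R'(2) by (intro mult_left_mono) auto
  finally have "L2_norm M (\<lambda>w. (X w - R w) + s *\<^sub>R (Y w - R' w)) < \<epsilon>"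
    using R(2) \<eta>(2) by simp
  moreover have "(\<lambda>w. (X w - R w) + s *\<^sub>R (Y w - R' w)) = (\<lambda>w. (X w + s * Y w) - (R w + s * R' w))"
    by (auto simp: algebra_simps)
  ultimately show ?thesis
    using linear_span_add_mult[OF R(1) R'(1), of s] by (intro bexI[of _ "\<lambda>w. R w + s * R' w"]) auto
qed

section \<open>Gaussian variables\<close>

lemma char_normal:
  assumes "0 < \<sigma>"
  shows "char (density lborel (\<lambda>x. ennreal (normal_density 0 \<sigma> x))) u
    = complex_of_real (exp (- ((u * \<sigma>)\<^sup>2) / 2))"
proof -
  have resc: "\<sigma> * normal_density 0 \<sigma> (\<sigma> * y) = std_normal_density y" for y
    using assms by (simp add: normal_density_def real_sqrt_mult power_mult_distrib field_simps)
  have "char (density lborel (\<lambda>x. ennreal (normal_density 0 \<sigma> x))) u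
      = (\<integral>x. normal_density 0 \<sigma> x *\<^sub>R iexp (u * x) \<partial>lborel)"
    unfolding char_def by (subst integral_density) auto
  also have "\<dots> = \<sigma> *\<^sub>R (\<integral>y. normal_density 0 \<sigma> (\<sigma> * y) *\<^sub>R iexp (u * (\<sigma> * y)) \<partial>lborel)"
    using assms by (subst lborel_integral_real_affine[where c = \<sigma> and t = 0]) auto
  also have "\<dots> = (\<integral>y. \<sigma> *\<^sub>R (normal_density 0 \<sigma> (\<sigma> * y) *\<^sub>R iexp (u * (\<sigma> * y))) \<partial>lborel)"
    by (rule integral_scaleR_right[symmetric])
  also have "\<dots> = (\<integral>y. std_normal_density y *\<^sub>R iexp ((u * \<sigma>) * y) \<partial>lborel)"
    unfolding scaleR_scaleR resc by (simp add: mult_ac)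
  also have "\<dots> = char std_normal_distribution (u * \<sigma>)"
    unfolding char_def by (subst integral_density) auto
  finally show ?thesis by (simp add: char_std_normal_distribution)
qed

lemma (in prob_space) expectation_iexp_eq_char:
  assumes "X \<in> borel_measurable M"
  shows "(\<integral>w. iexp (u * X w) \<partial>M) = char (distr M borel X) u"
  unfolding char_def using assms by (subst integral_distr) auto

lemma (in prob_space) centered_gaussian_moments:
  assumes "centered_gaussian M X"
  obtains \<sigma> where "0 \<le> \<sigma>"
    and "integrable M (\<lambda>w. (X w)\<^sup>2)" and "(\<integral>w. (X w)\<^sup>2 \<partial>M) = \<sigma>\<^sup>2"
    and "integrable M (\<lambda>w. (X w) ^ 4)" and "(\<integral>w. (X w) ^ 4 \<partial>M) = 3 * \<sigma> ^ 4"
    and "\<And>u. (\<integral>w. iexp (u * X w) \<partial>M) = complex_of_real (exp (- ((u * \<sigma>)\<^sup>2) / 2))"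
proof -
  have X [measurable]: "X \<in> borel_measurable M"
    using assms by (simp add: centered_gaussian_def)
  consider "distr M borel X = return borel 0"
    | \<sigma> where "\<sigma> > 0" "distr M borel X = density lborel (\<lambda>x. ennreal (normal_density 0 \<sigma> x))"
    using assms by (auto simp: centered_gaussian_def)
  then show thesis
  proof cases
    case 1
    have "AE x in distr M borel X. x = 0"
      unfolding 1 by (simp add: AE_return)
    then have zero: "AE w in M. X w = 0"
      by (subst (asm) AE_distr_iff) auto
    have int: "integrable M (\<lambda>w. f (X w)) \<and> (\<integral>w. f (X w) \<partial>M) = f 0"
      if [measurable]: "f \<in> borel_measurable borel" for f :: "real \<Rightarrow> real"
    proof -
      have ae: "AE w in M. f (X w) = f 0" using zero by auto
      have "integrable M (\<lambda>w. f (X w)) = integrable M (\<lambda>w. f 0)"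
        using ae by (intro Bochner_Integration.integrable_cong_AE) auto
      moreover have "(\<integral>w. f (X w) \<partial>M) = (\<integral>w. f 0 \<partial>M)"
        using ae by (intro integral_cong_AE) auto
      ultimately show ?thesis by (simp add: prob_space)
    qed
    have "(\<integral>w. iexp (u * X w) \<partial>M) = (\<integral>w. 1 \<partial>M)" for u :: real
      using zero by (intro integral_cong_AE) auto
    with int[of "\<lambda>x. x\<^sup>2"] int[of "\<lambda>x. x ^ 4"] show thesis
      by (intro that[of 0]) (auto simp: prob_space)
  next
    case 2
    have moment: "integrable M (\<lambda>w. X w ^ n) \<and>
        (\<integral>w. X w ^ n \<partial>M) = (\<integral>x. normal_density 0 \<sigma> x * x ^ n \<partial>lborel)" for n
    proof -
      have "integrable (distr M borel X) (\<lambda>x. x ^ n)"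
        unfolding 2 using integrable_normal_moment[of \<sigma> 0 n] 2(1)
        by (subst integrable_density) auto
      moreover have "(\<integral>x. x ^ n \<partial>distr M borel X) = (\<integral>x. normal_density 0 \<sigma> x * x ^ n \<partial>lborel)"
        unfolding 2 by (subst integral_density) auto
      ultimately show ?thesis
        by (simp add: integrable_distr_eq integral_distr)
    qed
    show thesis
    proof (rule that[of \<sigma>])
      show "(\<integral>w. (X w)\<^sup>2 \<partial>M) = \<sigma>\<^sup>2"
        using moment[of 2] integral_normal_moment_even[OF 2(1), of 0 1] by (simp add: fact_numeral)
      show "(\<integral>w. (X w) ^ 4 \<partial>M) = 3 * \<sigma> ^ 4"
        using moment[of 4] integral_normal_moment_even[OF 2(1), of 0 2] 2(1)
        by (simp add: fact_numeral power_divide flip: power_mult)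
      show "(\<integral>w. iexp (u * X w) \<partial>M) = complex_of_real (exp (- ((u * \<sigma>)\<^sup>2) / 2))" for u
        by (simp only: expectation_iexp_eq_char[OF X] 2(2) char_normal[OF 2(1)])
    qed (use moment 2(1) in auto)
  qed
qed

lemma (in prob_space) centered_gaussianI_char:
  assumes X [measurable]: "X \<in> borel_measurable M" and "0 \<le> \<sigma>"
    and ch: "\<And>u. (\<integral>w. iexp (u * X w) \<partial>M) = complex_of_real (exp (- ((u * \<sigma>)\<^sup>2) / 2))"
  shows "centered_gaussian M X"
proof -
  have rd: "real_distribution (distr M borel X)"
    using X by (simp add: real_distribution_distr)
  show ?thesis
  proof (cases "\<sigma> = 0")
    case True
    have "real_distribution (return borel (0::real))"
      by (simp add: real_distribution_def real_distribution_axioms_def prob_space_return)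
    moreover have "char (distr M borel X) u = char (return borel 0) u" for u
      using ch[of u] True unfolding expectation_iexp_eq_char[OF X]
      by (simp add: char_def integral_return)
    then have "char (distr M borel X) = char (return borel 0)" by (rule ext)
    ultimately have "distr M borel X = return borel 0"
      using rd by (intro Levy_uniqueness)
    with X show ?thesis by (simp add: centered_gaussian_def)
  next
    case False
    with \<open>0 \<le> \<sigma>\<close> have pos: "0 < \<sigma>" by simp
    let ?N = "density lborel (\<lambda>x. ennreal (normal_density 0 \<sigma> x))"
    have "real_distribution ?N"
      using prob_space_normal_density[OF pos]
      by (simp add: real_distribution_def real_distribution_axioms_def)
    moreover have "char (distr M borel X) u = char ?N u" for u
      using ch[of u] unfolding expectation_iexp_eq_char[OF X] char_normal[OF pos] .
    then have "char (distr M borel X) = char ?N" by (rule ext)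
    ultimately have "distr M borel X = ?N"
      using rd by (intro Levy_uniqueness)
    with X pos show ?thesis by (auto simp: centered_gaussian_def)
  qed
qed

lemma (in prob_space) centered_gaussian_L2:
  assumes "centered_gaussian M X"
  shows "L2_fun M X"
  using centered_gaussian_moments[OF assms] assms
  by (auto simp: L2_fun_def centered_gaussian_def)

text \<open>Mean-square limits of Gaussian variables are Gaussian because their characteristic functions
  converge, and the limiting characteristic function is the one of the limiting variance.\<close>

lemma (in prob_space) centered_gaussian_L2_limit:
  assumes X: "L2_fun M X"
    and approx: "\<And>\<epsilon>. 0 < \<epsilon> \<Longrightarrow> \<exists>R. centered_gaussian M R \<and> L2_norm M (\<lambda>w. X w - R w) < \<epsilon>"
  shows "centered_gaussian M X"
proof -
  have "\<exists>R. centered_gaussian M R \<and> L2_norm M (\<lambda>w. X w - R w) < inverse (real (Suc m))" for m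
    by (rule approx) simp
  then obtain R where R: "\<And>m. centered_gaussian M (R m)"
    and dist: "\<And>m. L2_norm M (\<lambda>w. X w - R m w) < inverse (real (Suc m))"
    by metis
  have X_meas [measurable]: "X \<in> borel_measurable M" using X by (rule L2_fun_measurable)
  have R2: "L2_fun M (R m)" for m by (rule centered_gaussian_L2[OF R])
  have R_meas [measurable]: "R m \<in> borel_measurable M" for m using R2 by (rule L2_fun_measurable)
  have dist0: "(\<lambda>m. L2_norm M (\<lambda>w. X w - R m w)) \<longlonglongrightarrow> 0"
    by (rule tendsto_sandwich[OF _ _ tendsto_const LIMSEQ_inverse_real_of_nat])
      (use dist in \<open>auto simp: L2_norm_nonneg less_imp_le\<close>)
  have norm_diff: "\<bar>L2_norm M (R m) - L2_norm M X\<bar> \<le> L2_norm M (\<lambda>w. X w - R m w)" for m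
    using L2_norm_triangle[OF L2_fun_diff[OF X R2[of m]] R2[of m]]
      L2_norm_triangle[OF L2_fun_diff[OF R2[of m] X] X] L2_norm_minus_commute[of M X "R m"]
    by simp
  have "(\<lambda>m. L2_norm M (R m) - L2_norm M X) \<longlonglongrightarrow> 0"
    by (rule Lim_null_comparison[OF always_eventually dist0]) (use norm_diff in auto)
  then have sd: "(\<lambda>m. L2_norm M (R m)) \<longlonglongrightarrow> L2_norm M X"
    by (simp add: LIM_zero_iff)
  have chR: "(\<integral>w. iexp (u * R m w) \<partial>M) = complex_of_real (exp (- ((u * L2_norm M (R m))\<^sup>2) / 2))" for u m
  proof -
    obtain \<sigma> where "0 \<le> \<sigma>" "(\<integral>w. (R m w)\<^sup>2 \<partial>M) = \<sigma>\<^sup>2"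
      "\<And>u. (\<integral>w. iexp (u * R m w) \<partial>M) = complex_of_real (exp (- ((u * \<sigma>)\<^sup>2) / 2))"
      using centered_gaussian_moments[OF R] by metis
    then show ?thesis by (simp add: L2_norm_def)
  qed
  have iexp_bound: "norm ((\<integral>w. iexp (u * R m w) \<partial>M) - (\<integral>w. iexp (u * X w) \<partial>M))
      \<le> \<bar>u\<bar> * L2_norm M (\<lambda>w. X w - R m w)" for u m
  proof -
    have int: "integrable M (\<lambda>w. iexp (u * Y w))" if [measurable]: "Y \<in> borel_measurable M" for Y
      by (rule integrable_const_bound[where B = 1]) auto
    have one: "L2_fun M (\<lambda>w. 1::real)" by (simp add: L2_fun_def)
    have Z: "L2_fun M (\<lambda>w. \<bar>X w - R m w\<bar>)"
      using L2_fun_norm[OF L2_fun_diff[OF X R2[of m]]] by simp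
    have pt: "norm (iexp (u * R m w) - iexp (u * X w)) \<le> \<bar>u\<bar> * (1 * \<bar>X w - R m w\<bar>)" for w
    proof -
      have "iexp (u * R m w) - iexp (u * X w) = iexp (u * X w) * (iexp (u * (R m w - X w)) - 1)"
        by (simp add: algebra_simps flip: exp_add)
      also have "norm \<dots> \<le> \<bar>u * (R m w - X w)\<bar>"
        using iexp_approx1[of "u * (R m w - X w)" 0] by (simp add: norm_mult)
      finally show ?thesis by (simp add: abs_mult abs_minus_commute)
    qed
    have "norm ((\<integral>w. iexp (u * R m w) \<partial>M) - (\<integral>w. iexp (u * X w) \<partial>M))
        = norm (\<integral>w. iexp (u * R m w) - iexp (u * X w) \<partial>M)"
      using int by simp
    also have "\<dots> \<le> (\<integral>w. norm (iexp (u * R m w) - iexp (u * X w)) \<partial>M)"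
      by (rule integral_norm_bound)
    also have "\<dots> \<le> (\<integral>w. \<bar>u\<bar> * (1 * \<bar>X w - R m w\<bar>) \<partial>M)"
      using int L2_fun_integrable_mult[OF one Z] pt
      by (intro integral_mono integrable_norm Bochner_Integration.integrable_diff integrable_mult_right) auto
    also have "\<dots> = \<bar>u\<bar> * (\<integral>w. 1 * \<bar>X w - R m w\<bar> \<partial>M)" by (rule integral_mult_right_zero)
    also have "\<dots> \<le> \<bar>u\<bar> * (L2_norm M (\<lambda>w. 1::real) * L2_norm M (\<lambda>w. \<bar>X w - R m w\<bar>))"
      using L2_Cauchy_Schwarz[OF one Z] by (intro mult_left_mono) (auto simp: abs_le_iff)
    also have "\<dots> = \<bar>u\<bar> * L2_norm M (\<lambda>w. X w - R m w)"
      by (simp add: L2_norm_def prob_space)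
    finally show ?thesis .
  qed
  show ?thesis
  proof (rule centered_gaussianI_char)
    fix u
    have "(\<lambda>m. (\<integral>w. iexp (u * R m w) \<partial>M) - (\<integral>w. iexp (u * X w) \<partial>M)) \<longlonglongrightarrow> 0"
      by (rule Lim_null_comparison[OF always_eventually tendsto_mult_right_zero[OF dist0]])
        (use iexp_bound in blast)
    then have "(\<lambda>m. \<integral>w. iexp (u * R m w) \<partial>M) \<longlonglongrightarrow> (\<integral>w. iexp (u * X w) \<partial>M)"
      by (simp add: LIM_zero_iff)
    moreover have "(\<lambda>m. \<integral>w. iexp (u * R m w) \<partial>M)
        \<longlonglongrightarrow> complex_of_real (exp (- ((u * L2_norm M X)\<^sup>2) / 2))"
      unfolding chR by (intro tendsto_of_real tendsto_exp tendsto_divide tendsto_minus tendsto_power tendsto_mult tendsto_const sd) simp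
    ultimately show "(\<integral>w. iexp (u * X w) \<partial>M) = complex_of_real (exp (- ((u * L2_norm M X)\<^sup>2) / 2))"
      by (rule LIMSEQ_unique)
  qed (simp_all add: L2_norm_nonneg)
qed

text \<open>By polarisation the product \<open>X\<^sub>1 X\<^sub>2 X\<^sub>3 X\<^sub>4\<close> is a combination, with coefficients \<open>\<plusminus> 1 / 192\<close>, of the
  fourth powers of \<open>X\<^sub>1 \<plusminus> X\<^sub>2 \<plusminus> X\<^sub>3 \<plusminus> X\<^sub>4\<close>. Their expectations are three times the squares of the
  variances, which are quadratic in the covariances of the four variables.\<close>

lemma (in prob_space) isserlis:
  assumes gauss: "\<And>a b c. centered_gaussian M (\<lambda>w. X1 w + a * X2 w + b * X3 w + c * X4 w)"
    and L2: "L2_fun M X1" "L2_fun M X2" "L2_fun M X3" "L2_fun M X4"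
  shows "integrable M (\<lambda>w. X1 w * X2 w * X3 w * X4 w)"
    and "(\<integral>w. X1 w * X2 w * X3 w * X4 w \<partial>M)
      = (\<integral>w. X1 w * X2 w \<partial>M) * (\<integral>w. X3 w * X4 w \<partial>M)
      + (\<integral>w. X1 w * X3 w \<partial>M) * (\<integral>w. X2 w * X4 w \<partial>M)
      + (\<integral>w. X1 w * X4 w \<partial>M) * (\<integral>w. X2 w * X3 w \<partial>M)" (is "?lhs = ?rhs")
proof -
  define T where "T a b c w = X1 w + a * X2 w + b * X3 w + c * X4 w" for a b c w
  define e where "e Y Z = (\<integral>w. Y w * Z w \<partial>M)" for Y Z :: "'a \<Rightarrow> real"
  have int2: "integrable M (\<lambda>w. Y w * Z w)"
    if "Y \<in> {X1, X2, X3, X4}" "Z \<in> {X1, X2, X3, X4}" for Y Z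
    using that L2 by (auto intro: L2_fun_integrable_mult)
  have T4: "integrable M (\<lambda>w. T a b c w ^ 4)" "(\<integral>w. T a b c w ^ 4 \<partial>M) = 3 * (\<integral>w. (T a b c w)\<^sup>2 \<partial>M)\<^sup>2"
    for a b c
  proof -
    obtain \<sigma> where "(\<integral>w. (T a b c w)\<^sup>2 \<partial>M) = \<sigma>\<^sup>2"
      "integrable M (\<lambda>w. T a b c w ^ 4)" "(\<integral>w. T a b c w ^ 4 \<partial>M) = 3 * \<sigma> ^ 4"
      by (rule centered_gaussian_moments[OF gauss[of a b c], folded T_def]) (rule that)
    then show "integrable M (\<lambda>w. T a b c w ^ 4)" "(\<integral>w. T a b c w ^ 4 \<partial>M) = 3 * (\<integral>w. (T a b c w)\<^sup>2 \<partial>M)\<^sup>2"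
      by simp_all
  qed
  have T2: "(\<integral>w. (T a b c w)\<^sup>2 \<partial>M) = e X1 X1 + a\<^sup>2 * e X2 X2 + b\<^sup>2 * e X3 X3 + c\<^sup>2 * e X4 X4
      + 2 * (a * e X1 X2 + b * e X1 X3 + c * e X1 X4 + a * b * e X2 X3 + a * c * e X2 X4 + b * c * e X3 X4)"
    for a b c
  proof -
    have "(T a b c w)\<^sup>2 = X1 w * X1 w + a\<^sup>2 * (X2 w * X2 w) + b\<^sup>2 * (X3 w * X3 w) + c\<^sup>2 * (X4 w * X4 w)
      + 2 * (a * (X1 w * X2 w) + b * (X1 w * X3 w) + c * (X1 w * X4 w) + a * b * (X2 w * X3 w)
        + a * c * (X2 w * X4 w) + b * c * (X3 w * X4 w))" for w
      unfolding T_def by (simp add: power2_eq_square algebra_simps)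
    then show ?thesis
      using int2 by (simp add: e_def)
  qed
  let ?pm = "{1, -1::real}"
  have polar: "X1 w * X2 w * X3 w * X4 w
      = (\<Sum>a\<in>?pm. \<Sum>b\<in>?pm. \<Sum>c\<in>?pm. a * b * c * T a b c w ^ 4) / 192" for w
    unfolding T_def by (simp, algebra)
  show "integrable M (\<lambda>w. X1 w * X2 w * X3 w * X4 w)"
    unfolding polar using T4(1) by (intro integrable_divide_zero Bochner_Integration.integrable_sum integrable_mult_right)
  have "?lhs = (\<Sum>a\<in>?pm. \<Sum>b\<in>?pm. \<Sum>c\<in>?pm. a * b * c * (3 * (\<integral>w. (T a b c w)\<^sup>2 \<partial>M)\<^sup>2)) / 192"
    unfolding polar T4(2)[symmetric] using T4(1) by simp
  also have "\<dots> = e X1 X2 * e X3 X4 + e X1 X3 * e X2 X4 + e X1 X4 * e X2 X3"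
    unfolding T2 by (simp add: power2_eq_square algebra_simps)
  finally show "?lhs = ?rhs"
    by (simp add: e_def)
qed

section \<open>The covariance of operator fractional Brownian motion\<close>

lemma (in prob_space) centered_gaussian_family_L2:
  fixes X :: "'i \<Rightarrow> 'a \<Rightarrow> 'b::euclidean_space"
  assumes X: "centered_gaussian_family M I X" and i: "i \<in> I"
  shows "L2_fun M (X i)"
proof -
  have meas: "X i \<in> borel_measurable M"
    using X i by (simp add: centered_gaussian_family_def)
  have "L2_fun M (\<lambda>w. b \<bullet> X i w)" for b
  proof -
    have "centered_gaussian M (\<lambda>w. \<Sum>k\<in>{i}. b \<bullet> X k w)"
      using X i unfolding centered_gaussian_family_def by (elim conjE allE[of _ "{i}"] allE[of _ "\<lambda>_. b"]) auto
    then show ?thesis using centered_gaussian_L2 by simp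
  qed
  then have "integrable M (\<lambda>w. \<Sum>b\<in>Basis. (b \<bullet> X i w)\<^sup>2)"
    by (intro Bochner_Integration.integrable_sum) (simp add: L2_fun_def)
  moreover have "(norm x)\<^sup>2 = (\<Sum>b\<in>Basis. (b \<bullet> x)\<^sup>2)" for x :: 'b
    by (subst power2_norm_eq_inner, subst euclidean_inner) (simp add: power2_eq_square inner_commute)
  ultimately show ?thesis using meas by (simp add: L2_fun_def)
qed

lemma bounded_bilinear_component_cnj:
  "bounded_bilinear (\<lambda>(u::complex^'n) (v::complex^'m). u $ a * cnj (v $ b))"
  by (rule bounded_bilinear.comp[OF bounded_bilinear_mult bounded_linear_vec_nth
        bounded_linear_compose[OF bounded_linear_cnj bounded_linear_vec_nth]])

lemma adjoint_product_component:
  "(P ** adjoint_matrix Q) $ a $ b = (\<Sum>c\<in>UNIV. P $ a $ c * cnj (Q $ b $ c))"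
  by (simp add: matrix_matrix_mult_def adjoint_matrix_def transpose_def map_matrix_def)

lemma bounded_bilinear_adjoint_product:
  "bounded_bilinear (\<lambda>(P::complex^'n^'m) (Q::complex^'n^'l). (P ** adjoint_matrix Q) $ a $ b)"
  unfolding adjoint_product_component
  by (rule bilinear_conv_bounded_bilinear[THEN iffD1])
    (auto simp: bilinear_def linear_iff sum.distrib scaleR_sum_right algebra_simps)

lemma integral_bilinear_sum_list:
  fixes X :: "'p \<Rightarrow> 'a \<Rightarrow> 'b::{real_normed_vector, second_countable_topology}"
    and Y :: "'q \<Rightarrow> 'a \<Rightarrow> 'c::{real_normed_vector, second_countable_topology}"
    and prod :: "'b \<Rightarrow> 'c \<Rightarrow> 'd::{banach, second_countable_topology}"
  assumes bil: "bounded_bilinear prod"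
    and X: "\<And>p. p \<in> set S \<Longrightarrow> L2_fun M (X p)" and Y: "\<And>q. q \<in> set S' \<Longrightarrow> L2_fun M (Y q)"
  shows "(\<integral>w. prod (\<Sum>p\<leftarrow>S. X p w) (\<Sum>q\<leftarrow>S'. Y q w) \<partial>M) = (\<Sum>p\<leftarrow>S. \<Sum>q\<leftarrow>S'. \<integral>w. prod (X p w) (Y q w) \<partial>M)"
proof -
  interpret bounded_bilinear prod by (rule bil)
  note int = L2_fun_bounded_bilinear_integrable[OF bil]
  have right: "(\<integral>w. prod (Z w) (\<Sum>q\<leftarrow>T. Y q w) \<partial>M) = (\<Sum>q\<leftarrow>T. \<integral>w. prod (Z w) (Y q w) \<partial>M)"
    if "L2_fun M Z" "\<And>q. q \<in> set T \<Longrightarrow> L2_fun M (Y q)" for Z T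
    using that(2)
  proof (induction T)
    case (Cons q T)
    then show ?case
      by (simp add: add_right int[OF that(1)] L2_fun_sum_list)
  qed (simp add: zero_right)
  show ?thesis
    using X
  proof (induction S)
    case (Cons p S)
    then show ?case
      by (simp add: add_left int L2_fun_sum_list Y right)
  qed (simp add: zero_left)
qed

lemma matrix_integral_component:
  fixes F :: "'a \<Rightarrow> 'b::euclidean_space^'n^'m"
  assumes "integrable M F"
  shows "(\<integral>w. F w \<partial>M) $ i $ k = (\<integral>w. F w $ i $ k \<partial>M)"
proof -
  have "bounded_linear (\<lambda>P::'b^'n^'m. P $ i $ k)"
    by (rule bounded_linear_compose[OF bounded_linear_vec_nth bounded_linear_vec_nth])
  from integral_bounded_linear[OF this assms] show ?thesis by simp
qed

lemma bounded_bilinear_outer: "bounded_bilinear (outer :: real^'n \<Rightarrow> real^'m \<Rightarrow> real^'m^'n)"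
  by (rule bilinear_conv_bounded_bilinear[THEN iffD1])
    (auto simp: bilinear_def linear_iff outer_def vec_eq_iff algebra_simps)

lemma gaussian_random_measure_L2:
  assumes "gaussian_random_measure N Bt" and "E \<in> fmeasurable lborel"
  shows "L2_fun N (Bt E)"
  using assms prob_space.centered_gaussian_family_L2[of N "fmeasurable lborel" Bt E]
  by (simp add: gaussian_random_measure_def)

lemma gaussian_random_measure_covariance:
  assumes Bt: "gaussian_random_measure N Bt"
    and E: "E \<in> fmeasurable lborel" and F: "F \<in> fmeasurable lborel"
  shows "(\<integral>w. (Bt E w) $ c * cnj ((Bt F w) $ d) \<partial>N) = (if c = d then of_real (measure lborel (E \<inter> F)) else 0)"
proof -
  have bil: "bounded_bilinear (\<lambda>(u::complex^'n) (v::complex^'n). outer u (conj_vec v))"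
    by (rule bilinear_conv_bounded_bilinear[THEN iffD1])
      (auto simp: bilinear_def linear_iff outer_def conj_vec_def vec_eq_iff algebra_simps)
  have "integrable N (\<lambda>w. outer (Bt E w) (conj_vec (Bt F w)))"
    by (intro L2_fun_bounded_bilinear_integrable[OF bil] gaussian_random_measure_L2[OF Bt] E F)
  then have "(\<integral>w. outer (Bt E w) (conj_vec (Bt F w)) \<partial>N) $ c $ d = (\<integral>w. (Bt E w) $ c * cnj ((Bt F w) $ d) \<partial>N)"
    by (subst matrix_integral_component) (simp_all add: outer_def conj_vec_def)
  then show ?thesis
    using Bt E F by (simp add: gaussian_random_measure_def mat_def)
qed

lemma L2_fun_indicator:
  fixes C :: "'b::{real_normed_vector, second_countable_topology}"
  assumes "E \<in> fmeasurable M"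
  shows "L2_fun M (\<lambda>x. indicat_real E x *\<^sub>R C)"
proof -
  have sq: "(norm (indicat_real E x *\<^sub>R C))\<^sup>2 = indicat_real E x * (norm C)\<^sup>2" for x
    by (auto simp: indicator_def)
  have "E \<in> sets M" "emeasure M E < \<infinity>" using assms by (auto simp: fmeasurable_def)
  then show ?thesis
    unfolding L2_fun_def sq by (auto intro!: borel_measurable_scaleR integrable_mult_left)
qed

lemma bounded_linear_matrix_vector_mult:
  "bounded_linear (\<lambda>v::complex^'n. (C::complex^'n^'m) *v v)"
  by (rule linear_conv_bounded_linear[THEN iffD1], rule linearI)
    (simp_all add: matrix_vector_mult_def vec_eq_iff sum.distrib scaleR_sum_right algebra_simps)

text \<open>The isometry property in bilinear form: it holds for step functions by orthogonality of the
  increments of the random measure, and both sides pass to mean-square limits.\<close>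

lemma has_gaussian_integral_covariance:
  fixes Bt :: "real set \<Rightarrow> 'v \<Rightarrow> complex^'n"
  assumes Bt: "gaussian_random_measure N Bt"
    and X: "has_gaussian_integral N Bt f X" and Y: "has_gaussian_integral N Bt g Y"
  shows "integrable lborel (\<lambda>x. (f x ** adjoint_matrix (g x)) $ a $ b)"
    and "(\<integral>w. X w $ a * cnj (Y w $ b) \<partial>N) = (\<integral>x. (f x ** adjoint_matrix (g x)) $ a $ b \<partial>lborel)"
      (is "?cov = ?spec")
proof -
  obtain S where S: "\<And>m. \<forall>(E, C) \<in> set (S m). E \<in> fmeasurable lborel"
    and Sf: "L2_tendsto lborel (\<lambda>m x. \<Sum>(E, C)\<leftarrow>S m. indicat_real E x *\<^sub>R C) f"
    and SX: "L2_tendsto N (\<lambda>m w. \<Sum>(E, C)\<leftarrow>S m. C *v Bt E w) X"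
    using X unfolding has_gaussian_integral_def by blast
  obtain T where T: "\<And>m. \<forall>(E, C) \<in> set (T m). E \<in> fmeasurable lborel"
    and Tg: "L2_tendsto lborel (\<lambda>m x. \<Sum>(E, C)\<leftarrow>T m. indicat_real E x *\<^sub>R C) g"
    and TY: "L2_tendsto N (\<lambda>m w. \<Sum>(E, C)\<leftarrow>T m. C *v Bt E w) Y"
    using Y unfolding has_gaussian_integral_def by blast
  show "integrable lborel (\<lambda>x. (f x ** adjoint_matrix (g x)) $ a $ b)"
    using Sf Tg by (intro L2_fun_bounded_bilinear_integrable[OF bounded_bilinear_adjoint_product])
      (auto simp: L2_tendsto_def)
  have elementary: "(\<integral>w. (C *v Bt E w) $ a * cnj ((C' *v Bt F w) $ b) \<partial>N)
      = (\<integral>x. ((indicat_real E x *\<^sub>R C) ** adjoint_matrix (indicat_real F x *\<^sub>R C')) $ a $ b \<partial>lborel)"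
    if E: "E \<in> fmeasurable lborel" and F: "F \<in> fmeasurable lborel" for E F and C C' :: "complex^'n^'n"
  proof -
    have "(C *v Bt E w) $ a * cnj ((C' *v Bt F w) $ b)
        = (\<Sum>c\<in>UNIV. \<Sum>d\<in>UNIV. (C $ a $ c * cnj (C' $ b $ d)) * (Bt E w $ c * cnj (Bt F w $ d)))" for w
      by (simp add: matrix_vector_mult_def sum_product mult_ac)
    then have "(\<integral>w. (C *v Bt E w) $ a * cnj ((C' *v Bt F w) $ b) \<partial>N)
        = (\<Sum>c\<in>UNIV. \<Sum>d\<in>UNIV. (C $ a $ c * cnj (C' $ b $ d)) * (\<integral>w. Bt E w $ c * cnj (Bt F w $ d) \<partial>N))"
      using L2_fun_bounded_bilinear_integrable[OF bounded_bilinear_component_cnj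
          gaussian_random_measure_L2[OF Bt E] gaussian_random_measure_L2[OF Bt F]]
      by simp
    also have "\<dots> = (\<Sum>c\<in>UNIV. C $ a $ c * cnj (C' $ b $ c)) * of_real (measure lborel (E \<inter> F))"
      by (simp add: gaussian_random_measure_covariance[OF Bt E F] if_distrib[of "\<lambda>x. _ * x"] sum_distrib_right
          cong: if_cong)
    also have "\<dots> = (\<integral>x. (\<Sum>c\<in>UNIV. C $ a $ c * cnj (C' $ b $ c)) * of_real (indicat_real (E \<inter> F) x) \<partial>lborel)"
      using E F by (simp add: fmeasurable_def)
    also have "\<dots> = (\<integral>x. ((indicat_real E x *\<^sub>R C) ** adjoint_matrix (indicat_real F x *\<^sub>R C')) $ a $ b \<partial>lborel)"
      by (intro Bochner_Integration.integral_cong)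
        (auto simp: adjoint_product_component indicator_def sum_distrib_right)
    finally show ?thesis .
  qed
  have step: "(\<integral>w. (\<Sum>(E, C)\<leftarrow>S m. C *v Bt E w) $ a * cnj ((\<Sum>(E, C)\<leftarrow>T m. C *v Bt E w) $ b) \<partial>N)
      = (\<integral>x. ((\<Sum>(E, C)\<leftarrow>S m. indicat_real E x *\<^sub>R C) **
          adjoint_matrix (\<Sum>(E, C)\<leftarrow>T m. indicat_real E x *\<^sub>R C)) $ a $ b \<partial>lborel)" for m
  proof -
    have SE: "fst p \<in> fmeasurable lborel" if "p \<in> set (S m)" for p
      using S[of m] that by auto
    have TE: "fst p \<in> fmeasurable lborel" if "p \<in> set (T m)" for p
      using T[of m] that by auto
    have "(\<integral>w. (\<Sum>p\<leftarrow>S m. snd p *v Bt (fst p) w) $ a * cnj ((\<Sum>q\<leftarrow>T m. snd q *v Bt (fst q) w) $ b) \<partial>N)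
      = (\<Sum>p\<leftarrow>S m. \<Sum>q\<leftarrow>T m. \<integral>w. (snd p *v Bt (fst p) w) $ a * cnj ((snd q *v Bt (fst q) w) $ b) \<partial>N)"
      using SE TE by (intro integral_bilinear_sum_list[OF bounded_bilinear_component_cnj]
          L2_fun_bounded_linear[OF bounded_linear_matrix_vector_mult] gaussian_random_measure_L2[OF Bt])
    also have "\<dots> = (\<Sum>p\<leftarrow>S m. \<Sum>q\<leftarrow>T m. \<integral>x. ((indicat_real (fst p) x *\<^sub>R snd p) **
        adjoint_matrix (indicat_real (fst q) x *\<^sub>R snd q)) $ a $ b \<partial>lborel)"
      using SE TE by (intro arg_cong[where f = sum_list] map_cong refl elementary) auto
    also have "\<dots> = (\<integral>x. ((\<Sum>p\<leftarrow>S m. indicat_real (fst p) x *\<^sub>R snd p) **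
          adjoint_matrix (\<Sum>q\<leftarrow>T m. indicat_real (fst q) x *\<^sub>R snd q)) $ a $ b \<partial>lborel)"
      using SE TE by (intro integral_bilinear_sum_list[OF bounded_bilinear_adjoint_product, symmetric]
          L2_fun_indicator)
    finally show ?thesis by (simp add: case_prod_unfold)
  qed
  note to_cov = L2_tendsto_bounded_bilinear[OF bounded_bilinear_component_cnj[of a b] SX TY]
  note to_spec = L2_tendsto_bounded_bilinear[OF bounded_bilinear_adjoint_product[of a b] Sf Tg]
  show "?cov = ?spec"
    by (rule LIMSEQ_unique[OF to_cov[unfolded step] to_spec])
qed

lemma same_fdd_covariance:
  fixes X :: "real \<Rightarrow> 'a \<Rightarrow> real^'n"
  assumes "same_fdd M X N Y"
  shows "(\<integral>w. X s w $ a * X t w $ b \<partial>M) = (\<integral>w. Y s w $ a * Y t w $ b \<partial>N)"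
proof -
  have XY: "X r \<in> borel_measurable M" "Y r \<in> borel_measurable N" for r
    using assms by (auto simp: same_fdd_def)
  let ?P = "\<Pi>\<^sub>M r\<in>{s, t}. (borel :: (real^'n) measure)"
  let ?h = "\<lambda>x. x s $ a * x t $ b"
  have comp: "(\<lambda>x. x r $ i) \<in> borel_measurable ?P" if "r \<in> {s, t}" for r i
    using borel_measurable_continuous_on[OF linear_continuous_on[OF bounded_linear_vec_nth]
        measurable_component_singleton[OF that, of "\<lambda>_. borel"]] .
  have h: "?h \<in> borel_measurable ?P"
    by (intro borel_measurable_times comp) auto
  have mX: "(\<lambda>w. \<lambda>r\<in>{s, t}. X r w) \<in> measurable M ?P" and mY: "(\<lambda>w. \<lambda>r\<in>{s, t}. Y r w) \<in> measurable N ?P"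
    using XY by (auto intro!: measurable_restrict)
  have "(\<integral>w. X s w $ a * X t w $ b \<partial>M) = (\<integral>x. ?h x \<partial>distr M ?P (\<lambda>w. \<lambda>r\<in>{s, t}. X r w))"
    by (subst integral_distr[OF mX h]) simp
  also have "distr M ?P (\<lambda>w. \<lambda>r\<in>{s, t}. X r w) = distr N ?P (\<lambda>w. \<lambda>r\<in>{s, t}. Y r w)"
    using assms by (simp add: same_fdd_def)
  also have "(\<integral>x. ?h x \<partial>distr N ?P (\<lambda>w. \<lambda>r\<in>{s, t}. Y r w)) = (\<integral>w. Y s w $ a * Y t w $ b \<partial>N)"
    by (subst integral_distr[OF mY h]) simp
  finally show ?thesis .
qed

lemma adjoint_matrix_mult: "adjoint_matrix (P ** Q) = adjoint_matrix Q ** adjoint_matrix P"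
  by (simp add: adjoint_matrix_def matrix_matrix_mult_def transpose_def map_matrix_def vec_eq_iff mult.commute)

lemma complex_matrix_mult: "complex_matrix (P ** Q) = complex_matrix P ** complex_matrix Q"
  by (simp add: matrix_matrix_mult_def map_matrix_def vec_eq_iff)

lemma adjoint_complex_matrix: "adjoint_matrix (complex_matrix P) = complex_matrix (transpose P)"
  by (simp add: adjoint_matrix_def transpose_def map_matrix_def vec_eq_iff)

text \<open>Time reversibility makes \<open>A A\<^sup>*\<close> real, hence equal to the matrix built from the conjugate of \<open>A\<close>,
  which governs the negative frequencies. Once the scalar factor \<open>(exp (\<i> t x) - 1) / (\<i> x)\<close> is taken
  out of the kernel, what remains of the spectral density is thus a real even function of \<open>x\<close>,
  \<open>\<bar>x\<bar> powr (- D) ** Re (A A\<^sup>*) ** (\<bar>x\<bar> powr (- D))\<^sup>T\<close>.\<close>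

definition spectral_matrix :: "real^'n^'n \<Rightarrow> complex^'n^'n \<Rightarrow> real \<Rightarrow> real^'n^'n" where
  "spectral_matrix H A y = (let P = mat_powr y (- (H - (1/2) *\<^sub>R mat 1)) in
     P ** map_matrix Re (A ** adjoint_matrix A) ** transpose P)"

text \<open>Taking real parts early replaces a parity argument: the covariance is real, so only the cosines in
  \<open>(exp (\<i> s x) - 1) (exp (- \<i> t x) - 1)\<close> contribute. Grouped as below they become the three
  variances of \<open>B s\<close>, \<open>B t\<close> and \<open>B (s - t)\<close>.\<close>

lemma ofbm_kernel_product:
  fixes A :: "complex^'n^'n"
  assumes "time_reversible A"
  shows "Re ((ofbm_kernel H A s x ** adjoint_matrix (ofbm_kernel H A t x)) $ a $ b)
    = ((1 - cos (s * x)) + (1 - cos (t * x)) - (1 - cos ((s - t) * x))) / x\<^sup>2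
      * spectral_matrix H A \<bar>x\<bar> $ a $ b"
proof (cases "x = 0")
  case True
  then show ?thesis
    by (simp add: ofbm_kernel_def Let_def adjoint_product_component map_matrix_def)
next
  case False
  define R where "R = map_matrix Re (A ** adjoint_matrix A)"
  define P where "P y = mat_powr y (- (H - (1/2) *\<^sub>R mat 1))" for y
  define \<kappa> where "\<kappa> t = (exp (\<i> * of_real (t * x)) - 1) / (\<i> * of_real x)" for t :: real
  define E where "E = complex_matrix (P (max x 0)) ** A + complex_matrix (P (max (- x) 0)) ** map_matrix cnj A"
  have R: "A ** adjoint_matrix A = complex_matrix R"
  proof -
    have "Im ((A ** adjoint_matrix A) $ i $ k) = 0" for i k
      using assms by (simp add: time_reversible_def map_matrix_def vec_eq_iff)
    then show ?thesis by (simp add: R_def map_matrix_def vec_eq_iff complex_eq_iff)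
  qed
  have Rc: "map_matrix cnj A ** adjoint_matrix (map_matrix cnj A) = complex_matrix R"
  proof -
    have "(map_matrix cnj A ** adjoint_matrix (map_matrix cnj A)) $ i $ k = cnj ((A ** adjoint_matrix A) $ i $ k)" for i k
      by (simp add: adjoint_product_component map_matrix_def)
    then show ?thesis unfolding R by (simp add: vec_eq_iff map_matrix_def)
  qed
  have P0: "complex_matrix (P 0) ** Q = 0" for Q :: "complex^'n^'n"
    by (simp add: P_def mat_powr_def map_matrix_def matrix_matrix_mult_def vec_eq_iff)
  have half: "(complex_matrix (P y) ** C) ** adjoint_matrix (complex_matrix (P y) ** C) = complex_matrix (P y ** R ** transpose (P y))"
    if C: "C ** adjoint_matrix C = complex_matrix R" for y and C :: "complex^'n^'n"
  proof -
    have "(complex_matrix (P y) ** C) ** adjoint_matrix (complex_matrix (P y) ** C)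
        = complex_matrix (P y) ** (C ** adjoint_matrix C) ** adjoint_matrix (complex_matrix (P y))"
      by (simp add: adjoint_matrix_mult matrix_mul_assoc)
    then show ?thesis by (simp add: C adjoint_complex_matrix complex_matrix_mult)
  qed
  have E: "E ** adjoint_matrix E = complex_matrix (P \<bar>x\<bar> ** R ** transpose (P \<bar>x\<bar>))"
  proof (cases "0 < x")
    case True
    then have "E = complex_matrix (P \<bar>x\<bar>) ** A" by (simp add: E_def P0)
    then show ?thesis using half[OF R] by simp
  next
    case False
    with \<open>x \<noteq> 0\<close> have "E = complex_matrix (P \<bar>x\<bar>) ** map_matrix cnj A" by (simp add: E_def P0)
    then show ?thesis using half[OF Rc] by simp
  qed
  have K: "ofbm_kernel H A t x = map_matrix (\<lambda>z. \<kappa> t * z) E" for t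
    by (simp add: ofbm_kernel_def Let_def \<kappa>_def E_def P_def)
  have "(ofbm_kernel H A s x ** adjoint_matrix (ofbm_kernel H A t x)) $ a $ b
      = \<kappa> s * cnj (\<kappa> t) * (E ** adjoint_matrix E) $ a $ b"
    unfolding K adjoint_product_component by (simp add: map_matrix_def sum_distrib_left mult_ac)
  also have "\<dots> = \<kappa> s * cnj (\<kappa> t) * of_real (spectral_matrix H A \<bar>x\<bar> $ a $ b)"
    unfolding E by (simp add: spectral_matrix_def Let_def P_def R_def map_matrix_def)
  finally have main: "Re ((ofbm_kernel H A s x ** adjoint_matrix (ofbm_kernel H A t x)) $ a $ b)
      = Re (\<kappa> s * cnj (\<kappa> t)) * spectral_matrix H A \<bar>x\<bar> $ a $ b"
    by simp
  have k: "\<kappa> s * cnj (\<kappa> t) = (cis (s * x) - 1) * (cis (- (t * x)) - 1) / of_real (x\<^sup>2)"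
  proof -
    have "\<i> * complex_of_real x * (\<i> * complex_of_real x) = - (complex_of_real x * complex_of_real x)"
      by (simp add: complex_eq_iff)
    then show ?thesis by (simp add: \<kappa>_def cis_conv_exp exp_cnj power2_eq_square)
  qed
  have r: "Re ((cis (s * x) - 1) * (cis (- (t * x)) - 1) / of_real (x\<^sup>2)) = ((1 - cos (s * x)) + (1 - cos (t * x)) - (1 - cos ((s - t) * x))) / x\<^sup>2"
    unfolding Re_divide_of_real
    by (simp add: algebra_simps cos_diff)
  show ?thesis unfolding main k r ..
qed

text \<open>The covariance matrix of \<open>B u\<close>, and the function inside the double integral of \<open>Omega\<close>.\<close>

definition variance_function :: "real^'n^'n \<Rightarrow> real^'n^'n \<Rightarrow> real \<Rightarrow> real^'n^'n" where
  "variance_function H S u = mat_powr \<bar>u\<bar> H ** S ** mat_powr \<bar>u\<bar> (transpose H)"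

lemma variance_function_zero [simp]: "variance_function H S 0 = 0"
  by (simp add: variance_function_def mat_powr_def matrix_matrix_mult_def vec_eq_iff)

lemma variance_function_minus [simp]: "variance_function H S (- u) = variance_function H S u"
  by (simp add: variance_function_def)

lemma sandwich_component:
  "(U ** Q ** transpose U) $ a $ b = (\<Sum>c\<in>UNIV. \<Sum>d\<in>UNIV. U $ a $ c * U $ b $ d * (Q::real^'n^'n) $ c $ d)"
proof -
  have "(U ** Q ** transpose U) $ a $ b = (\<Sum>d\<in>UNIV. \<Sum>c\<in>UNIV. U $ a $ c * U $ b $ d * Q $ c $ d)"
    by (simp add: matrix_matrix_mult_def transpose_def sum_distrib_right sum_distrib_left mult_ac)
  then show ?thesis by (subst sum.swap)
qed

text \<open>Substituting \<open>x = y / \<bar>t\<bar>\<close> in the spectral integral of the variance extracts the factor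
  \<open>\<bar>t\<bar>\<^sup>H\<close> on either side.\<close>

lemma spectral_integral_scaling:
  fixes H S :: "real^'n^'n" and A :: "complex^'n^'n"
  defines "q t \<equiv> \<lambda>x a b. 2 * (1 - cos (t * x)) / x\<^sup>2 * spectral_matrix H A \<bar>x\<bar> $ a $ b"
  assumes int: "\<And>a b. integrable lborel (\<lambda>x. q 1 x a b)"
    and S: "\<And>a b. S $ a $ b = (\<integral>x. q 1 x a b \<partial>lborel)"
  shows "(\<integral>x. q t x a b \<partial>lborel) = variance_function H S t $ a $ b"
proof (cases "t = 0")
  case True
  then show ?thesis by (simp add: q_def)
next
  case False
  define u where "u = \<bar>t\<bar>"
  have u: "0 < u" using False by (simp add: u_def)
  define D where "D = H - (1/2) *\<^sub>R mat 1"
  define U where "U = mat_powr u D"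
  have Q: "spectral_matrix H A (\<bar>y\<bar> / u) = U ** spectral_matrix H A \<bar>y\<bar> ** transpose U" if "y \<noteq> 0" for y
  proof -
    have "mat_powr (\<bar>y\<bar> / u) (- D) = U ** mat_powr \<bar>y\<bar> (- D)"
      using mat_powr_mult[of "inverse u" "\<bar>y\<bar>" "- D"] u that
      by (simp add: U_def mat_powr_inverse_minus divide_inverse mult.commute)
    then show ?thesis
      by (simp add: spectral_matrix_def Let_def D_def[symmetric] matrix_transpose_mul matrix_mul_assoc)
  qed
  have pt: "q t (0 + inverse u * y) a b = u\<^sup>2 * (\<Sum>c\<in>UNIV. \<Sum>d\<in>UNIV. U $ a $ c * U $ b $ d * q 1 y c d)" for y
  proof (cases "y = 0")
    case False
    have "t * (0 + inverse u * y) = y \<or> t * (0 + inverse u * y) = - y"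
      using \<open>t \<noteq> 0\<close> by (cases "0 < t") (simp_all add: u_def)
    then have "cos (t * (0 + inverse u * y)) = cos (1 * y)"
      by (elim disjE) (simp_all only: cos_minus mult_1)
    moreover have "\<bar>0 + inverse u * y\<bar> = \<bar>y\<bar> / u"
      using u by (simp add: abs_mult divide_inverse)
    ultimately have "q t (0 + inverse u * y) a b
        = 2 * (1 - cos (1 * y)) / (0 + inverse u * y)\<^sup>2 * (U ** spectral_matrix H A \<bar>y\<bar> ** transpose U) $ a $ b"
      unfolding q_def using Q[OF False] by simp
    also have "\<dots> = u\<^sup>2 * (2 * (1 - cos (1 * y)) / y\<^sup>2 * (U ** spectral_matrix H A \<bar>y\<bar> ** transpose U) $ a $ b)"
      using u by (simp add: power_mult_distrib field_simps)
    also have "2 * (1 - cos (1 * y)) / y\<^sup>2 * (U ** spectral_matrix H A \<bar>y\<bar> ** transpose U) $ a $ b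
        = (\<Sum>c\<in>UNIV. \<Sum>d\<in>UNIV. U $ a $ c * U $ b $ d * q 1 y c d)"
      unfolding sandwich_component q_def by (simp add: sum_distrib_left mult_ac)
    finally show ?thesis .
  qed (simp add: q_def)
  have "(\<integral>x. q t x a b \<partial>lborel) = inverse u * (\<integral>y. q t (0 + inverse u * y) a b \<partial>lborel)"
    using u by (subst lborel_integral_real_affine[where c = "inverse u" and t = 0]) auto
  also have "\<dots> = inverse u * (u\<^sup>2 * (\<Sum>c\<in>UNIV. \<Sum>d\<in>UNIV. U $ a $ c * U $ b $ d * S $ c $ d))"
    unfolding pt S using int by simp
  also have "\<dots> = u * (U ** S ** transpose U) $ a $ b"
    using u by (simp add: sandwich_component power2_eq_square)
  also have "\<dots> = (mat_powr u H ** S ** mat_powr u (transpose H)) $ a $ b"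
  proof -
    have H: "mat_powr u H = sqrt u *\<^sub>R U"
      using mat_powr_add_scalar[OF u, of D "1/2"] u by (simp add: U_def D_def powr_half_sqrt)
    have "(sqrt u *\<^sub>R U) ** S ** transpose (sqrt u *\<^sub>R U) = u *\<^sub>R (U ** S ** transpose U)"
    proof -
      have "(r *\<^sub>R U) ** S ** transpose (r *\<^sub>R U) = (r * r) *\<^sub>R (U ** S ** transpose U)" for r
        by (simp add: matrix_matrix_mult_def transpose_def vec_eq_iff sum_distrib_left sum_distrib_right mult_ac)
      from this[of "sqrt u"] u show ?thesis by simp
    qed
    then show ?thesis by (simp add: mat_powr_transpose H)
  qed
  finally show ?thesis by (simp add: variance_function_def u_def)
qed

lemma ofbm_covariance:
  fixes B :: "real \<Rightarrow> 'w \<Rightarrow> real^'n"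
  assumes B: "is_ofbm M B N Bt H A" and rev: "time_reversible A"
    and S: "S = (\<integral>w. outer (B 1 w) (B 1 w) \<partial>M)"
  shows "L2_fun M (B t)"
    and "(\<integral>w. B s w $ a * B t w $ b \<partial>M)
      = (variance_function H S s + variance_function H S t - variance_function H S (s - t)) $ a $ b / 2"
proof -
  have M: "prob_space M" and fam: "centered_gaussian_family M UNIV B" and Bt: "gaussian_random_measure N Bt"
    using B by (auto simp: is_ofbm_def)
  show L2: "L2_fun M (B t)" for t
    by (rule prob_space.centered_gaussian_family_L2[OF M fam]) simp
  obtain Y where Y: "\<And>t. has_gaussian_integral N Bt (ofbm_kernel H A t) (\<lambda>w. complex_vec (Y t w))"
    and fdd: "same_fdd M B N Y"
    using B by (auto simp: is_ofbm_def)
  define q where "q t x a b = 2 * (1 - cos (t * x)) / x\<^sup>2 * spectral_matrix H A \<bar>x\<bar> $ a $ b" for t x :: real and a b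
  have Re_kernel: "Re ((ofbm_kernel H A s x ** adjoint_matrix (ofbm_kernel H A t x)) $ a $ b)
      = (q s x a b + q t x a b - q (s - t) x a b) / 2" for s t x a b
    unfolding ofbm_kernel_product[OF rev] q_def by (simp add: diff_divide_distrib add_divide_distrib algebra_simps)
  note iso = has_gaussian_integral_covariance[OF Bt Y Y]
  have int: "integrable lborel (\<lambda>x. q t x a b)" for t a b
  proof -
    have "(q t x a b + q t x a b - q (t - t) x a b) / 2 = q t x a b" for x
      by (simp add: q_def)
    with integrable_Re[OF iso(1)[of t t a b]] show ?thesis
      unfolding Re_kernel by simp
  qed
  have cov: "(\<integral>w. B s w $ a * B t w $ b \<partial>M)
      = ((\<integral>x. q s x a b \<partial>lborel) + (\<integral>x. q t x a b \<partial>lborel) - (\<integral>x. q (s - t) x a b \<partial>lborel)) / 2" for s t a b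
  proof -
    have "complex_of_real (\<integral>w. Y s w $ a * Y t w $ b \<partial>N)
        = (\<integral>w. complex_vec (Y s w) $ a * cnj (complex_vec (Y t w) $ b) \<partial>N)"
      by (simp add: complex_vec_def flip: integral_complex_of_real)
    also have "\<dots> = (\<integral>x. (ofbm_kernel H A s x ** adjoint_matrix (ofbm_kernel H A t x)) $ a $ b \<partial>lborel)"
      by (rule iso(2))
    finally have "(\<integral>w. Y s w $ a * Y t w $ b \<partial>N)
        = (\<integral>x. Re ((ofbm_kernel H A s x ** adjoint_matrix (ofbm_kernel H A t x)) $ a $ b) \<partial>lborel)"
      using integral_Re[OF iso(1)[of s t a b]] by (metis Re_complex_of_real)
    also have "\<dots> = ((\<integral>x. q s x a b \<partial>lborel) + (\<integral>x. q t x a b \<partial>lborel) - (\<integral>x. q (s - t) x a b \<partial>lborel)) / 2"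
      unfolding Re_kernel using int by simp
    finally show ?thesis by (simp add: same_fdd_covariance[OF fdd])
  qed
  have S_comp: "S $ a $ b = (\<integral>x. q 1 x a b \<partial>lborel)" for a b
  proof -
    have "S $ a $ b = (\<integral>w. B 1 w $ a * B 1 w $ b \<partial>M)"
      unfolding S matrix_integral_component[OF L2_fun_bounded_bilinear_integrable[OF bounded_bilinear_outer L2 L2]]
      by (simp add: outer_def)
    also have "\<dots> = (\<integral>x. q 1 x a b \<partial>lborel)"
      unfolding cov by (simp add: q_def)
    finally show ?thesis .
  qed
  have "(\<integral>x. q t x a b \<partial>lborel) = variance_function H S t $ a $ b" for t a b
    using spectral_integral_scaling[of H A S t a b] int[of 1] S_comp unfolding q_def by simp
  then show "(\<integral>w. B s w $ a * B t w $ b \<partial>M)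
      = (variance_function H S s + variance_function H S t - variance_function H S (s - t)) $ a $ b / 2"
    unfolding cov by simp
qed

section \<open>The variance function\<close>

text \<open>The operator of the Lyapunov equation. It plays the role of \<open>u d/du\<close> on the variance function.\<close>

definition lyapunov :: "real^'n^'n \<Rightarrow> real^'n^'n \<Rightarrow> real^'n^'n" where
  "lyapunov H X = H ** X + X ** transpose H"

lemma bounded_linear_lyapunov: "bounded_linear (lyapunov H)"
  unfolding lyapunov_def
  by (intro bounded_linear_add bounded_bilinear.bounded_linear_right[OF bounded_bilinear_matrix_mult]
      bounded_bilinear.bounded_linear_left[OF bounded_bilinear_matrix_mult])

lemma variance_function_has_vector_derivative:
  assumes "0 < u"
  shows "(variance_function H S has_vector_derivative inverse u *\<^sub>R lyapunov H (variance_function H S u)) (at u)"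
proof -
  let ?P = "\<lambda>u. mat_powr u H"
  have P: "(?P has_vector_derivative inverse u *\<^sub>R (H ** ?P u)) (at u)"
    by (rule mat_powr_has_vector_derivative[OF assms])
  have PS: "((\<lambda>u. ?P u ** S) has_vector_derivative (inverse u *\<^sub>R (H ** ?P u)) ** S) (at u)"
    by (rule bounded_linear.has_vector_derivative
        [OF bounded_bilinear.bounded_linear_left[OF bounded_bilinear_matrix_mult] P])
  have T: "((\<lambda>u. transpose (?P u)) has_vector_derivative transpose (inverse u *\<^sub>R (H ** ?P u))) (at u)"
    by (rule bounded_linear.has_vector_derivative[OF bounded_linear_transpose P])
  have "((\<lambda>u. (?P u ** S) ** transpose (?P u)) has_vector_derivative
      (?P u ** S) ** transpose (inverse u *\<^sub>R (H ** ?P u))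
      + ((inverse u *\<^sub>R (H ** ?P u)) ** S) ** transpose (?P u)) (at u)"
    by (rule bounded_bilinear.has_vector_derivative[OF bounded_bilinear_matrix_mult PS T])
  moreover have "(?P u ** S) ** transpose (inverse u *\<^sub>R (H ** ?P u))
      + ((inverse u *\<^sub>R (H ** ?P u)) ** S) ** transpose (?P u)
      = inverse u *\<^sub>R lyapunov H (?P u ** S ** transpose (?P u))"
  proof -
    have "transpose (r *\<^sub>R X) = r *\<^sub>R transpose X" for r and X :: "real^'a^'a"
      by (simp add: transpose_def vec_eq_iff)
    moreover have "(r *\<^sub>R X) ** Y = r *\<^sub>R (X ** Y)" "Y ** (r *\<^sub>R X) = r *\<^sub>R (Y ** X)" for r and X Y :: "real^'a^'a"
      using bounded_bilinear.scaleR_left[OF bounded_bilinear_matrix_mult, of r X Y]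
        bounded_bilinear.scaleR_right[OF bounded_bilinear_matrix_mult, of Y r X] by simp_all
    ultimately show ?thesis
      by (simp add: lyapunov_def matrix_transpose_mul matrix_mul_assoc scaleR_add_right)
  qed
  ultimately have "((\<lambda>u. (?P u ** S) ** transpose (?P u)) has_vector_derivative
      inverse u *\<^sub>R lyapunov H (variance_function H S u)) (at u)"
    using assms by (simp add: variance_function_def mat_powr_transpose)
  then show ?thesis
    by (rule has_vector_derivative_transform_within_open[where S = "{0<..}"])
      (use assms in \<open>auto simp: variance_function_def mat_powr_transpose\<close>)
qed

lemma continuous_on_variance_function: "continuous_on {0<..} (variance_function H S)"
  by (rule continuous_on_vector_derivative[OF has_vector_derivative_at_within])
    (rule variance_function_has_vector_derivative, simp)

lemma borel_measurable_variance_function [measurable]: "variance_function H S \<in> borel_measurable borel"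
proof -
  have "(\<lambda>u. indicator {0<..} u *\<^sub>R variance_function H S u) \<in> borel_measurable borel"
    by (rule borel_measurable_continuous_on_indicator[OF _ continuous_on_variance_function]) simp
  then have "(\<lambda>u. indicator {0<..} \<bar>u\<bar> *\<^sub>R variance_function H S \<bar>u\<bar>) \<in> borel_measurable borel"
    by (rule measurable_compose[rotated]) simp
  moreover have "indicator {0<..} \<bar>u\<bar> *\<^sub>R variance_function H S \<bar>u\<bar> = variance_function H S u" for u
  proof (cases "u = 0")
    case False
    then show ?thesis by (simp add: variance_function_def)
  qed simp
  ultimately show ?thesis by simp
qed

text \<open>Stationarity of the increments keeps the growth of the norm of \<open>B t\<close> at most linear. This norm is the norm of
  every increment of length \<open>\<bar>t\<bar>\<close>, hence a subadditive function of \<open>t\<close>; it is bounded on \<open>[1, 2]\<close> by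
  continuity, then on \<open>[0, 1]\<close> because the points of \<open>[0, 1]\<close> are differences of points of
  \<open>[1, 2]\<close>, and then it grows by at most a constant over each unit interval.\<close>

lemma variance_function_growth:
  fixes B :: "real \<Rightarrow> 'w \<Rightarrow> real^'n" and H S :: "real^'n^'n"
  assumes L2: "\<And>t. L2_fun M (B t)"
    and cov: "\<And>s t a b. (\<integral>w. B s w $ a * B t w $ b \<partial>M)
      = (variance_function H S s + variance_function H S t - variance_function H S (s - t)) $ a $ b / 2"
  obtains C where "0 < C"
    and "\<And>t. L2_norm M (B t) \<le> C * (1 + \<bar>t\<bar>)"
    and "\<And>t. norm (variance_function H S t) \<le> C * (1 + \<bar>t\<bar>)\<^sup>2"
proof -
  let ?V = "variance_function H S"
  define \<rho> where "\<rho> t = L2_norm M (B t)" for t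
  have int: "integrable M (\<lambda>w. B s w $ a * B t w $ b)" for s t a b
    by (rule L2_fun_integrable_mult[OF L2_fun_component[OF L2] L2_fun_component[OF L2]])
  have self: "(\<integral>w. B t w $ a * B t w $ b \<partial>M) = ?V t $ a $ b" for t a b
    by (simp add: cov)
  have increment: "L2_norm M (\<lambda>w. B s w - B t w) = \<rho> (s - t)" for s t
  proof -
    have sq: "(norm x)\<^sup>2 = (\<Sum>a\<in>UNIV. x $ a * x $ a)" for x :: "real^'n"
      by (simp add: power2_norm_eq_inner inner_vec_def)
    have "(\<integral>w. (norm (B s w - B t w))\<^sup>2 \<partial>M)
        = (\<integral>w. (\<Sum>a\<in>UNIV. B s w $ a * B s w $ a + B t w $ a * B t w $ a - 2 * (B s w $ a * B t w $ a)) \<partial>M)"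
      unfolding sq by (intro Bochner_Integration.integral_cong sum.cong refl) (simp add: algebra_simps)
    also have "\<dots> = (\<Sum>a\<in>UNIV. ?V (s - t) $ a $ a)"
      using int by (simp add: self cov[of s _ t] diff_divide_distrib add_divide_distrib)
    also have "\<dots> = (\<integral>w. (norm (B (s - t) w))\<^sup>2 \<partial>M)"
      unfolding sq using int by (simp add: self)
    finally show ?thesis by (simp add: L2_norm_def \<rho>_def)
  qed
  have sub: "\<rho> s \<le> \<rho> (s - t) + \<rho> t" for s t
    using L2_norm_triangle[OF L2_fun_diff[OF L2 L2] L2, of s t t] by (simp add: increment \<rho>_def[symmetric])
  have even: "\<rho> (- t) = \<rho> t" for t
    using increment[of 0 t] increment[of t 0] L2_norm_minus_commute[of M "B 0" "B t"] by simp
  have entry: "\<bar>?V t $ a $ b\<bar> \<le> (\<rho> t)\<^sup>2" for t a b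
  proof -
    have "\<bar>?V t $ a $ b\<bar> \<le> L2_norm M (\<lambda>w. B t w $ a) * L2_norm M (\<lambda>w. B t w $ b)"
      unfolding self[symmetric] by (rule L2_Cauchy_Schwarz[OF L2_fun_component[OF L2] L2_fun_component[OF L2]])
    also have "\<dots> \<le> \<rho> t * \<rho> t"
      unfolding \<rho>_def by (intro mult_mono L2_norm_component L2 L2_norm_nonneg)
    finally show ?thesis by (simp add: power2_eq_square)
  qed
  have "\<exists>K. \<forall>t\<in>{1..2}. \<rho> t \<le> K"
  proof -
    have rho: "\<rho> t = sqrt (\<Sum>a\<in>UNIV. ?V t $ a $ a)" for t
    proof -
      have "(\<integral>w. (norm (B t w))\<^sup>2 \<partial>M) = (\<Sum>a\<in>UNIV. ?V t $ a $ a)"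
        using int by (simp add: power2_norm_eq_inner inner_vec_def self)
      then show ?thesis by (simp add: \<rho>_def L2_norm_def)
    qed
    have "continuous_on {1..2} ?V"
      by (rule continuous_on_subset[OF continuous_on_variance_function]) auto
    then have "continuous_on {1..2} \<rho>"
      unfolding rho[abs_def] by (intro continuous_intros)
    then have "compact (\<rho> ` {1..2})"
      by (rule compact_continuous_image) simp
    then have "bdd_above (\<rho> ` {1..2})"
      by (intro bounded_imp_bdd_above compact_imp_bounded)
    then show ?thesis by (auto simp: bdd_above_def)
  qed
  then obtain K where K: "\<And>t. 1 \<le> t \<Longrightarrow> t \<le> 2 \<Longrightarrow> \<rho> t \<le> K"
    by (meson atLeastAtMost_iff)
  have K0: "0 \<le> K" using K[of 1] L2_norm_nonneg[of M "B 1"] by (simp add: \<rho>_def)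
  have small: "\<rho> t \<le> 2 * K" if "0 \<le> t" "t \<le> 1" for t
    using sub[of t "- 1"] K[of "t + 1"] K[of 1] that even[of 1] by simp
  have linear: "\<rho> t \<le> 2 * K * (real n + 1)" if "0 \<le> t" "t \<le> real n + 1" for t n
    using that
  proof (induction n arbitrary: t)
    case (Suc n)
    show ?case
    proof (cases "t \<le> 1")
      case True
      then have "\<rho> t \<le> 2 * K * 1" using small Suc.prems by simp
      also have "\<dots> \<le> 2 * K * (real (Suc n) + 1)" using K0 by (intro mult_left_mono) auto
      finally show ?thesis .
    next
      case False
      then have "\<rho> (t - 1) \<le> 2 * K * (real n + 1)" using Suc by simp
      then show ?thesis using sub[of t 1] small[of 1] by (simp add: algebra_simps)
    qed
  qed (use small in simp)
  have growth: "\<rho> t \<le> 4 * K * (1 + \<bar>t\<bar>)" for t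
  proof -
    have "\<rho> \<bar>t\<bar> \<le> 2 * K * (real (nat \<lceil>\<bar>t\<bar>\<rceil>) + 1)"
      by (rule linear) linarith+
    also have "\<dots> \<le> 2 * K * (2 * (1 + \<bar>t\<bar>))"
    proof (rule mult_left_mono)
      have "real (nat \<lceil>\<bar>t\<bar>\<rceil>) = of_int \<lceil>\<bar>t\<bar>\<rceil>" by simp
      then show "real (nat \<lceil>\<bar>t\<bar>\<rceil>) + 1 \<le> 2 * (1 + \<bar>t\<bar>)"
        using of_int_ceiling_le_add_one[of "\<bar>t\<bar>"] abs_ge_zero[of t] by argo
    qed (use K0 in simp)
    finally show ?thesis using even[of t] by (cases "t < 0") (simp_all add: algebra_simps)
  qed
  have growthV: "norm (?V t) \<le> real CARD('n) * real CARD('n) * (4 * K)\<^sup>2 * (1 + \<bar>t\<bar>)\<^sup>2" for t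
  proof -
    have "norm (?V t) \<le> (\<Sum>a\<in>UNIV. \<Sum>b\<in>UNIV. \<bar>?V t $ a $ b\<bar>)"
      by (rule matrix_norm_le_sum)
    also have "\<dots> \<le> (\<Sum>a::'n\<in>UNIV. \<Sum>b::'n\<in>UNIV. (4 * K * (1 + \<bar>t\<bar>))\<^sup>2)"
      by (intro sum_mono order.trans[OF entry] power_mono growth) (simp add: \<rho>_def L2_norm_nonneg)
    finally show ?thesis by (simp add: power_mult_distrib)
  qed
  define C where "C = max 1 (max (4 * K) (real CARD('n) * real CARD('n) * (4 * K)\<^sup>2))"
  show thesis
  proof (rule that[of C])
    show "0 < C" by (simp add: C_def)
    show "L2_norm M (B t) \<le> C * (1 + \<bar>t\<bar>)" for t
    proof -
      have "4 * K \<le> C" by (simp add: C_def)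
      then have "4 * K * (1 + \<bar>t\<bar>) \<le> C * (1 + \<bar>t\<bar>)" by (intro mult_right_mono) auto
      with growth[of t] show ?thesis unfolding \<rho>_def by linarith
    qed
    show "norm (?V t) \<le> C * (1 + \<bar>t\<bar>)\<^sup>2" for t
      by (rule order.trans[OF growthV]) (intro mult_right_mono, auto simp: C_def)
  qed
qed

text \<open>As for a homogeneous function, the \<open>m\<close>-th derivative of the variance function at \<open>u\<close> is \<open>1 / u ^ m\<close>
  times a fixed linear operator applied to its value. With \<open>L\<close> for \<open>lyapunov H\<close>, that operator is the
  falling factorial \<open>L (L - 1) \<dots> (L - (m - 1))\<close>.\<close>

primrec euler_iterate :: "real^'n^'n \<Rightarrow> nat \<Rightarrow> real^'n^'n \<Rightarrow> real^'n^'n" where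
  "euler_iterate H 0 X = X"
| "euler_iterate H (Suc m) X = lyapunov H (euler_iterate H m X) - real m *\<^sub>R euler_iterate H m X"

lemma bounded_linear_euler_iterate: "bounded_linear (euler_iterate H m)"
proof (induction m)
  case (Suc m)
  then show ?case
    unfolding euler_iterate.simps
    by (intro bounded_linear_sub bounded_linear_compose[OF bounded_linear_lyapunov]
        bounded_linear_const_scaleR)
qed simp

lemma euler_iterate_has_vector_derivative:
  assumes "0 < u"
  shows "((\<lambda>u. euler_iterate H m (variance_function H S u)) has_vector_derivative
    inverse u *\<^sub>R lyapunov H (euler_iterate H m (variance_function H S u))) (at u)"
proof (induction m)
  case 0
  then show ?case using variance_function_has_vector_derivative[OF assms] by simp
next
  case (Suc m)
  let ?Y = "\<lambda>u. euler_iterate H m (variance_function H S u)"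
  interpret bounded_linear "lyapunov H" by (rule bounded_linear_lyapunov)
  have "((\<lambda>u. lyapunov H (?Y u) - real m *\<^sub>R ?Y u) has_vector_derivative
      lyapunov H (inverse u *\<^sub>R lyapunov H (?Y u)) - real m *\<^sub>R (inverse u *\<^sub>R lyapunov H (?Y u))) (at u)"
    by (intro has_vector_derivative_diff bounded_linear.has_vector_derivative[OF bounded_linear_scaleR_right]
        has_vector_derivative Suc)
  then show ?case
    by (simp add: scaleR diff scaleR_diff_right mult.commute)
qed

definition variance_deriv :: "real^'n^'n \<Rightarrow> real^'n^'n \<Rightarrow> 'n \<Rightarrow> 'n \<Rightarrow> nat \<Rightarrow> real \<Rightarrow> real" where
  "variance_deriv H S a b m u = euler_iterate H m (variance_function H S u) $ a $ b / u ^ m"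

lemma DERIV_variance_deriv:
  assumes "0 < u"
  shows "DERIV (variance_deriv H S a b m) u :> variance_deriv H S a b (Suc m) u"
proof -
  let ?Y = "\<lambda>u. euler_iterate H m (variance_function H S u)"
  have "bounded_linear (\<lambda>P::real^'a^'a. P $ a $ b)"
    by (rule bounded_linear_compose[OF bounded_linear_vec_nth bounded_linear_vec_nth])
  from bounded_linear.has_vector_derivative[OF this euler_iterate_has_vector_derivative[OF assms]]
  have D: "DERIV (\<lambda>u. ?Y u $ a $ b) u :> lyapunov H (?Y u) $ a $ b / u"
    by (simp add: has_real_derivative_iff_has_vector_derivative divide_inverse mult.commute)
  have "DERIV (\<lambda>u. ?Y u $ a $ b / u ^ m) u :>
      (lyapunov H (?Y u) $ a $ b / u * u ^ m - ?Y u $ a $ b * (real m * u ^ (m - 1))) / (u ^ m * u ^ m)"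
    using assms by (intro DERIV_divide D) (auto intro!: derivative_eq_intros)
  moreover have "(lyapunov H (?Y u) $ a $ b / u * u ^ m - ?Y u $ a $ b * (real m * u ^ (m - 1))) / (u ^ m * u ^ m)
      = variance_deriv H S a b (Suc m) u"
    using assms by (cases m) (simp_all add: variance_deriv_def field_simps)
  ultimately show ?thesis by (simp add: variance_deriv_def[abs_def])
qed

text \<open>Four derivatives turn quadratic growth into decay like the inverse square, so the cubic Taylor
  polynomial at \<open>c\<close> is accurate to order \<open>1 / c\<^sup>2\<close> at bounded distance from \<open>c\<close>.\<close>

lemma variance_function_taylor:
  fixes H S :: "real^'n^'n"
  assumes growth: "\<And>t. norm (variance_function H S t) \<le> C * (1 + \<bar>t\<bar>)\<^sup>2" and C: "0 < C"
  obtains K where "0 \<le> K" and "\<And>a b c r s. 2 \<le> c \<Longrightarrow> 2 * r \<le> c \<Longrightarrow> \<bar>s\<bar> \<le> r \<Longrightarrow>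
    \<bar>variance_function H S (c + s) $ a $ b - (\<Sum>m<4. variance_deriv H S a b m c / fact m * s ^ m)\<bar> \<le> K * r ^ 4 / c\<^sup>2"
proof -
  let ?V = "variance_function H S"
  obtain L where L: "0 \<le> L" "\<And>X. norm (euler_iterate H 4 X) \<le> norm X * L"
    using bounded_linear.nonneg_bounded[OF bounded_linear_euler_iterate] by blast
  have fourth: "\<bar>variance_deriv H S a b 4 u\<bar> \<le> 4 * C * L / u\<^sup>2" if u: "1 \<le> u" for u a b
  proof -
    have "\<bar>euler_iterate H 4 (?V u) $ a $ b\<bar> \<le> norm (euler_iterate H 4 (?V u))"
      by (rule order.trans[OF component_le_norm_cart Finite_Cartesian_Product.norm_nth_le])
    also have "\<dots> \<le> norm (?V u) * L" by (rule L(2))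
    also have "\<dots> \<le> (C * (1 + \<bar>u\<bar>)\<^sup>2) * L" by (rule mult_right_mono[OF growth L(1)])
    also have "\<dots> \<le> (C * (2 * u)\<^sup>2) * L"
      using u C L(1) by (intro mult_right_mono mult_left_mono power_mono) auto
    finally have "\<bar>euler_iterate H 4 (?V u) $ a $ b\<bar> \<le> 4 * C * L * u\<^sup>2"
      by (simp add: power_mult_distrib mult_ac)
    then have "\<bar>euler_iterate H 4 (?V u) $ a $ b\<bar> / u ^ 4 \<le> 4 * C * L * u\<^sup>2 / u ^ 4"
      using u by (intro divide_right_mono) auto
    also have "\<dots> = 4 * C * L / u\<^sup>2"
      using u by (simp add: field_simps flip: power_add)
    finally show ?thesis using u by (simp add: variance_deriv_def abs_divide)
  qed
  show thesis
  proof (rule that[of "4 * C * L"])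
    show "0 \<le> 4 * C * L" using C L(1) by simp
    fix a b :: 'n and c r s :: real
    assume c: "2 \<le> c" and r: "2 * r \<le> c" and s: "\<bar>s\<bar> \<le> r"
    let ?p = "\<Sum>m<4. variance_deriv H S a b m c / fact m * s ^ m"
    show "\<bar>?V (c + s) $ a $ b - ?p\<bar> \<le> 4 * C * L * r ^ 4 / c\<^sup>2"
    proof (cases "s = 0")
      case True
      have "{..<4::nat} = {0, 1, 2, 3}" by auto
      then have "?V (c + s) $ a $ b - ?p = 0"
        using True by (simp add: variance_deriv_def)
      then show ?thesis using C L(1) by simp
    next
      case False
      have "\<exists>t. (if c + s < c then c + s < t \<and> t < c else c < t \<and> t < c + s) \<and>
          variance_deriv H S a b 0 (c + s) = (\<Sum>m<4. variance_deriv H S a b m c / fact m * (c + s - c) ^ m)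
            + variance_deriv H S a b 4 t / fact 4 * (c + s - c) ^ 4"
      proof (rule Taylor[of 4 "variance_deriv H S a b" _ "c - r" "c + r"])
        show "\<forall>m t. m < 4 \<and> c - r \<le> t \<and> t \<le> c + r \<longrightarrow>
            DERIV (variance_deriv H S a b m) t :> variance_deriv H S a b (Suc m) t"
          using c r by (intro allI impI DERIV_variance_deriv) linarith
      qed (use s c r False in auto)
      then obtain t where between: "if c + s < c then c + s < t \<and> t < c else c < t \<and> t < c + s"
        and tay: "variance_deriv H S a b 0 (c + s) = (\<Sum>m<4. variance_deriv H S a b m c / fact m * (c + s - c) ^ m)
            + variance_deriv H S a b 4 t / fact 4 * (c + s - c) ^ 4"
        by blast
      have t: "c - r \<le> t" using between s by (auto split: if_splits)
      have eq: "?V (c + s) $ a $ b = ?p + variance_deriv H S a b 4 t / fact 4 * s ^ 4"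
        using tay by (simp only: add_diff_cancel_left') (simp add: variance_deriv_def[of H S a b 0])
      have t': "c / 2 \<le> t" "1 \<le> t" using t c r by linarith+
      have "\<bar>?V (c + s) $ a $ b - ?p\<bar> = \<bar>variance_deriv H S a b 4 t\<bar> / 24 * \<bar>s\<bar> ^ 4"
        unfolding eq by (simp add: abs_mult power_abs fact_numeral)
      also have "\<dots> \<le> (4 * C * L / t\<^sup>2) / 24 * r ^ 4"
        using fourth[OF t'(2)] s C L(1) by (intro mult_mono divide_right_mono power_mono) auto
      also have "\<dots> \<le> (4 * C * L / (c / 2)\<^sup>2) / 24 * r ^ 4"
        using t' c C L(1) s by (intro mult_right_mono divide_right_mono divide_left_mono power_mono) auto
      also have "\<dots> = (4 * C * L * r ^ 4 / c\<^sup>2) / 6"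
        by (simp add: power_divide)
      also have "(4 * C * L * r ^ 4 / c\<^sup>2) / 6 \<le> 4 * C * L * r ^ 4 / c\<^sup>2"
      proof -
        have "X / 6 \<le> X" if "0 \<le> X" for X :: real using that by simp
        moreover have "0 \<le> 4 * C * L * r ^ 4 / c\<^sup>2" using C L(1) by simp
        ultimately show ?thesis by blast
      qed
      finally show ?thesis .
    qed
  qed
qed

section \<open>Double wavelet integrals\<close>

text \<open>A function that is bounded on the square of the support of \<open>\<psi>\<close>, multiplied by \<open>\<psi> t \<psi> t'\<close>, is
  dominated in this way. The lemma makes iterated Bochner integrals of such functions behave well.\<close>

lemma double_integral_bound:
  fixes F :: "real \<Rightarrow> real \<Rightarrow> 'b::{banach, second_countable_topology}"
  assumes \<psi>: "integrable lborel \<psi>"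
    and F: "case_prod F \<in> borel_measurable (borel \<Otimes>\<^sub>M borel)"
    and bound: "\<And>t t'. norm (F t t') \<le> K * (\<bar>\<psi> t\<bar> * \<bar>\<psi> t'\<bar>)"
  shows "integrable lborel (F t)"
    and "integrable lborel (\<lambda>t. \<integral>t'. F t t' \<partial>lborel)"
    and "norm (\<integral>t. (\<integral>t'. F t t' \<partial>lborel) \<partial>lborel) \<le> K * (\<integral>t. \<bar>\<psi> t\<bar> \<partial>lborel)\<^sup>2"
proof -
  have F': "case_prod F \<in> borel_measurable (lborel \<Otimes>\<^sub>M lborel)"
    using F by (simp cong: measurable_cong_sets)
  have abs: "integrable lborel (\<lambda>t. \<bar>\<psi> t\<bar>)" using \<psi> by simp
  show inner: "integrable lborel (F t)" for t
  proof (rule Bochner_Integration.integrable_bound)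
    show "integrable lborel (\<lambda>t'. (K * \<bar>\<psi> t\<bar>) * \<bar>\<psi> t'\<bar>)" using abs by simp
    show "F t \<in> borel_measurable lborel"
      using measurable_Pair_compose_split[OF F' measurable_const[of t] measurable_ident] by simp
    show "AE t' in lborel. norm (F t t') \<le> norm ((K * \<bar>\<psi> t\<bar>) * \<bar>\<psi> t'\<bar>)"
      using order.trans[OF bound abs_ge_self] by (simp add: mult.assoc)
  qed
  have le: "norm (\<integral>t'. F t t' \<partial>lborel) \<le> K * (\<integral>t. \<bar>\<psi> t\<bar> \<partial>lborel) * \<bar>\<psi> t\<bar>" for t
  proof -
    have "norm (\<integral>t'. F t t' \<partial>lborel) \<le> (\<integral>t'. norm (F t t') \<partial>lborel)"
      by (rule integral_norm_bound)
    also have "\<dots> \<le> (\<integral>t'. (K * \<bar>\<psi> t\<bar>) * \<bar>\<psi> t'\<bar> \<partial>lborel)"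
      using inner abs bound by (intro integral_mono integrable_norm) (auto simp: mult.assoc)
    finally show ?thesis by (simp add: mult_ac)
  qed
  show outer: "integrable lborel (\<lambda>t. \<integral>t'. F t t' \<partial>lborel)"
  proof (rule Bochner_Integration.integrable_bound)
    show "integrable lborel (\<lambda>t. K * (\<integral>t. \<bar>\<psi> t\<bar> \<partial>lborel) * \<bar>\<psi> t\<bar>)" using abs by simp
    show "(\<lambda>t. \<integral>t'. F t t' \<partial>lborel) \<in> borel_measurable lborel"
      by (rule lborel.borel_measurable_lebesgue_integral[OF F'])
    show "AE t in lborel. norm (\<integral>t'. F t t' \<partial>lborel) \<le> norm (K * (\<integral>t. \<bar>\<psi> t\<bar> \<partial>lborel) * \<bar>\<psi> t\<bar>)"
      using order.trans[OF le abs_ge_self] by simp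
  qed
  have "norm (\<integral>t. (\<integral>t'. F t t' \<partial>lborel) \<partial>lborel) \<le> (\<integral>t. norm (\<integral>t'. F t t' \<partial>lborel) \<partial>lborel)"
    by (rule integral_norm_bound)
  also have "\<dots> \<le> (\<integral>t. K * (\<integral>t. \<bar>\<psi> t\<bar> \<partial>lborel) * \<bar>\<psi> t\<bar> \<partial>lborel)"
    using outer abs le by (intro integral_mono integrable_norm) auto
  finally show "norm (\<integral>t. (\<integral>t'. F t t' \<partial>lborel) \<partial>lborel) \<le> K * (\<integral>t. \<bar>\<psi> t\<bar> \<partial>lborel)\<^sup>2"
    by (simp add: power2_eq_square)
qed

definition compact_wavelet :: "(real \<Rightarrow> real) \<Rightarrow> real \<Rightarrow> bool" where
  "compact_wavelet \<psi> r \<longleftrightarrow> 0 \<le> r \<and> integrable lborel \<psi> \<and> (\<forall>t. r < \<bar>t\<bar> \<longrightarrow> \<psi> t = 0) \<and>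
     (\<integral>t. \<psi> t \<partial>lborel) = 0 \<and> (\<integral>t. t * \<psi> t \<partial>lborel) = 0"

lemma is_wavelet_compact:
  assumes "is_wavelet \<psi> N \<alpha>"
  obtains r where "compact_wavelet \<psi> r"
proof -
  obtain a b where ab: "a \<le> b" "closure {t. \<psi> t \<noteq> 0} = {a..b}"
    using assms by (auto simp: is_wavelet_def)
  let ?r = "\<bar>a\<bar> + \<bar>b\<bar>"
  have "\<psi> t = 0" if "?r < \<bar>t\<bar>" for t
  proof (rule ccontr)
    assume "\<psi> t \<noteq> 0"
    then have "t \<in> {a..b}" using closure_subset[of "{t. \<psi> t \<noteq> 0}"] ab(2) by auto
    then show False using that by auto
  qed
  moreover have "(\<integral>t. t ^ q * \<psi> t \<partial>lborel) = 0" if "q < 2" for q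
    using assms that by (auto simp: is_wavelet_def)
  from this[of 0] this[of 1] have "(\<integral>t. \<psi> t \<partial>lborel) = 0" "(\<integral>t. t * \<psi> t \<partial>lborel) = 0"
    by simp_all
  ultimately have "compact_wavelet \<psi> ?r"
    using assms by (simp add: compact_wavelet_def is_wavelet_def)
  then show thesis by (rule that)
qed

context
  fixes \<psi> :: "real \<Rightarrow> real" and r :: real
  assumes wavelet: "compact_wavelet \<psi> r"
begin

lemma wavelet_integrable: "integrable lborel \<psi>"
  using wavelet by (simp add: compact_wavelet_def)

lemma wavelet_measurable: "\<psi> \<in> borel_measurable borel"
  using borel_measurable_integrable[OF wavelet_integrable] by simp

lemma wavelet_support: "\<psi> t \<noteq> 0 \<Longrightarrow> \<bar>t\<bar> \<le> r"
  using wavelet by (meson compact_wavelet_def not_le)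

lemma wavelet_radius: "0 \<le> r"
  using wavelet by (simp add: compact_wavelet_def)

lemma integrable_moment: "integrable lborel (\<lambda>t. t ^ q * \<psi> t)"
proof (rule Bochner_Integration.integrable_bound)
  show "integrable lborel (\<lambda>t. r ^ q * \<psi> t)" using wavelet_integrable by simp
  have "\<bar>t ^ q * \<psi> t\<bar> \<le> \<bar>r ^ q * \<psi> t\<bar>" for t
  proof (cases "\<psi> t = 0")
    case False
    then have "\<bar>t\<bar> ^ q \<le> r ^ q" by (intro power_mono wavelet_support) auto
    then show ?thesis using wavelet_radius by (simp add: abs_mult power_abs mult_right_mono)
  qed simp
  then show "AE t in lborel. norm (t ^ q * \<psi> t) \<le> norm (r ^ q * \<psi> t)" by simp
qed (use wavelet_measurable in measurable)

lemma vanishing_moment: "q < 2 \<Longrightarrow> (\<integral>t. t ^ q * \<psi> t \<partial>lborel) = 0"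
  using wavelet by (auto simp: compact_wavelet_def less_Suc_eq numeral_2_eq_2)

lemma wavelet_product_bound:
  assumes "\<And>t t'. \<bar>t\<bar> \<le> r \<Longrightarrow> \<bar>t'\<bar> \<le> r \<Longrightarrow> norm (f t t') \<le> K"
  shows "norm ((\<psi> t * \<psi> t') *\<^sub>R f t t') \<le> K * (\<bar>\<psi> t\<bar> * \<bar>\<psi> t'\<bar>)"
proof (cases "\<psi> t = 0 \<or> \<psi> t' = 0")
  case False
  then have "norm (f t t') \<le> K" using assms wavelet_support by blast
  then show ?thesis by (simp add: abs_mult mult.commute mult_right_mono)
qed auto

text \<open>Each wavelet kills two moments, but the product of two kills all polynomials of degree at most three
  in \<open>x t + y t'\<close>: of two exponents with sum below four, one is at most one.\<close>

lemma double_moment_zero: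
  assumes "p < 4"
  shows "(\<integral>t. (\<integral>t'. (\<psi> t * \<psi> t') * (x * t + y * t') ^ p \<partial>lborel) \<partial>lborel) = 0"
proof -
  define \<mu> where "\<mu> q = (\<integral>t. t ^ q * \<psi> t \<partial>lborel)" for q
  have inner: "(\<integral>t'. (\<psi> t * \<psi> t') * (x * t + y * t') ^ p \<partial>lborel)
      = (\<Sum>k\<le>p. (of_nat (p choose k) * x ^ k * y ^ (p - k) * \<mu> (p - k)) * (t ^ k * \<psi> t))" for t
  proof -
    have expand: "(\<psi> t * \<psi> t') * (x * t + y * t') ^ p
        = (\<Sum>k\<le>p. (of_nat (p choose k) * x ^ k * y ^ (p - k) * t ^ k * \<psi> t) * (t' ^ (p - k) * \<psi> t'))" for t'
      by (simp add: binomial_ring power_mult_distrib sum_distrib_left mult_ac)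
    have lin: "(\<integral>t'. (\<Sum>k\<le>p. A k * (t' ^ (p - k) * \<psi> t')) \<partial>lborel) = (\<Sum>k\<le>p. A k * \<mu> (p - k))" for A
      using integrable_moment by (simp add: \<mu>_def)
    show ?thesis unfolding expand lin by (simp add: mult_ac)
  qed
  have "(\<integral>t. (\<integral>t'. (\<psi> t * \<psi> t') * (x * t + y * t') ^ p \<partial>lborel) \<partial>lborel)
      = (\<Sum>k\<le>p. (of_nat (p choose k) * x ^ k * y ^ (p - k) * \<mu> (p - k)) * \<mu> k)"
    unfolding inner using integrable_moment by (simp add: \<mu>_def)
  also have "\<dots> = 0"
  proof (rule sum.neutral, rule ballI)
    fix k assume "k \<in> {..p}"
    then have "k < 2 \<or> p - k < 2" using assms by auto
    then show "(of_nat (p choose k) * x ^ k * y ^ (p - k) * \<mu> (p - k)) * \<mu> k = 0"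
      using vanishing_moment by (auto simp: \<mu>_def)
  qed
  finally show ?thesis .
qed

lemma double_integral_near_polynomial:
  fixes f :: "real \<Rightarrow> real"
  assumes f: "f \<in> borel_measurable borel"
    and near: "\<And>t t'. \<bar>t\<bar> \<le> r \<Longrightarrow> \<bar>t'\<bar> \<le> r \<Longrightarrow> \<bar>f (x * t + y * t') - (\<Sum>m<4. q m * (x * t + y * t') ^ m)\<bar> \<le> \<epsilon>"
  shows "\<bar>\<integral>t. (\<integral>t'. (\<psi> t * \<psi> t') * f (x * t + y * t') \<partial>lborel) \<partial>lborel\<bar> \<le> \<epsilon> * (\<integral>t. \<bar>\<psi> t\<bar> \<partial>lborel)\<^sup>2"
proof -
  note [measurable] = f wavelet_measurable
  define g where "g t t' = f (x * t + y * t') - (\<Sum>m<4. q m * (x * t + y * t') ^ m)" for t t'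
  define G where "G t t' = (\<psi> t * \<psi> t') * g t t'" for t t'
  define P where "P m t t' = q m * ((\<psi> t * \<psi> t') * (x * t + y * t') ^ m)" for m t t'
  have "norm (G t t') \<le> \<epsilon> * (\<bar>\<psi> t\<bar> * \<bar>\<psi> t'\<bar>)" for t t'
    using wavelet_product_bound[of g \<epsilon> t t'] near by (simp add: G_def g_def)
  moreover have "case_prod G \<in> borel_measurable (borel \<Otimes>\<^sub>M borel)"
    unfolding G_def g_def by measurable
  ultimately have G: "integrable lborel (G t)" "integrable lborel (\<lambda>t. \<integral>t'. G t t' \<partial>lborel)"
    "norm (\<integral>t. (\<integral>t'. G t t' \<partial>lborel) \<partial>lborel) \<le> \<epsilon> * (\<integral>t. \<bar>\<psi> t\<bar> \<partial>lborel)\<^sup>2" for t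
    using double_integral_bound[OF wavelet_integrable, of G \<epsilon>] by blast+
  have P: "integrable lborel (P m t)" "integrable lborel (\<lambda>t. \<integral>t'. P m t t' \<partial>lborel)" for m t
  proof -
    have "\<bar>q m * (x * t + y * t') ^ m\<bar> \<le> \<bar>q m\<bar> * (\<bar>x\<bar> * r + \<bar>y\<bar> * r) ^ m" if "\<bar>t\<bar> \<le> r" "\<bar>t'\<bar> \<le> r" for t t'
    proof -
      have "\<bar>x * t + y * t'\<bar> \<le> \<bar>x\<bar> * r + \<bar>y\<bar> * r"
        using that by (intro order.trans[OF abs_triangle_ineq] add_mono) (simp_all add: abs_mult mult_left_mono)
      then show ?thesis by (simp add: abs_mult power_abs mult_left_mono power_mono)
    qed
    then have "norm ((\<psi> t * \<psi> t') *\<^sub>R (q m * (x * t + y * t') ^ m))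
        \<le> (\<bar>q m\<bar> * (\<bar>x\<bar> * r + \<bar>y\<bar> * r) ^ m) * (\<bar>\<psi> t\<bar> * \<bar>\<psi> t'\<bar>)" for t t'
      by (intro wavelet_product_bound) simp
    then have "norm (P m t t') \<le> (\<bar>q m\<bar> * (\<bar>x\<bar> * r + \<bar>y\<bar> * r) ^ m) * (\<bar>\<psi> t\<bar> * \<bar>\<psi> t'\<bar>)" for t t'
      unfolding P_def real_scaleR_def by (metis mult.left_commute)
    moreover have "case_prod (P m) \<in> borel_measurable (borel \<Otimes>\<^sub>M borel)"
      unfolding P_def by measurable
    ultimately show "integrable lborel (P m t)" "integrable lborel (\<lambda>t. \<integral>t'. P m t t' \<partial>lborel)"
      using double_integral_bound[OF wavelet_integrable, of "P m"] by blast+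
  qed
  have "(\<psi> t * \<psi> t') * f (x * t + y * t') = G t t' + (\<Sum>m<4. P m t t')" for t t'
    by (simp add: G_def g_def P_def right_diff_distrib sum_distrib_left mult_ac)
  then have "(\<integral>t. (\<integral>t'. (\<psi> t * \<psi> t') * f (x * t + y * t') \<partial>lborel) \<partial>lborel)
      = (\<integral>t. (\<integral>t'. G t t' \<partial>lborel) \<partial>lborel) + (\<Sum>m<4. \<integral>t. (\<integral>t'. P m t t' \<partial>lborel) \<partial>lborel)"
    using G P by simp
  also have "(\<Sum>m<4. \<integral>t. (\<integral>t'. P m t t' \<partial>lborel) \<partial>lborel) = 0"
    using double_moment_zero by (intro sum.neutral) (simp add: P_def)
  finally show ?thesis using G(3) by simp
qed

end

lemma borel_measurable_matrix_component:
  fixes F :: "'a \<Rightarrow> 'b::real_normed_vector^'n^'m"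
  assumes "F \<in> borel_measurable M"
  shows "(\<lambda>x. F x $ a $ b) \<in> borel_measurable M"
  using assms
  by (rule borel_measurable_continuous_on[rotated])
    (intro linear_continuous_on bounded_linear_compose[OF bounded_linear_vec_nth bounded_linear_vec_nth])

text \<open>The growth bound is what makes the matrix-valued integrals in \<open>Omega\<close> converge, so that entries may
  be taken inside them.\<close>

lemma Omega_component:
  fixes H S :: "real^'n^'n" and j j' :: nat
  assumes wavelet: "compact_wavelet \<psi> r"
    and growth: "\<And>t. norm (variance_function H S t) \<le> C * (1 + \<bar>t\<bar>)\<^sup>2"
  defines "c z \<equiv> of_int z * real (gcd (2 ^ j) (2 ^ j'))"
  shows "Omega \<psi> H S j j' z $ a $ b = - 1/2 * (\<integral>t. (\<integral>t'. (\<psi> t * \<psi> t') *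
    variance_function H S (2 ^ j * t - 2 ^ j' * t' + c z) $ a $ b \<partial>lborel) \<partial>lborel)"
proof -
  define F where "F t t' = (\<psi> t * \<psi> t') *\<^sub>R variance_function H S (2 ^ j * t - 2 ^ j' * t' + c z)" for t t'
  have [measurable]: "\<psi> \<in> borel_measurable borel" by (rule wavelet_measurable[OF wavelet])
  have C: "0 \<le> C" using order.trans[OF norm_ge_zero growth[of 0]] by simp
  have "norm (variance_function H S (2 ^ j * t - 2 ^ j' * t' + c z)) \<le> C * (1 + (2 ^ j * r + 2 ^ j' * r + \<bar>c z\<bar>))\<^sup>2"
    if "\<bar>t\<bar> \<le> r" "\<bar>t'\<bar> \<le> r" for t t'
  proof -
    have "\<bar>2 ^ j * t\<bar> \<le> 2 ^ j * r" "\<bar>2 ^ j' * t'\<bar> \<le> 2 ^ j' * r"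
      using that by (simp_all add: abs_mult)
    then have "\<bar>2 ^ j * t - 2 ^ j' * t' + c z\<bar> \<le> 2 ^ j * r + 2 ^ j' * r + \<bar>c z\<bar>" by linarith
    then show ?thesis
      using C by (intro order.trans[OF growth] mult_left_mono power_mono) auto
  qed
  then have bound: "norm (F t t') \<le> (C * (1 + (2 ^ j * r + 2 ^ j' * r + \<bar>c z\<bar>))\<^sup>2) * (\<bar>\<psi> t\<bar> * \<bar>\<psi> t'\<bar>)" for t t'
    unfolding F_def by (rule wavelet_product_bound[OF wavelet])
  have meas: "case_prod F \<in> borel_measurable (borel \<Otimes>\<^sub>M borel)"
    unfolding F_def by measurable
  note int = double_integral_bound(1,2)[OF wavelet_integrable[OF wavelet] meas bound]
  have "Omega \<psi> H S j j' z = (- 1/2) *\<^sub>R (\<integral>t. (\<integral>t'. F t t' \<partial>lborel) \<partial>lborel)"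
    by (simp add: Omega_def Let_def F_def variance_function_def c_def)
  then have "Omega \<psi> H S j j' z $ a $ b = - 1/2 * (\<integral>t. (\<integral>t'. F t t' $ a $ b \<partial>lborel) \<partial>lborel)"
    by (simp add: matrix_integral_component int)
  then show ?thesis by (simp add: F_def)
qed

text \<open>At lag \<open>c\<close>, the vanishing moments remove the cubic Taylor polynomial of the variance function, and
  the remainder is of order \<open>1 / c\<^sup>2\<close>. The finitely many small lags only affect the constant.\<close>

lemma Omega_decay:
  fixes H S :: "real^'n^'n"
  assumes wavelet: "compact_wavelet \<psi> r"
    and growth: "\<And>t. norm (variance_function H S t) \<le> C * (1 + \<bar>t\<bar>)\<^sup>2" and C: "0 < C"
  obtains K where "0 \<le> K" and "\<And>z a b. \<bar>Omega \<psi> H S j j' z $ a $ b\<bar> \<le> K / (1 + (of_int z)\<^sup>2)"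
proof -
  define \<gamma> where "\<gamma> = real (gcd (2 ^ j) (2 ^ j'))"
  have \<gamma>: "1 \<le> \<gamma>"
  proof -
    have "0 < gcd (2 ^ j) (2 ^ j' :: nat)" by simp
    then show ?thesis unfolding \<gamma>_def by linarith
  qed
  define R where "R = 2 ^ j * r + 2 ^ j' * r"
  have R: "0 \<le> R" using wavelet_radius[OF wavelet] by (simp add: R_def)
  define I where "I = (\<integral>t. \<bar>\<psi> t\<bar> \<partial>lborel)"
  obtain K0 where K0: "0 \<le> K0" "\<And>a b c r s. 2 \<le> c \<Longrightarrow> 2 * r \<le> c \<Longrightarrow> \<bar>s\<bar> \<le> r \<Longrightarrow>
    \<bar>variance_function H S (c + s) $ a $ b - (\<Sum>m<4. variance_deriv H S a b m c / fact m * s ^ m)\<bar> \<le> K0 * r ^ 4 / c\<^sup>2"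
    using variance_function_taylor[OF growth C] by blast
  \<comment> \<open>beyond this threshold the Taylor bound applies on the whole range of \<open>2 ^ j * t - 2 ^ j' * t'\<close>\<close>
  define T where "T = max 2 (2 * R)"
  have far: "\<bar>Omega \<psi> H S j j' z $ a $ b\<bar> \<le> K0 * R ^ 4 * I\<^sup>2 / (of_int z)\<^sup>2" if z: "T \<le> \<bar>of_int z\<bar>" for z a b
  proof -
    define c where "c = \<bar>of_int z\<bar> * \<gamma>"
    define \<sigma> where "\<sigma> = (sgn (of_int z) :: real)"
    have cz: "\<bar>of_int z\<bar> \<le> c" using mult_left_mono[OF \<gamma>, of "\<bar>of_int z\<bar>"] by (simp add: c_def)
    have z0: "z \<noteq> 0" using z by (auto simp: T_def)
    have c: "2 \<le> c" "2 * R \<le> c" using z cz by (auto simp: T_def)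
    have \<sigma>: "\<bar>\<sigma>\<bar> = 1" using z0 by (simp add: \<sigma>_def)
    \<comment> \<open>the variance function is even, so the lag may be taken positive\<close>
    have even: "variance_function H S (2 ^ j * t - 2 ^ j' * t' + of_int z * \<gamma>)
        = variance_function H S (c + ((\<sigma> * 2 ^ j) * t + (- \<sigma> * 2 ^ j') * t'))" for t t'
    proof (cases "0 < z")
      case True
      then show ?thesis by (simp add: c_def \<sigma>_def add_ac)
    next
      case False
      with z0 have "z < 0" by simp
      then have "c + ((\<sigma> * 2 ^ j) * t + (- \<sigma> * 2 ^ j') * t') = - (2 ^ j * t - 2 ^ j' * t' + of_int z * \<gamma>)"
        by (simp add: c_def \<sigma>_def)
      then show ?thesis by (simp only: variance_function_minus)
    qed
    have "\<bar>\<integral>t. (\<integral>t'. (\<psi> t * \<psi> t') * (\<lambda>s. variance_function H S (c + s) $ a $ b)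
        ((\<sigma> * 2 ^ j) * t + (- \<sigma> * 2 ^ j') * t') \<partial>lborel) \<partial>lborel\<bar> \<le> (K0 * R ^ 4 / c\<^sup>2) * (\<integral>t. \<bar>\<psi> t\<bar> \<partial>lborel)\<^sup>2"
    proof (rule double_integral_near_polynomial[OF wavelet])
      show "(\<lambda>s. variance_function H S (c + s) $ a $ b) \<in> borel_measurable borel"
        by (rule borel_measurable_matrix_component) measurable
      fix t t' assume t: "\<bar>t\<bar> \<le> r" "\<bar>t'\<bar> \<le> r"
      let ?s = "(\<sigma> * 2 ^ j) * t + (- \<sigma> * 2 ^ j') * t'"
      have "\<bar>(\<sigma> * 2 ^ j) * t\<bar> \<le> 2 ^ j * r" "\<bar>(- \<sigma> * 2 ^ j') * t'\<bar> \<le> 2 ^ j' * r"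
        using t \<sigma> by (simp_all add: abs_mult)
      then have "\<bar>?s\<bar> \<le> R" unfolding R_def by linarith
      then show "\<bar>variance_function H S (c + ?s) $ a $ b
          - (\<Sum>m<4. variance_deriv H S a b m c / fact m * ?s ^ m)\<bar> \<le> K0 * R ^ 4 / c\<^sup>2"
        by (rule K0(2)[OF c])
    qed
    then have "\<bar>Omega \<psi> H S j j' z $ a $ b\<bar> \<le> 1/2 * ((K0 * R ^ 4 / c\<^sup>2) * I\<^sup>2)"
      unfolding Omega_component[OF wavelet growth] \<gamma>_def[symmetric] even I_def by (simp add: abs_mult)
    also have "\<dots> \<le> (K0 * R ^ 4 / c\<^sup>2) * I\<^sup>2"
    proof -
      have "1/2 * X \<le> X" if "0 \<le> X" for X :: real using that by simp
      moreover have "0 \<le> (K0 * R ^ 4 / c\<^sup>2) * I\<^sup>2" using K0(1) R by simp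
      ultimately show ?thesis by blast
    qed
    also have "\<dots> \<le> (K0 * R ^ 4 / (of_int z)\<^sup>2) * I\<^sup>2"
    proof -
      have "(of_int z)\<^sup>2 \<le> c\<^sup>2" using power_mono[OF cz, of 2] by simp
      then show ?thesis
        using K0(1) R z0 c(1) by (intro mult_right_mono divide_left_mono mult_pos_pos) auto
    qed
    finally show ?thesis by simp
  qed
  define Z where "Z = {z::int. \<bar>of_int z\<bar> < T}"
  have "Z \<subseteq> {- \<lceil>T\<rceil>..\<lceil>T\<rceil>}"
  proof
    fix z assume "z \<in> Z"
    then have "\<bar>of_int z\<bar> < T" by (simp add: Z_def)
    then have "of_int \<bar>z\<bar> \<le> T" by simp
    then have "\<bar>z\<bar> \<le> \<lceil>T\<rceil>" using le_of_int_ceiling[of T] by linarith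
    then show "z \<in> {- \<lceil>T\<rceil>..\<lceil>T\<rceil>}" by auto
  qed
  then have finZ: "finite Z" using finite_subset by blast
  define K1 where "K1 = (\<Sum>z\<in>Z. \<Sum>a\<in>UNIV. \<Sum>b\<in>UNIV. \<bar>Omega \<psi> H S j j' z $ a $ b\<bar> * (1 + (of_int z)\<^sup>2))"
  have K1: "0 \<le> K1" by (auto simp: K1_def intro!: sum_nonneg)
  show thesis
  proof (rule that[of "K1 + 2 * (K0 * R ^ 4 * I\<^sup>2)"])
    show "0 \<le> K1 + 2 * (K0 * R ^ 4 * I\<^sup>2)" using K1 K0(1) R by simp
    fix z and a b :: 'n
    show "\<bar>Omega \<psi> H S j j' z $ a $ b\<bar> \<le> (K1 + 2 * (K0 * R ^ 4 * I\<^sup>2)) / (1 + (of_int z)\<^sup>2)"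
    proof (cases "z \<in> Z")
      case True
      let ?f = "\<lambda>z a b. \<bar>Omega \<psi> H S j j' z $ a $ b\<bar> * (1 + (of_int z)\<^sup>2)"
      have "?f z a b \<le> (\<Sum>b\<in>UNIV. ?f z a b)"
        by (rule member_le_sum[of b UNIV "?f z a"]) auto
      also have "\<dots> \<le> (\<Sum>a\<in>UNIV. \<Sum>b\<in>UNIV. ?f z a b)"
        by (rule member_le_sum[of a UNIV "\<lambda>a. \<Sum>b\<in>UNIV. ?f z a b"]) (auto intro!: sum_nonneg)
      also have "\<dots> \<le> K1"
        unfolding K1_def by (rule member_le_sum[OF True _ finZ]) (auto intro!: sum_nonneg)
      finally have "?f z a b \<le> K1 + 2 * (K0 * R ^ 4 * I\<^sup>2)"
        using K0(1) R by (simp add: add_increasing2)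
      then show ?thesis by (simp add: pos_le_divide_eq add_pos_nonneg)
    next
      case False
      then have z: "T \<le> \<bar>of_int z\<bar>" by (simp add: Z_def)
      then have "1 \<le> \<bar>of_int z :: real\<bar>" by (simp add: T_def)
      then have z1: "1 \<le> (of_int z :: real)\<^sup>2" by (metis abs_le_square_iff abs_one one_power2)
      have "\<bar>Omega \<psi> H S j j' z $ a $ b\<bar> \<le> K0 * R ^ 4 * I\<^sup>2 / (of_int z)\<^sup>2" by (rule far[OF z])
      also have "\<dots> = 2 * (K0 * R ^ 4 * I\<^sup>2) / (2 * (of_int z)\<^sup>2)" by simp
      also have "\<dots> \<le> 2 * (K0 * R ^ 4 * I\<^sup>2) / (1 + (of_int z)\<^sup>2)"
      proof -
        have "0 < (of_int z :: real)\<^sup>2" "0 < 1 + (of_int z :: real)\<^sup>2" using z1 by linarith+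
        then show ?thesis using z1 K0(1) R by (intro divide_left_mono mult_pos_pos) simp_all
      qed
      also have "\<dots> \<le> (K1 + 2 * (K0 * R ^ 4 * I\<^sup>2)) / (1 + (of_int z)\<^sup>2)"
        using K1 by (intro divide_right_mono) auto
      finally show ?thesis .
    qed
  qed
qed

section \<open>Averages over a lattice\<close>

lemma integrable_inverse_square_int: "integrable (count_space UNIV) (\<lambda>z::int. 1 / (1 + (of_int z)\<^sup>2) :: real)"
proof -
  let ?f = "\<lambda>z::int. 1 / (1 + (of_int z)\<^sup>2) :: real"
  have "summable (\<lambda>n. inverse ((real n)\<^sup>2))"
    by (rule inverse_power_summable) simp
  then have "summable (\<lambda>n. norm (?f (int n)))"
  proof (rule summable_comparison_test'[where N = 1])
    fix n :: nat assume "1 \<le> n"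
    then show "norm (norm (?f (int n))) \<le> inverse ((real n)\<^sup>2)"
      by (auto simp: divide_inverse intro!: le_imp_inverse_le)
  qed
  then have nat: "Infinite_Set_Sum.abs_summable_on (\<lambda>n. ?f (int n)) UNIV"
    by (simp only: abs_summable_on_nat_iff')
  then have "Infinite_Set_Sum.abs_summable_on (\<lambda>n. ?f (- int n)) UNIV" by simp
  then have "Infinite_Set_Sum.abs_summable_on ?f (range int \<union> range (\<lambda>n. - int n))"
    using nat by (intro abs_summable_on_union abs_summable_on_reindex)
  moreover have "range int \<union> range (\<lambda>n. - int n) = UNIV"
    by (auto intro: int_cases2)
  ultimately show ?thesis
    by (simp add: Infinite_Set_Sum.abs_summable_on_def)
qed

lemma integrable_count_space_summable_on:
  fixes F :: "int \<Rightarrow> 'b::{banach, second_countable_topology}"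
  assumes "integrable (count_space UNIV) F"
  shows "F summable_on UNIV"
proof -
  have "Infinite_Set_Sum.abs_summable_on F UNIV"
    using assms by (simp add: Infinite_Set_Sum.abs_summable_on_def)
  then show ?thesis
    using abs_summable_equivalent abs_summable_summable by blast
qed

text \<open>Sorting the pairs by their lag \<open>z = k - q k'\<close> gives a weighted sum of the values of \<open>F\<close>. The lag \<open>z\<close>
  is attained for all but at most \<open>2 \<bar>z\<bar>\<close> of the \<open>n\<close> indices \<open>k'\<close>, so its weight \<open>w n z\<close> tends to one,
  and dominated convergence applies.\<close>

lemma lattice_average:
  fixes F :: "int \<Rightarrow> 'b::{banach, second_countable_topology}" and q :: int
  assumes F: "integrable (count_space UNIV) F" and q: "1 \<le> q"
  shows "(\<lambda>n. (1 / real n) *\<^sub>R (\<Sum>k' = 1..int n. \<Sum>k = 1..q * int n. F (k - q * k'))) \<longlonglongrightarrow> (\<Sum>\<^sub>\<infinity>z. F z)"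
proof -
  define A where "A n k' = {1 - q * k'..q * int n - q * k'}" for n :: nat and k'
  define w where "w n z = (1 / real n) * (\<Sum>k' = 1..int n. indicat_real (A n k') z)" for n z
  have indF: "integrable (count_space UNIV) (\<lambda>z. indicat_real S z *\<^sub>R F z)" for S
    using F by (intro integrable_mult_indicator) auto
  have as_integral: "(1 / real n) *\<^sub>R (\<Sum>k' = 1..int n. \<Sum>k = 1..q * int n. F (k - q * k'))
      = (\<integral>z. w n z *\<^sub>R F z \<partial>count_space UNIV)" for n
  proof -
    have "(\<Sum>k = 1..q * int n. F (k - q * k')) = (\<integral>z. indicat_real (A n k') z *\<^sub>R F z \<partial>count_space UNIV)" for k'
    proof -
      have "(\<Sum>k = 1..q * int n. F (k - q * k')) = (\<Sum>z\<in>A n k'. F z)"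
        by (rule sum.reindex_bij_witness[of _ "\<lambda>z. z + q * k'" "\<lambda>k. k - q * k'"]) (auto simp: A_def)
      also have "\<dots> = (\<Sum>z\<in>A n k'. indicat_real (A n k') z *\<^sub>R F z)"
        by (intro sum.cong) auto
      also have "\<dots> = (\<Sum>z | z \<in> UNIV \<and> indicat_real (A n k') z *\<^sub>R F z \<noteq> 0. indicat_real (A n k') z *\<^sub>R F z)"
        by (rule sum.mono_neutral_right) (auto simp: A_def indicator_def)
      also have "\<dots> = (\<integral>z. indicat_real (A n k') z *\<^sub>R F z \<partial>count_space UNIV)"
      proof (rule lebesgue_integral_count_space_finite_support[symmetric])
        have "{a \<in> UNIV. indicat_real (A n k') a *\<^sub>R F a \<noteq> 0} \<subseteq> A n k'" by (auto simp: indicator_def)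
        then show "finite {a \<in> UNIV. indicat_real (A n k') a *\<^sub>R F a \<noteq> 0}"
          by (rule finite_subset) (simp add: A_def)
      qed
      finally show ?thesis .
    qed
    then have "(\<Sum>k' = 1..int n. \<Sum>k = 1..q * int n. F (k - q * k'))
        = (\<Sum>k' = 1..int n. \<integral>z. indicat_real (A n k') z *\<^sub>R F z \<partial>count_space UNIV)"
      by (rule sum.cong[OF refl])
    also have "\<dots> = (\<integral>z. (\<Sum>k' = 1..int n. indicat_real (A n k') z *\<^sub>R F z) \<partial>count_space UNIV)"
      by (rule Bochner_Integration.integral_sum[OF indF, symmetric])
    finally have "(1 / real n) *\<^sub>R (\<Sum>k' = 1..int n. \<Sum>k = 1..q * int n. F (k - q * k'))
        = (\<integral>z. (1 / real n) *\<^sub>R (\<Sum>k' = 1..int n. indicat_real (A n k') z *\<^sub>R F z) \<partial>count_space UNIV)"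
      by (simp only: integral_scaleR_right)
    then show ?thesis
      by (simp only: w_def scaleR_scaleR[symmetric] scaleR_sum_left)
  qed
  have w01: "0 \<le> w n z" "w n z \<le> 1" for n z
  proof -
    show "0 \<le> w n z" unfolding w_def by (intro mult_nonneg_nonneg sum_nonneg) auto
    have "(\<Sum>k' = 1..int n. indicat_real (A n k') z) \<le> (\<Sum>k' = 1..int n. 1)"
      by (intro sum_mono) (auto simp: indicator_def)
    then have "(\<Sum>k' = 1..int n. indicat_real (A n k') z) \<le> real n" by simp
    then show "w n z \<le> 1" by (cases "n = 0") (simp_all add: w_def field_simps)
  qed
  have w_lower: "1 - w n z \<le> (2 * \<bar>of_int z\<bar>) * inverse (real n)" if "0 < n" for n z
  proof -
    let ?bad = "{1..\<bar>z\<bar>} \<union> {int n - \<bar>z\<bar> + 1..int n}"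
    have "real n - (\<Sum>k' = 1..int n. indicat_real (A n k') z) = (\<Sum>k' = 1..int n. 1 - indicat_real (A n k') z)"
      by (simp add: sum_subtractf)
    also have "\<dots> \<le> (\<Sum>k' = 1..int n. indicat_real ?bad k')"
    proof (rule sum_mono)
      fix k' assume k': "k' \<in> {1..int n}"
      have "z \<in> A n k'" if "k' \<notin> ?bad"
      proof -
        have "\<bar>z\<bar> < k'" "k' \<le> int n - \<bar>z\<bar>" using that k' by auto
        moreover have "k' \<le> q * k'" "int n - k' \<le> q * (int n - k')"
          using q k' mult_right_mono[of 1 q k'] mult_right_mono[of 1 q "int n - k'"] by auto
        ultimately show ?thesis by (auto simp: A_def right_diff_distrib)
      qed
      then show "1 - indicat_real (A n k') z \<le> indicat_real ?bad k'"
        by (auto simp: indicator_def)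
    qed
    also have "\<dots> = (\<Sum>k'\<in>{1..int n} \<inter> ?bad. 1)"
      by (subst sum.inter_restrict) (auto simp: indicator_def intro!: sum.cong)
    also have "\<dots> = real (card ({1..int n} \<inter> ?bad))" by simp
    also have "\<dots> \<le> real (card ?bad)"
      by (intro of_nat_mono card_mono) auto
    also have "\<dots> \<le> real (card {1..\<bar>z\<bar>} + card {int n - \<bar>z\<bar> + 1..int n})"
      by (intro of_nat_mono card_Un_le)
    also have "\<dots> = 2 * \<bar>of_int z\<bar>" by simp
    finally have "real n - (\<Sum>k' = 1..int n. indicat_real (A n k') z) \<le> 2 * \<bar>of_int z\<bar>" .
    then have "(real n - (\<Sum>k' = 1..int n. indicat_real (A n k') z)) * inverse (real n)
        \<le> (2 * \<bar>of_int z\<bar>) * inverse (real n)"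
      by (rule mult_right_mono) simp
    moreover have "1 - w n z = (real n - (\<Sum>k' = 1..int n. indicat_real (A n k') z)) * inverse (real n)"
      using that by (simp add: w_def left_diff_distrib right_diff_distrib divide_inverse mult.commute)
    ultimately show ?thesis by simp
  qed
  have "(\<lambda>n. w n z) \<longlonglongrightarrow> 1" for z
  proof -
    have lim0: "(\<lambda>n. (2 * \<bar>of_int z\<bar>) * inverse (real n)) \<longlonglongrightarrow> 0"
      by (intro tendsto_mult_right_zero lim_inverse_n)
    have "(\<lambda>n. 1 - w n z) \<longlonglongrightarrow> 0"
    proof (rule tendsto_sandwich[OF _ _ tendsto_const lim0])
      show "\<forall>\<^sub>F n in sequentially. 0 \<le> 1 - w n z" using w01 by simp
      show "\<forall>\<^sub>F n in sequentially. 1 - w n z \<le> (2 * \<bar>of_int z\<bar>) * inverse (real n)"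
        using w_lower by (intro eventually_sequentiallyI[of 1]) auto
    qed
    from tendsto_diff[OF tendsto_const[of 1] this] show ?thesis by simp
  qed
  then have "(\<lambda>n. w n z *\<^sub>R F z) \<longlonglongrightarrow> 1 *\<^sub>R F z" for z
    by (intro tendsto_scaleR tendsto_const)
  then have "(\<lambda>n. \<integral>z. w n z *\<^sub>R F z \<partial>count_space UNIV) \<longlonglongrightarrow> (\<integral>z. F z \<partial>count_space UNIV)"
    using F w01
    by (intro integral_dominated_convergence[where w = "\<lambda>z. norm (F z)"])
      (auto intro!: mult_left_le_one_le)
  moreover have "(\<integral>z. F z \<partial>count_space UNIV) = (\<Sum>\<^sub>\<infinity>z. F z)"
    using infsetsum_infsum[of F UNIV] F by (simp add: infsetsum_def Infinite_Set_Sum.abs_summable_on_def)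
  ultimately show ?thesis unfolding as_integral by simp
qed

text \<open>The normalised double sum over all pairs of coefficients at octaves \<open>j\<close> and \<open>j'\<close>, for \<open>2 ^ m\<close> data
  points and a quantity that depends on the lag. The lag is measured in units of the gcd, and the
  division is exact.\<close>

definition octave_mean :: "nat \<Rightarrow> nat \<Rightarrow> (int \<Rightarrow> 'b::real_normed_vector) \<Rightarrow> nat \<Rightarrow> 'b" where
  "octave_mean j j' F m = (let K = num_coeffs (2 ^ m) j; K' = num_coeffs (2 ^ m) j' in
      (sqrt (real K) * sqrt (real K') * (1 / real K) * (1 / real K')) *\<^sub>R
        (\<Sum>k = 1..int K. \<Sum>k' = 1..int K'. F ((2 ^ j * k - 2 ^ j' * k') div gcd (2 ^ j) (2 ^ j'))))"

text \<open>If \<open>j \<le> j'\<close>, the gcd is \<open>2 ^ j\<close>, the lag is \<open>k - q k'\<close> with \<open>q = 2 ^ (j' - j)\<close>, and there are \<open>q\<close> times as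
  many coefficients at octave \<open>j\<close> as at octave \<open>j'\<close>. This is the lattice average, and the
  normalisation contributes \<open>1 / sqrt q\<close>.\<close>

lemma octave_average_le:
  fixes F :: "int \<Rightarrow> 'b::{banach, second_countable_topology}"
  assumes F: "integrable (count_space UNIV) F" and "j \<le> j'"
  shows "octave_mean j j' F
    \<longlonglongrightarrow> (2 powr (- (real j + real j') / 2) * real (gcd (2 ^ j) (2 ^ j'))) *\<^sub>R (\<Sum>\<^sub>\<infinity>z. F z)"
proof -
  obtain d where d: "j' = j + d" using \<open>j \<le> j'\<close> le_Suc_ex by blast
  define q :: int where "q = 2 ^ d"
  have gcdi: "gcd (2 ^ j) (2 ^ j') = (2 ^ j :: int)"
    by (simp add: d power_add)
  have gcdn: "gcd (2 ^ j) (2 ^ j') = (2 ^ j :: nat)"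
    by (simp add: d power_add)
  have lag: "(2 ^ j * k - 2 ^ j' * k') div gcd (2 ^ j) (2 ^ j') = k - q * k'" for k k' :: int
  proof -
    have "2 ^ j * k - 2 ^ j' * k' = 2 ^ j * (k - q * k')"
      by (simp add: d power_add q_def algebra_simps)
    then show ?thesis unfolding gcdi by simp
  qed
  have const: "2 powr (- (real j + real j') / 2) * real (gcd (2 ^ j) (2 ^ j')) = 1 / sqrt (2 ^ d)"
  proof -
    have "2 powr (- (real j + real j') / 2) * 2 ^ j = 2 powr (- (real j + real j') / 2) * 2 powr real j"
      by (simp add: powr_realpow)
    also have "\<dots> = 2 powr (- (real d / 2))"
      by (simp add: d field_simps flip: powr_add)
    also have "2 powr (- (real d / 2)) = 1 / sqrt (2 ^ d :: real)"
    proof -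
      have "sqrt (2 ^ d :: real) = (2 powr real d) powr (1 / 2)"
        by (simp add: powr_half_sqrt powr_realpow)
      then show ?thesis by (simp add: powr_powr powr_minus_divide)
    qed
    finally show ?thesis by (simp add: gcdn)
  qed
  define g where "g n = (1 / sqrt (2 ^ d)) *\<^sub>R ((1 / real n) *\<^sub>R (\<Sum>k' = 1..int n. \<Sum>k = 1..q * int n. F (k - q * k')))"
    for n :: nat
  have "(\<lambda>n. g n) \<longlonglongrightarrow> (1 / sqrt (2 ^ d)) *\<^sub>R (\<Sum>\<^sub>\<infinity>z. F z)"
    unfolding g_def by (intro tendsto_scaleR tendsto_const lattice_average F) (simp add: q_def)
  moreover have "filterlim (\<lambda>m::nat. 2 ^ (m - j') :: nat) sequentially sequentially"
  proof (rule filterlim_at_top_mono[OF filterlim_minus_const_nat_at_top[of j']])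
    show "\<forall>\<^sub>F m in sequentially. m - j' \<le> 2 ^ (m - j')"
      by (intro always_eventually allI less_imp_le less_exp)
  qed
  ultimately have "(\<lambda>m. g (2 ^ (m - j'))) \<longlonglongrightarrow> (1 / sqrt (2 ^ d)) *\<^sub>R (\<Sum>\<^sub>\<infinity>z. F z)"
    by (rule filterlim_compose)
  moreover have "\<forall>\<^sub>F m in sequentially. g (2 ^ (m - j')) = octave_mean j j' F m"
  proof (rule eventually_sequentiallyI[of j'])
    fix m assume m: "j' \<le> m"
    define n :: nat where "n = 2 ^ (m - j')"
    have n: "0 < n" by (simp add: n_def)
    have K': "num_coeffs (2 ^ m) j' = n"
      using m by (simp add: num_coeffs_def n_def power_diff)
    have K: "num_coeffs (2 ^ m) j = 2 ^ d * n"
    proof -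
      have "m = d + (m - j') + j" using m d by simp
      then have "(2::nat) ^ m = 2 ^ d * n * 2 ^ j" by (metis n_def power_add)
      then show ?thesis by (simp add: num_coeffs_def)
    qed
    have factor: "sqrt (real (2 ^ d * n)) * sqrt (real n) * (1 / real (2 ^ d * n)) * (1 / real n)
        = 1 / sqrt (2 ^ d) * (1 / real n)"
    proof -
      define s where "s = sqrt (2 ^ d :: real)"
      have s: "0 < s" "s * s = 2 ^ d" by (simp_all add: s_def)
      have root: "sqrt (real (2 ^ d * n)) * sqrt (real n) = s * real n"
        by (simp add: real_sqrt_mult s_def)
      have "real (2 ^ d * n) = s * s * real n" using s(2) by simp
      then show ?thesis
        unfolding root s_def[symmetric] using n s(1) by (simp only:) simp
    qed
    show "g (2 ^ (m - j')) = octave_mean j j' F m"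
      unfolding octave_mean_def Let_def K K' factor lag n_def[symmetric] g_def
      by (subst sum.swap) (simp add: q_def)
  qed
  ultimately show ?thesis
    unfolding const by (rule Lim_transform_eventually)
qed

text \<open>Exchanging the octaves changes the sign of the lag.\<close>

lemma octave_average:
  fixes F :: "int \<Rightarrow> 'b::{banach, second_countable_topology}"
  assumes F: "integrable (count_space UNIV) F"
  shows "octave_mean j j' F
    \<longlonglongrightarrow> (2 powr (- (real j + real j') / 2) * real (gcd (2 ^ j) (2 ^ j'))) *\<^sub>R (\<Sum>\<^sub>\<infinity>z. F z)"
proof (cases "j \<le> j'")
  case True
  then show ?thesis by (rule octave_average_le[OF F])
next
  case False
  define F' where "F' z = F (- z)" for z
  have bij: "bij_betw (uminus :: int \<Rightarrow> int) UNIV UNIV"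
    by (rule bij_betwI[of _ _ _ uminus]) auto
  have F': "integrable (count_space UNIV) F'"
    using abs_summable_on_reindex_bij_betw[OF bij, of F] F
    by (simp add: F'_def[abs_def] Infinite_Set_Sum.abs_summable_on_def)
  have inf: "(\<Sum>\<^sub>\<infinity>z. F' z) = (\<Sum>\<^sub>\<infinity>z. F z)"
    unfolding F'_def by (rule infsum_reindex_bij_betw[OF bij])
  have lag: "F' ((2 ^ j' * k' - 2 ^ j * k) div gcd (2 ^ j') (2 ^ j))
      = F ((2 ^ j * k - 2 ^ j' * k') div gcd (2 ^ j) (2 ^ j'))" for k k' :: int
  proof -
    let ?g = "gcd (2 ^ j) (2 ^ j') :: int"
    have "?g dvd 2 ^ j * k - 2 ^ j' * k'" by (intro dvd_diff dvd_mult2) auto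
    then have "(- (2 ^ j * k - 2 ^ j' * k')) div ?g = - ((2 ^ j * k - 2 ^ j' * k') div ?g)"
      by (rule dvd_neg_div)
    then show ?thesis by (simp add: F'_def gcd.commute)
  qed
  show ?thesis
    using octave_average_le[OF F', of j' j] False
    unfolding octave_mean_def[abs_def] Let_def lag inf
    by (subst sum.swap) (simp add: mult_ac add.commute gcd.commute)
qed

section \<open>The wavelet coefficients\<close>

text \<open>The facts established so far about the process and the wavelet. The constant \<open>C\<close> is the one of
  \<open>variance_function_growth\<close>.\<close>

locale wavelet_analysis = prob_space M
  for M :: "'w measure" +
  fixes B :: "real \<Rightarrow> 'w \<Rightarrow> real^'n" and H S :: "real^'n^'n" and C :: real
    and \<psi> :: "real \<Rightarrow> real" and r :: real and D :: "nat \<Rightarrow> int \<Rightarrow> 'w \<Rightarrow> real^'n"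
  assumes gaussian: "centered_gaussian_family M UNIV B"
    and covariance: "\<And>s t a b. (\<integral>w. B s w $ a * B t w $ b \<partial>M)
      = (variance_function H S s + variance_function H S t - variance_function H S (s - t)) $ a $ b / 2"
    and C_pos: "0 < C"
    and growth_norm: "\<And>t. L2_norm M (B t) \<le> C * (1 + \<bar>t\<bar>)"
    and growth: "\<And>t. norm (variance_function H S t) \<le> C * (1 + \<bar>t\<bar>)\<^sup>2"
    and wavelet: "compact_wavelet \<psi> r"
    and coeff: "is_wavelet_coeff M B \<psi> D"
begin

abbreviation V :: "'n \<Rightarrow> 'n \<Rightarrow> real \<Rightarrow> real" where
  "V a b u \<equiv> variance_function H S u $ a $ b"

abbreviation \<tau> :: "nat \<Rightarrow> int \<Rightarrow> real \<Rightarrow> real" where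
  "\<tau> j k z \<equiv> 2 ^ j * z + 2 ^ j * of_int k"

lemma B_L2: "L2_fun M (B t)"
  by (rule centered_gaussian_family_L2[OF gaussian]) simp

lemma D_ms_integral: "has_ms_integral M (\<lambda>z w. \<psi> z *\<^sub>R B (\<tau> j k z) w) (D j k)"
  using coeff by (simp add: is_wavelet_coeff_def)

lemma D_L2: "L2_fun M (\<lambda>w. D j k w $ a)"
  by (rule L2_fun_component[OF has_ms_integral_L2[OF D_ms_integral]])

lemma \<psi>_measurable [measurable]: "\<psi> \<in> borel_measurable borel"
  by (rule wavelet_measurable[OF wavelet])

lemma \<psi>_integrable: "integrable lborel \<psi>"
  by (rule wavelet_integrable[OF wavelet])

lemma \<psi>_mean_zero: "(\<integral>z. \<psi> z \<partial>lborel) = 0"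
  using vanishing_moment[OF wavelet, of 0] by simp

lemma V_measurable [measurable]: "(\<lambda>u. V a b u) \<in> borel_measurable borel"
  by (rule borel_measurable_matrix_component[OF borel_measurable_variance_function])

lemma V_bound: "\<bar>u\<bar> \<le> R \<Longrightarrow> \<bar>V a b u\<bar> \<le> C * (1 + R)\<^sup>2"
proof -
  assume u: "\<bar>u\<bar> \<le> R"
  have "\<bar>V a b u\<bar> \<le> norm (variance_function H S u)"
    by (rule order.trans[OF component_le_norm_cart Finite_Cartesian_Product.norm_nth_le])
  also have "\<dots> \<le> C * (1 + \<bar>u\<bar>)\<^sup>2" by (rule growth)
  also have "\<dots> \<le> C * (1 + R)\<^sup>2" using u C_pos by (intro mult_left_mono power_mono) auto
  finally show ?thesis .
qed

lemma \<tau>_bound: "\<bar>z\<bar> \<le> r \<Longrightarrow> \<bar>\<tau> j k z\<bar> \<le> 2 ^ j * r + 2 ^ j * \<bar>of_int k\<bar>"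
  by (rule order.trans[OF abs_triangle_ineq]) (simp add: abs_mult)

lemma \<psi>_mult_integrable:
  assumes [measurable]: "f \<in> borel_measurable borel" and bound: "\<And>z. \<bar>z\<bar> \<le> r \<Longrightarrow> \<bar>f z\<bar> \<le> K"
  shows "integrable lborel (\<lambda>z. \<psi> z * f z)"
proof (rule Bochner_Integration.integrable_bound)
  show "integrable lborel (\<lambda>z. K * \<psi> z)" using \<psi>_integrable by simp
  have "\<bar>\<psi> z * f z\<bar> \<le> \<bar>K * \<psi> z\<bar>" for z
  proof (cases "\<psi> z = 0")
    case False
    then have "\<bar>f z\<bar> \<le> \<bar>K\<bar>" using bound[OF wavelet_support[OF wavelet]] by fastforce
    from mult_left_mono[OF this abs_ge_zero[of "\<psi> z"]] show ?thesis
      by (simp add: abs_mult mult.commute)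
  qed simp
  then show "AE z in lborel. norm (\<psi> z * f z) \<le> norm (K * \<psi> z)" by simp
qed measurable

text \<open>Pairing twice turns the covariance of two coefficients into a double wavelet integral of the
  covariance of \<open>B\<close>. Its summands that depend on one argument only disappear because \<open>\<psi>\<close> has mean
  zero; the remaining one depends on the difference of the arguments, which is why only the lag
  \<open>2 ^ j * k - 2 ^ j' * k'\<close> matters.\<close>

lemma D_B_covariance:
  "(\<integral>w. D j k w $ b * B s w $ a \<partial>M)
    = (\<integral>z. \<psi> z * V a b (\<tau> j k z) \<partial>lborel) / 2 - (\<integral>z. \<psi> z * V a b (s - \<tau> j k z) \<partial>lborel) / 2"
proof -
  have pt: "(\<integral>w. (\<psi> z *\<^sub>R B (\<tau> j k z) w) $ b * B s w $ a \<partial>M)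
      = \<psi> z * ((V a b s + V a b (\<tau> j k z) - V a b (s - \<tau> j k z)) / 2)" for z
  proof -
    have "(\<integral>w. (\<psi> z *\<^sub>R B (\<tau> j k z) w) $ b * B s w $ a \<partial>M) = (\<integral>w. \<psi> z * (B s w $ a * B (\<tau> j k z) w $ b) \<partial>M)"
      by (intro Bochner_Integration.integral_cong) auto
    also have "\<dots> = \<psi> z * (\<integral>w. B s w $ a * B (\<tau> j k z) w $ b \<partial>M)"
      by (rule integral_mult_right_zero)
    finally show ?thesis unfolding covariance by simp
  qed
  have int: "integrable lborel (\<lambda>z. \<psi> z * V a b (\<tau> j k z))" "integrable lborel (\<lambda>z. \<psi> z * V a b (s - \<tau> j k z))"
  proof -
    show "integrable lborel (\<lambda>z. \<psi> z * V a b (\<tau> j k z))"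
      by (rule \<psi>_mult_integrable[OF _ V_bound[OF \<tau>_bound]]) measurable
    have "\<bar>s - \<tau> j k z\<bar> \<le> \<bar>s\<bar> + (2 ^ j * r + 2 ^ j * \<bar>of_int k\<bar>)" if "\<bar>z\<bar> \<le> r" for z
      using \<tau>_bound[OF that, of j k] by linarith
    then show "integrable lborel (\<lambda>z. \<psi> z * V a b (s - \<tau> j k z))"
      by (intro \<psi>_mult_integrable[OF _ V_bound]) measurable
  qed
  have "(\<integral>w. D j k w $ b * B s w $ a \<partial>M)
      = (\<integral>z. (\<integral>w. (\<psi> z *\<^sub>R B (\<tau> j k z) w) $ b * B s w $ a \<partial>M) \<partial>lborel)"
    by (rule has_ms_integral_pairing(2)[OF D_ms_integral L2_fun_component[OF B_L2], symmetric])
      (unfold pt, measurable)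
  also have "\<dots> = (\<integral>z. (V a b s / 2) * \<psi> z + (\<psi> z * V a b (\<tau> j k z)) / 2 - (\<psi> z * V a b (s - \<tau> j k z)) / 2 \<partial>lborel)"
    unfolding pt by (intro Bochner_Integration.integral_cong) (auto simp: field_simps)
  also have "\<dots> = (V a b s / 2) * (\<integral>z. \<psi> z \<partial>lborel) + (\<integral>z. \<psi> z * V a b (\<tau> j k z) \<partial>lborel) / 2
      - (\<integral>z. \<psi> z * V a b (s - \<tau> j k z) \<partial>lborel) / 2"
    using int \<psi>_integrable by simp
  finally show ?thesis by (simp add: \<psi>_mean_zero)
qed

lemma D_B_pairing_measurable:
  "(\<lambda>z. \<integral>w. (\<psi> z *\<^sub>R B (\<tau> j k z) w) $ a * D j' k' w $ b \<partial>M) \<in> borel_measurable borel"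
proof -
  have "(\<integral>w. (\<psi> z *\<^sub>R B (\<tau> j k z) w) $ a * D j' k' w $ b \<partial>M)
      = \<psi> z * (\<integral>w. D j' k' w $ b * B (\<tau> j k z) w $ a \<partial>M)" for z
    by (subst integral_mult_right_zero[symmetric]) (simp add: mult_ac)
  moreover have "(\<lambda>z. \<integral>z'. \<psi> z' * V a b (\<tau> j k z - \<tau> j' k' z') \<partial>lborel) \<in> borel_measurable borel"
    by (rule lborel.borel_measurable_lebesgue_integral) measurable
  ultimately show ?thesis
    unfolding D_B_covariance by simp
qed

lemma D_covariance:
  "(\<integral>w. D j k w $ a * D j' k' w $ b \<partial>M)
    = Omega \<psi> H S j j' ((2 ^ j * k - 2 ^ j' * k') div gcd (2 ^ j) (2 ^ j')) $ a $ b"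
proof -
  define F where "F z z' = (\<psi> z * \<psi> z') *\<^sub>R V a b (\<tau> j k z - \<tau> j' k' z')" for z z'
  define c where "c = (\<integral>z. \<psi> z * V a b (\<tau> j' k' z) \<partial>lborel) / 2"
  let ?R = "(2 ^ j * r + 2 ^ j * \<bar>of_int k\<bar>) + (2 ^ j' * r + 2 ^ j' * \<bar>of_int k'\<bar>) :: real"
  have "norm (F z z') \<le> (C * (1 + ?R)\<^sup>2) * (\<bar>\<psi> z\<bar> * \<bar>\<psi> z'\<bar>)" for z z'
    unfolding F_def
  proof (rule wavelet_product_bound[OF wavelet])
    fix z z' assume "\<bar>z\<bar> \<le> r" "\<bar>z'\<bar> \<le> r"
    then have "\<bar>\<tau> j k z - \<tau> j' k' z'\<bar> \<le> ?R"
      using \<tau>_bound[of z j k] \<tau>_bound[of z' j' k'] by linarith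
    then show "norm (V a b (\<tau> j k z - \<tau> j' k' z')) \<le> C * (1 + ?R)\<^sup>2"
      unfolding real_norm_def by (rule V_bound)
  qed
  moreover have "case_prod F \<in> borel_measurable (borel \<Otimes>\<^sub>M borel)"
    unfolding F_def by measurable
  ultimately have int: "integrable lborel (\<lambda>z. \<integral>z'. F z z' \<partial>lborel)"
    using double_integral_bound(2)[OF \<psi>_integrable, of F] by blast
  have pt: "(\<integral>w. (\<psi> z *\<^sub>R B (\<tau> j k z) w) $ a * D j' k' w $ b \<partial>M)
      = c * \<psi> z - (\<integral>z'. F z z' \<partial>lborel) / 2" for z
  proof -
    have "(\<integral>w. (\<psi> z *\<^sub>R B (\<tau> j k z) w) $ a * D j' k' w $ b \<partial>M)
        = \<psi> z * (\<integral>w. D j' k' w $ b * B (\<tau> j k z) w $ a \<partial>M)"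
      by (subst integral_mult_right_zero[symmetric]) (simp add: mult_ac)
    also have "\<dots> = c * \<psi> z - \<psi> z * (\<integral>z'. \<psi> z' * V a b (\<tau> j k z - \<tau> j' k' z') \<partial>lborel) / 2"
      unfolding D_B_covariance c_def by (simp add: algebra_simps)
    also have "\<psi> z * (\<integral>z'. \<psi> z' * V a b (\<tau> j k z - \<tau> j' k' z') \<partial>lborel) = (\<integral>z'. F z z' \<partial>lborel)"
      by (subst integral_mult_right_zero[symmetric]) (simp only: F_def[abs_def] real_scaleR_def mult.assoc)
    finally show ?thesis .
  qed
  have "(\<integral>w. D j k w $ a * D j' k' w $ b \<partial>M)
      = (\<integral>z. (\<integral>w. (\<psi> z *\<^sub>R B (\<tau> j k z) w) $ a * D j' k' w $ b \<partial>M) \<partial>lborel)"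
    by (rule has_ms_integral_pairing(2)[OF D_ms_integral D_L2 D_B_pairing_measurable, symmetric])
  also have "\<dots> = - 1/2 * (\<integral>z. (\<integral>z'. F z z' \<partial>lborel) \<partial>lborel)"
    unfolding pt using int \<psi>_integrable by (simp add: \<psi>_mean_zero)
  also have "\<dots> = Omega \<psi> H S j j' ((2 ^ j * k - 2 ^ j' * k') div gcd (2 ^ j) (2 ^ j')) $ a $ b"
  proof -
    have "gcd (2 ^ j) (2 ^ j') dvd 2 ^ j * k - 2 ^ j' * k'"
      by (intro dvd_diff dvd_mult2) auto
    then have "of_int ((2 ^ j * k - 2 ^ j' * k') div gcd (2 ^ j) (2 ^ j')) * real_of_int (gcd (2 ^ j) (2 ^ j'))
        = of_int (2 ^ j * k - 2 ^ j' * k')"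
      by (metis dvd_div_mult_self of_int_mult)
    moreover have "real_of_int (gcd (2 ^ j) (2 ^ j')) = real (gcd (2 ^ j) (2 ^ j'))"
      by (metis gcd_int_int_eq of_int_of_nat_eq of_nat_numeral of_nat_power)
    ultimately have lag: "of_int ((2 ^ j * k - 2 ^ j' * k') div gcd (2 ^ j) (2 ^ j')) * real (gcd (2 ^ j) (2 ^ j'))
        = 2 ^ j * of_int k - 2 ^ j' * of_int k'"
      by simp
    have arg: "2 ^ j * z - 2 ^ j' * z' + (2 ^ j * of_int k - 2 ^ j' * of_int k') = \<tau> j k z - \<tau> j' k' z'" for z z' :: real
      by simp
    show ?thesis
      unfolding Omega_component[OF wavelet growth] lag F_def real_scaleR_def arg ..
  qed
  finally show ?thesis .
qed

lemma B_second_moment: "(\<integral>w. (B s w $ a)\<^sup>2 \<partial>M) = V a a s"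
  using covariance[of s a s a] by (simp add: power2_eq_square)

lemma V_nonneg: "0 \<le> V a a s"
  unfolding B_second_moment[symmetric] by simp

lemma L2_norm_B: "L2_norm M (\<lambda>w. B s w $ a) = sqrt (V a a s)"
  by (simp add: L2_norm_def B_second_moment)

lemma D_approx:
  assumes "0 < \<epsilon>"
  shows "\<exists>R\<in>linear_span B. L2_norm M (\<lambda>w. D j k w $ a - R w) < \<epsilon>"
proof (rule ms_integral_approx_from_span
    [where \<tau> = "\<tau> j k", OF B_L2 D_ms_integral _ D_B_pairing_measurable[of j k a j k a] _ assms])
  show "(\<lambda>z. \<integral>w. (\<psi> z *\<^sub>R B (\<tau> j k z) w) $ a * B t w $ b \<partial>M) \<in> borel_measurable borel" for t b
  proof -
    have pt: "(\<integral>w. (\<psi> z *\<^sub>R B (\<tau> j k z) w) $ a * B t w $ b \<partial>M)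
        = \<psi> z * ((V a b (\<tau> j k z) + V a b t - V a b (\<tau> j k z - t)) / 2)" for z
      unfolding vector_scaleR_component real_scaleR_def mult.assoc integral_mult_right_zero covariance by simp
    show ?thesis unfolding pt by measurable
  qed
  have norm: "L2_norm M (\<lambda>w. (\<psi> z *\<^sub>R B (\<tau> j k z) w) $ a) = \<bar>\<psi> z * sqrt (V a a (\<tau> j k z))\<bar>" for z
  proof -
    have "(\<integral>w. (norm ((\<psi> z *\<^sub>R B (\<tau> j k z) w) $ a))\<^sup>2 \<partial>M) = (\<psi> z)\<^sup>2 * V a a (\<tau> j k z)"
      unfolding B_second_moment[symmetric] by (simp add: power_mult_distrib)
    moreover have "0 \<le> V a a (\<tau> j k z)" by (rule V_nonneg)
    ultimately show ?thesis
      unfolding L2_norm_def by (simp only: real_sqrt_mult real_sqrt_abs abs_mult) (simp only: abs_of_nonneg real_sqrt_ge_zero)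
  qed
  have "\<bar>sqrt (V a a (\<tau> j k z))\<bar> \<le> C * (1 + (2 ^ j * r + 2 ^ j * \<bar>of_int k\<bar>))" if z: "\<bar>z\<bar> \<le> r" for z
  proof -
    have "\<bar>sqrt (V a a (\<tau> j k z))\<bar> = L2_norm M (\<lambda>w. B (\<tau> j k z) w $ a)"
      unfolding L2_norm_B by (intro abs_of_nonneg real_sqrt_ge_zero V_nonneg)
    also have "\<dots> \<le> L2_norm M (B (\<tau> j k z))" by (rule L2_norm_component[OF B_L2])
    also have "\<dots> \<le> C * (1 + \<bar>\<tau> j k z\<bar>)" by (rule growth_norm)
    also have "\<dots> \<le> C * (1 + (2 ^ j * r + 2 ^ j * \<bar>of_int k\<bar>))"
      using \<tau>_bound[OF z] C_pos by (intro mult_left_mono) auto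
    finally show ?thesis .
  qed
  then have "integrable lborel (\<lambda>z. \<psi> z * sqrt (V a a (\<tau> j k z)))"
    by (intro \<psi>_mult_integrable) measurable
  then show "integrable lborel (\<lambda>z. L2_norm M (\<lambda>w. (\<psi> z *\<^sub>R B (\<tau> j k z) w) $ a))"
    unfolding norm by (rule integrable_abs)
qed

lemma span_gaussian: "R \<in> linear_span B \<Longrightarrow> centered_gaussian M R"
  using gaussian unfolding linear_span_def centered_gaussian_family_def by auto

text \<open>Coefficients are mean-square limits of linear combinations of \<open>B\<close>, so they are jointly Gaussian; four
  of them suffice for Isserlis' formula.\<close>

lemma D_combination_gaussian:
  "centered_gaussian M (\<lambda>w. D j1 k1 w $ a1 + x * D j2 k2 w $ a2 + y * D j3 k3 w $ a3 + z * D j4 k4 w $ a4)"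
proof (rule centered_gaussian_L2_limit)
  note add = L2_fun_add[OF _ L2_fun_scaleR[OF D_L2], unfolded real_scaleR_def]
  note approx = L2_approx_add_mult[OF B_L2 _ D_L2 _ D_approx]
  show "L2_fun M (\<lambda>w. D j1 k1 w $ a1 + x * D j2 k2 w $ a2 + y * D j3 k3 w $ a3 + z * D j4 k4 w $ a4)"
    by (intro add D_L2)
  fix \<epsilon> :: real assume "0 < \<epsilon>"
  then have "\<exists>R\<in>linear_span B. L2_norm M (\<lambda>w. D j1 k1 w $ a1 + x * D j2 k2 w $ a2 + y * D j3 k3 w $ a3
      + z * D j4 k4 w $ a4 - R w) < \<epsilon>"
    by (intro approx add D_L2 D_approx)
  then show "\<exists>R. centered_gaussian M R \<and> L2_norm M (\<lambda>w. D j1 k1 w $ a1 + x * D j2 k2 w $ a2 + y * D j3 k3 w $ a3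
      + z * D j4 k4 w $ a4 - R w) < \<epsilon>"
    using span_gaussian by blast
qed

abbreviation lag :: "nat \<Rightarrow> nat \<Rightarrow> int \<Rightarrow> int \<Rightarrow> int" where
  "lag j j' k k' \<equiv> (2 ^ j * k - 2 ^ j' * k') div gcd (2 ^ j) (2 ^ j')"

lemma D_covariance_matrix:
  "(\<integral>w. outer (D j k w) (D j' k' w) \<partial>M) = Omega \<psi> H S j j' (lag j j' k k')"
proof -
  have D: "L2_fun M (D j k)" for j k by (rule has_ms_integral_L2[OF D_ms_integral])
  have "(\<integral>w. outer (D j k w) (D j' k' w) \<partial>M) $ a $ b = Omega \<psi> H S j j' (lag j j' k k') $ a $ b" for a b
    unfolding matrix_integral_component[OF L2_fun_bounded_bilinear_integrable[OF bounded_bilinear_outer D D]]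
      D_covariance[symmetric] by (simp add: outer_def)
  then show ?thesis by (simp add: vec_eq_iff)
qed

definition Omega_products :: "nat \<Rightarrow> nat \<Rightarrow> 'n \<Rightarrow> 'n \<Rightarrow> 'n \<Rightarrow> 'n \<Rightarrow> int \<Rightarrow> real" where
  "Omega_products j j' i1 i2 l1 l2 z =
     Omega \<psi> H S j j' z $ i1 $ l1 * Omega \<psi> H S j j' z $ i2 $ l2
     + Omega \<psi> H S j j' z $ i1 $ l2 * Omega \<psi> H S j j' z $ i2 $ l1"

text \<open>By Isserlis' formula, the pairing inside each octave is the product of the means, and the two pairings
  across the octaves make up the covariance.\<close>

lemma wavelet_variance_covariance:
  fixes j j' \<nu> :: nat and i1 i2 l1 l2 :: 'n
  defines "K \<equiv> num_coeffs \<nu> j" and "K' \<equiv> num_coeffs \<nu> j'"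
  defines "U \<equiv> \<lambda>w. wavelet_variance D \<nu> j w $ i1 $ i2" and "U' \<equiv> \<lambda>w. wavelet_variance D \<nu> j' w $ l1 $ l2"
  shows "(\<integral>w. (U w - (\<integral>v. U v \<partial>M)) * (U' w - (\<integral>v. U' v \<partial>M)) \<partial>M)
    = (1 / real K) * (1 / real K') *
      (\<Sum>k = 1..int K. \<Sum>k' = 1..int K'. Omega_products j j' i1 i2 l1 l2 (lag j j' k k'))"
proof -
  define P where "P k w = D j k w $ i1 * D j k w $ i2" for k w
  define P' where "P' k w = D j' k w $ l1 * D j' k w $ l2" for k w
  have U: "U w = (1 / real K) * (\<Sum>k = 1..int K. P k w)" for w
    by (simp add: U_def wavelet_variance_def K_def P_def outer_def)
  have U': "U' w = (1 / real K') * (\<Sum>k = 1..int K'. P' k w)" for w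
    by (simp add: U'_def wavelet_variance_def K'_def P'_def outer_def)
  have P: "integrable M (P k)" and P': "integrable M (P' k)" for k
    unfolding P_def[abs_def] P'_def[abs_def] by (rule L2_fun_integrable_mult[OF D_L2 D_L2])+
  note iss = isserlis[OF D_combination_gaussian D_L2 D_L2 D_L2 D_L2]
  have PP': "integrable M (\<lambda>w. P k w * P' k' w)" for k k'
    using iss(1)[of j k i1 j k i2 j' k' l1 j' k' l2] by (simp add: P_def P'_def mult.assoc)
  have EPP': "(\<integral>w. P k w * P' k' w \<partial>M) = (\<integral>w. P k w \<partial>M) * (\<integral>w. P' k' w \<partial>M)
      + Omega_products j j' i1 i2 l1 l2 (lag j j' k k')" for k k'
    using iss(2)[of j k i1 j k i2 j' k' l1 j' k' l2]
    unfolding D_covariance[of j k _ j'] Omega_products_def by (simp add: P_def P'_def mult.assoc)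
  have UU': "U w * U' w = (1 / real K) * (1 / real K') * (\<Sum>k = 1..int K. \<Sum>k' = 1..int K'. P k w * P' k' w)" for w
    by (simp add: U U' sum_product)
  have int: "integrable M U" "integrable M U'" "integrable M (\<lambda>w. U w * U' w)"
    unfolding UU' unfolding U[abs_def] U'[abs_def]
    by (intro integrable_mult_right Bochner_Integration.integrable_sum P P' PP')+
  have EU: "(\<integral>w. U w \<partial>M) = (1 / real K) * (\<Sum>k = 1..int K. \<integral>w. P k w \<partial>M)"
    unfolding U integral_mult_right_zero using P by simp
  have EU': "(\<integral>w. U' w \<partial>M) = (1 / real K') * (\<Sum>k = 1..int K'. \<integral>w. P' k w \<partial>M)"
    unfolding U' integral_mult_right_zero using P' by simp
  have EUU': "(\<integral>w. U w * U' w \<partial>M)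
      = (1 / real K) * (1 / real K') * (\<Sum>k = 1..int K. \<Sum>k' = 1..int K'. \<integral>w. P k w * P' k' w \<partial>M)"
    unfolding UU' integral_mult_right_zero using PP' by simp
  have "(\<integral>w. (U w - (\<integral>v. U v \<partial>M)) * (U' w - (\<integral>v. U' v \<partial>M)) \<partial>M)
      = (\<integral>w. U w * U' w - (\<integral>v. U' v \<partial>M) * U w - (\<integral>v. U v \<partial>M) * U' w + (\<integral>v. U v \<partial>M) * (\<integral>v. U' v \<partial>M) \<partial>M)"
    by (intro Bochner_Integration.integral_cong) (auto simp: algebra_simps)
  also have "\<dots> = (\<integral>w. U w * U' w \<partial>M) - (\<integral>w. U w \<partial>M) * (\<integral>w. U' w \<partial>M)"
    using int by (simp add: prob_space)
  also have "\<dots> = (1 / real K) * (1 / real K') *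
      (\<Sum>k = 1..int K. \<Sum>k' = 1..int K'. Omega_products j j' i1 i2 l1 l2 (lag j j' k k'))"
  proof -
    have "(\<Sum>k = 1..int K. \<Sum>k' = 1..int K'. \<integral>w. P k w * P' k' w \<partial>M)
        = (\<Sum>k = 1..int K. \<integral>w. P k w \<partial>M) * (\<Sum>k = 1..int K'. \<integral>w. P' k w \<partial>M)
          + (\<Sum>k = 1..int K. \<Sum>k' = 1..int K'. Omega_products j j' i1 i2 l1 l2 (lag j j' k k'))"
      by (simp add: EPP' sum.distrib sum_product)
    then show ?thesis
      unfolding EU EU' EUU' by (simp add: distrib_left)
  qed
  finally show ?thesis .
qed

lemma Omega_product_bound:
  obtains K where "0 \<le> K" and "\<And>z a b c d. \<bar>Omega \<psi> H S j j' z $ a $ b * Omega \<psi> H S j j' z $ c $ d\<bar>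
    \<le> K * (1 / (1 + (of_int z)\<^sup>2))"
proof -
  obtain K where K: "0 \<le> K" "\<And>z a b. \<bar>Omega \<psi> H S j j' z $ a $ b\<bar> \<le> K / (1 + (of_int z)\<^sup>2)"
    using Omega_decay[OF wavelet growth C_pos] by metis
  show thesis
  proof (rule that[of "K * K"])
    fix z and a b c d :: 'n
    have pos: "1 \<le> 1 + (of_int z :: real)\<^sup>2" by simp
    have "\<bar>Omega \<psi> H S j j' z $ c $ d\<bar> \<le> K / (1 + (of_int z)\<^sup>2)" by (rule K(2))
    also have "\<dots> \<le> K / 1"
    proof (rule divide_left_mono[OF pos K(1)])
      show "0 < (1 + (of_int z :: real)\<^sup>2) * 1" by (simp add: add_pos_nonneg)
    qed
    finally have "\<bar>Omega \<psi> H S j j' z $ a $ b\<bar> * \<bar>Omega \<psi> H S j j' z $ c $ d\<bar> \<le> K / (1 + (of_int z)\<^sup>2) * K"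
      using K by (intro mult_mono) auto
    then show "\<bar>Omega \<psi> H S j j' z $ a $ b * Omega \<psi> H S j j' z $ c $ d\<bar> \<le> K * K * (1 / (1 + (of_int z)\<^sup>2))"
      by (simp add: abs_mult)
  qed (simp add: K(1))
qed

lemma integrable_Omega_products:
  "integrable (count_space UNIV) (Omega_products j j' i1 i2 l1 l2)"
proof -
  obtain K where K: "0 \<le> K" "\<And>z a b c d. \<bar>Omega \<psi> H S j j' z $ a $ b * Omega \<psi> H S j j' z $ c $ d\<bar>
    \<le> K * (1 / (1 + (of_int z)\<^sup>2))"
    using Omega_product_bound by metis
  have prod: "integrable (count_space UNIV) (\<lambda>z. Omega \<psi> H S j j' z $ a $ b * Omega \<psi> H S j j' z $ c $ d)" for a b c d
    by (rule Bochner_Integration.integrable_bound[OF integrable_mult_right[OF integrable_inverse_square_int, of K]])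
      (simp, unfold real_norm_def, intro AE_I2 order.trans[OF K(2) abs_ge_self])
  show ?thesis
    unfolding Omega_products_def[abs_def] by (intro Bochner_Integration.integrable_add prod)
qed

lemma integrable_kronecker_Omega:
  "integrable (count_space UNIV) (\<lambda>z. kronecker (Omega \<psi> H S j j' z) (Omega \<psi> H S j j' z))"
proof -
  obtain K where K: "0 \<le> K" "\<And>z a b c d. \<bar>Omega \<psi> H S j j' z $ a $ b * Omega \<psi> H S j j' z $ c $ d\<bar>
    \<le> K * (1 / (1 + (of_int z)\<^sup>2))"
    using Omega_product_bound by metis
  define L where "L = (\<Sum>i::'n \<times> 'n\<in>UNIV. \<Sum>k::'n \<times> 'n\<in>UNIV. K)"
  have "norm (kronecker (Omega \<psi> H S j j' z) (Omega \<psi> H S j j' z)) \<le> L * (1 / (1 + (of_int z)\<^sup>2))" for z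
  proof -
    have "norm (kronecker (Omega \<psi> H S j j' z) (Omega \<psi> H S j j' z))
        \<le> (\<Sum>i::'n \<times> 'n\<in>UNIV. \<Sum>k::'n \<times> 'n\<in>UNIV. K * (1 / (1 + (of_int z)\<^sup>2)))"
      by (rule order.trans[OF matrix_norm_le_sum])
        (unfold kronecker_def vec_lambda_beta, intro sum_mono K(2))
    also have "\<dots> = L * (1 / (1 + (of_int z)\<^sup>2))"
      by (simp add: L_def)
    finally show ?thesis .
  qed
  then show ?thesis
    by (intro Bochner_Integration.integrable_bound[OF integrable_mult_right[OF integrable_inverse_square_int, of L]])
      (simp, unfold real_norm_def, intro AE_I2 order.trans[OF _ abs_ge_self])
qed

lemma variance_covariance_limit:
  "(\<lambda>m. sqrt (real (num_coeffs (2 ^ m) j)) * sqrt (real (num_coeffs (2 ^ m) j')) *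
      (\<integral>w. (wavelet_variance D (2 ^ m) j w $ i1 $ i2 - (\<integral>v. wavelet_variance D (2 ^ m) j v $ i1 $ i2 \<partial>M))
        * (wavelet_variance D (2 ^ m) j' w $ l1 $ l2 - (\<integral>v. wavelet_variance D (2 ^ m) j' v $ l1 $ l2 \<partial>M)) \<partial>M))
    \<longlonglongrightarrow> 2 powr (- (real j + real j') / 2) * real (gcd (2 ^ j) (2 ^ j')) *
         (\<Sum>\<^sub>\<infinity>z. Omega_products j j' i1 i2 l1 l2 z)"
  using octave_average[OF integrable_Omega_products[of j j' i1 i2 l1 l2], of j j']
  unfolding octave_mean_def wavelet_variance_covariance Let_def real_scaleR_def by (simp only: mult.assoc)

end

theorem proposition3p3:
  fixes M :: "'w measure" and B :: "real \<Rightarrow> 'w \<Rightarrow> real^('n::{finite,linorder})"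
    and N :: "'v measure" and Bt :: "real set \<Rightarrow> 'v \<Rightarrow> complex^('n::{finite,linorder})"
    and H :: "real^('n::{finite,linorder})^('n::{finite,linorder})" and A :: "complex^('n::{finite,linorder})^('n::{finite,linorder})" and Sig :: "real^('n::{finite,linorder})^('n::{finite,linorder})"
    and \<psi> :: "real \<Rightarrow> real" and N\<^sub>\<psi> :: nat and \<alpha> :: real
    and D :: "nat \<Rightarrow> int \<Rightarrow> 'w \<Rightarrow> real^('n::{finite,linorder})"
    and j j' :: nat
  assumes "CARD('n) \<ge> 2"
    and "is_ofbm M B N Bt H A"
    and "time_reversible A"
    and "Sig = (\<integral>w. outer (B 1 w) (B 1 w) \<partial>M)"
    and "is_wavelet \<psi> N\<^sub>\<psi> \<alpha>"
    and "is_wavelet_coeff M B \<psi> D"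
  shows
    "(\<lambda>z. kronecker (Omega \<psi> H Sig j j' z) (Omega \<psi> H Sig j j' z)) summable_on (UNIV :: int set) \<and>
     (\<lambda>m. let \<nu> = 2 ^ m; K = num_coeffs \<nu> j; K' = num_coeffs \<nu> j' in
        (sqrt (real K) * sqrt (real K') * (1 / real K) * (1 / real K')) *\<^sub>R
          (\<Sum>k = 1..int K. \<Sum>k' = 1..int K'.
             kronecker (\<integral>w. outer (D j k w) (D j' k' w) \<partial>M) (\<integral>w. outer (D j k w) (D j' k' w) \<partial>M)))
       \<longlonglongrightarrow>
       (2 powr (- (real j + real j') / 2) * real (gcd (2 ^ j) (2 ^ j'))) *\<^sub>R
         (\<Sum>\<^sub>\<infinity>z\<in>(UNIV :: int set). kronecker (Omega \<psi> H Sig j j' z) (Omega \<psi> H Sig j j' z)) \<and>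
    (\<exists>G :: real^(('n::{finite,linorder}) upper_idx)^(('n::{finite,linorder}) upper_idx).
       (\<lambda>m. let \<nu> = 2 ^ m in
          (sqrt (real (num_coeffs \<nu> j)) * sqrt (real (num_coeffs \<nu> j'))) *\<^sub>R
            cov_matrix M (\<lambda>w. vec_S (wavelet_variance D \<nu> j w))
                         (\<lambda>w. vec_S (wavelet_variance D \<nu> j' w)))
         \<longlonglongrightarrow> G \<and>
       (\<forall>i1 i2 l1 l2. i1 \<le> i2 \<longrightarrow> l1 \<le> l2 \<longrightarrow>
          (\<lambda>z. Omega \<psi> H Sig j j' z $ i1 $ l1 * Omega \<psi> H Sig j j' z $ i2 $ l2
             + Omega \<psi> H Sig j j' z $ i1 $ l2 * Omega \<psi> H Sig j j' z $ i2 $ l1)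
            summable_on (UNIV :: int set) \<and>
          G $ Abs_upper_idx (i1, i2) $ Abs_upper_idx (l1, l2) =
            2 powr (- (real j + real j') / 2) * real (gcd (2 ^ j) (2 ^ j')) *
              (\<Sum>\<^sub>\<infinity>z\<in>(UNIV :: int set).
                 Omega \<psi> H Sig j j' z $ i1 $ l1 * Omega \<psi> H Sig j j' z $ i2 $ l2
               + Omega \<psi> H Sig j j' z $ i1 $ l2 * Omega \<psi> H Sig j j' z $ i2 $ l1)))"
proof -
  note B_L2 = ofbm_covariance(1)[OF assms(2-4)]
  note B_cov = ofbm_covariance(2)[OF assms(2-4)]
  obtain C where C: "0 < C" "\<And>t. L2_norm M (B t) \<le> C * (1 + \<bar>t\<bar>)"
    "\<And>t. norm (variance_function H Sig t) \<le> C * (1 + \<bar>t\<bar>)\<^sup>2"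
    using variance_function_growth[of M B H Sig, OF B_L2 B_cov] by blast
  obtain r where r: "compact_wavelet \<psi> r"
    using is_wavelet_compact[OF assms(5)] by blast
  have "prob_space M" "centered_gaussian_family M UNIV B"
    using assms(2) by (auto simp: is_ofbm_def)
  then interpret wavelet_analysis M B H Sig C \<psi> r D
    unfolding wavelet_analysis_def wavelet_analysis_axioms_def
    using B_cov C r assms(6) by blast
  define c where "c = 2 powr (- (real j + real j') / 2) * real (gcd (2 ^ j) (2 ^ j'))"
  define G :: "real^('n upper_idx)^('n upper_idx)" where
    "G = (\<chi> p q. c * (\<Sum>\<^sub>\<infinity>z. Omega_products j j' (fst (Rep_upper_idx p)) (snd (Rep_upper_idx p))
      (fst (Rep_upper_idx q)) (snd (Rep_upper_idx q)) z))"
  have cov_lim: "octave_mean j j' (\<lambda>z. kronecker (Omega \<psi> H Sig j j' z) (Omega \<psi> H Sig j j' z))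
      \<longlonglongrightarrow> c *\<^sub>R (\<Sum>\<^sub>\<infinity>z. kronecker (Omega \<psi> H Sig j j' z) (Omega \<psi> H Sig j j' z))"
    unfolding c_def by (rule octave_average[OF integrable_kronecker_Omega])
  have G_lim: "(\<lambda>m. (sqrt (real (num_coeffs (2 ^ m) j)) * sqrt (real (num_coeffs (2 ^ m) j'))) *\<^sub>R
      cov_matrix M (\<lambda>w. vec_S (wavelet_variance D (2 ^ m) j w)) (\<lambda>w. vec_S (wavelet_variance D (2 ^ m) j' w)))
    \<longlonglongrightarrow> G"
  proof (intro vec_tendstoI)
    fix p q :: "'n upper_idx"
    show "(\<lambda>m. ((sqrt (real (num_coeffs (2 ^ m) j)) * sqrt (real (num_coeffs (2 ^ m) j'))) *\<^sub>R
        cov_matrix M (\<lambda>w. vec_S (wavelet_variance D (2 ^ m) j w)) (\<lambda>w. vec_S (wavelet_variance D (2 ^ m) j' w))) $ p $ q)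
      \<longlonglongrightarrow> G $ p $ q"
      using variance_covariance_limit[of j j' "fst (Rep_upper_idx p)" "snd (Rep_upper_idx p)"
          "fst (Rep_upper_idx q)" "snd (Rep_upper_idx q)"]
      by (simp add: cov_matrix_def vec_S_def G_def c_def)
  qed
  have G_entry: "G $ Abs_upper_idx (i1, i2) $ Abs_upper_idx (l1, l2) = c * (\<Sum>\<^sub>\<infinity>z. Omega_products j j' i1 i2 l1 l2 z)"
    if "i1 \<le> i2" "l1 \<le> l2" for i1 i2 l1 l2
    using that by (simp add: G_def Abs_upper_idx_inverse)
  show ?thesis
    unfolding Let_def c_def[symmetric] Omega_products_def[symmetric]
    by (intro conjI exI[of _ G] allI impI integrable_count_space_summable_on
        integrable_kronecker_Omega integrable_Omega_products G_lim G_entry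
        cov_lim[unfolded octave_mean_def[abs_def] Let_def D_covariance_matrix[symmetric]])
qed

end
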